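(* Let $A$ be a domain with fraction field $K$, let $B=A^{[3]}$ and $\delta\in\mathrm{EXP}_A(B)$. Let $\{X,Y,Z\}\in\Gamma(B)$ be such that $X\in B^\delta$. Let $\delta_K\in\mathrm{EXP}_K(K^{[3]})$ be the extension of $\delta$ to $K^{[3]}=K\otimes_A B$, and suppose $\mathrm{rank}(\delta)=\mathrm{rank}(\delta_K)=2$. Then $\delta$ is triangular over $A$ if and only if $\delta$ is triangular over $A[X]$.
   Context: All rings are commutative with unity. For a domain $A$, $A^{[n]}$ denotes the polynomial ring in $n$ variables over $A$. Exponential map: for domains $A\subset B$, an exponential map on $B$ (over $A$) is an $A$-algebra homomorphism $\delta=\delta_t:B\to B[t]$ ($t$ an indeterminate) such that (1) composing $\delta_t$ with evaluation at $t=0$ gives the identity of $B$, and (2) $\delta_s\circ\delta_t=\delta_{s+t}$, where $\delta_s$ is extended to a homomorphism $B[t]\to B[s,t]$ by $\delta_s(t)=t$. $\mathrm{EXP}_A(B)$ is the set of all of these. The ring of invariants is $B^\delta=\{x\in B:\delta(x)=x\}$. A local slice of $\delta$ is an $x\in B$ such that $\delta(x)$ has minimal positive $t$-degree. Coordinate systems, rank: for $B=A^{[n]}$, a coordinate system of $B$ over $A$ is a system $\{X_1,\dots,X_n\}$ of elements of $B$ (listed in order) with $B=A[X_1,\dots,X_n]$; $\Gamma(B)$ is the set of all coordinate systems. For $\delta\in\mathrm{EXP}_A(B)$, $\mathrm{rank}(\delta)$ is the least integer $r\ge 0$ for which there is $\{X_1,\dots,X_n\}\in\Gamma(B)$ with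 $A[X_1,\dots,X_{n-r}]\subset B^\delta$. $\delta_K$: with $S=A\setminus\{0\}$ and $B=A^{[n]}$, one has $S^{-1}B=K^{[n]}$, and $\delta_K\in\mathrm{EXP}_K(K^{[n]})$ is defined by $\delta_K(b/s)=\delta(b)/s$ for $b\in B$, $s\in S$. The rank of $\delta_K$ is taken with respect to coordinate systems of $K^{[n]}$ over $K$. Triangular: $\delta$ on $B=A^{[n]}$ is triangular over $A$ if $\delta\in\mathrm{EXP}_A(B)$ and there is a coordinate system $\{X_1,\dots,X_n\}$ of $B$ over $A$ such that (a) $\delta(X_1)-X_1\in tA[t]$; (b) $\delta(X_i)-X_i\in tA[X_1,\dots,X_{i-1}][t]$ for all $i\ge2$; (c) if $i$ is the smallest index with $\delta(X_i)\ne X_i$, then $X_i$ is a local slice of $\delta$. "Triangular over $A[X]$" is this notion with base ring $A[X]$ when $B$ is viewed as $A[X]^{[2]}$. *)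

theory Defs
  imports "HOL-Computational_Algebra.Computational_Algebra"
begin

text \<open>
  The domains \<open>A \<subseteq> B\<close> are subrings of an ambient integral domain, given by their carrier sets.
  The same definitions then serve for the base rings \<open>A\<close>, \<open>A[X]\<close> and, inside the fraction field
  of the ambient domain, \<open>K\<close>.
\<close>

definition is_subring :: "'b::comm_ring_1 set \<Rightarrow> bool" where
  "is_subring R \<longleftrightarrow> 1 \<in> R \<and> (\<forall>x\<in>R. \<forall>y\<in>R. x - y \<in> R \<and> x * y \<in> R)"

definition adjoin :: "'b::comm_ring_1 set \<Rightarrow> 'b set \<Rightarrow> 'b set" where
  "adjoin A S = is_subring hull (A \<union> S)"

text \<open>
  A polynomial in \<open>n\<close> variables over \<open>A\<close> is given by a finite set \<open>E\<close> of exponent vectors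
  (lists of length \<open>n\<close>) together with a coefficient function on \<open>E\<close>.
\<close>

definition alg_independent :: "'b::comm_ring_1 set \<Rightarrow> 'b list \<Rightarrow> bool" where
  "alg_independent A xs \<longleftrightarrow>
     (\<forall>E c. finite E \<and> (\<forall>e\<in>E. length e = length xs \<and> c e \<in> A) \<and>
            (\<Sum>e\<in>E. c e * (\<Prod>i<length xs. (xs ! i) ^ (e ! i))) = 0
        \<longrightarrow> (\<forall>e\<in>E. c e = 0))"

definition is_polynomial_ring :: "'b::comm_ring_1 set \<Rightarrow> 'b set \<Rightarrow> nat \<Rightarrow> bool" where
  "is_polynomial_ring A B n \<longleftrightarrow>
     (\<exists>xs. length xs = n \<and> alg_independent A xs \<and> B = adjoin A (set xs))"

definition coord_systems :: "'b::comm_ring_1 set \<Rightarrow> 'b set \<Rightarrow> nat \<Rightarrow> 'b list set" where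
  "coord_systems A B n = {xs. length xs = n \<and> B = adjoin A (set xs)}"

definition polys_over :: "'b::zero set \<Rightarrow> 'b poly set" where
  "polys_over R = {p. \<forall>i. coeff p i \<in> R}"

text \<open>
  In the last condition \<open>B[s,t]\<close> is represented in \<^typ>\<open>'b poly poly\<close> with \<open>s\<close> the inner and \<open>t\<close>
  the outer variable.  The left-hand side applies \<open>\<delta>\<^sub>s\<close> to the coefficients of \<open>\<delta>\<^sub>t(x)\<close>; the
  right-hand side substitutes \<open>s + t\<close> for the variable of \<open>\<delta>(x)\<close>.  Values of \<open>\<delta>\<close> outside \<open>B\<close>
  are irrelevant throughout.
\<close>

definition EXP :: "'b::comm_ring_1 set \<Rightarrow> 'b set \<Rightarrow> ('b \<Rightarrow> 'b poly) set" where
  "EXP A B = {\<delta>.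
     (\<forall>x\<in>B. \<delta> x \<in> polys_over B) \<and>
     (\<forall>x\<in>B. \<forall>y\<in>B. \<delta> (x + y) = \<delta> x + \<delta> y \<and> \<delta> (x * y) = \<delta> x * \<delta> y) \<and>
     (\<forall>a\<in>A. \<delta> a = [:a:]) \<and>
     (\<forall>x\<in>B. poly (\<delta> x) 0 = x) \<and>
     (\<forall>x\<in>B. map_poly \<delta> (\<delta> x) = map_poly (\<lambda>c. [:c:]) (\<delta> x) \<circ>\<^sub>p [:[:0, 1:], 1:])}"

definition invariants :: "'b::comm_ring_1 set \<Rightarrow> ('b \<Rightarrow> 'b poly) \<Rightarrow> 'b set" where
  "invariants B \<delta> = {x\<in>B. \<delta> x = [:x:]}"

definition local_slice :: "'b::comm_ring_1 set \<Rightarrow> ('b \<Rightarrow> 'b poly) \<Rightarrow> 'b \<Rightarrow> bool" where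
  "local_slice B \<delta> x \<longleftrightarrow>
     x \<in> B \<and> degree (\<delta> x) > 0 \<and> (\<forall>y\<in>B. degree (\<delta> y) > 0 \<longrightarrow> degree (\<delta> x) \<le> degree (\<delta> y))"

definition exp_rank ::
    "'b::comm_ring_1 set \<Rightarrow> 'b set \<Rightarrow> nat \<Rightarrow> ('b \<Rightarrow> 'b poly) \<Rightarrow> nat" where
  "exp_rank A B n \<delta> =
     (LEAST r. r \<le> n \<and>
        (\<exists>xs\<in>coord_systems A B n. adjoin A (set (take (n - r) xs)) \<subseteq> invariants B \<delta>))"

text \<open>Indices start at 0, so the first variable of the coordinate system is \<open>xs ! 0\<close>.\<close>

definition triangular ::
    "'b::comm_ring_1 set \<Rightarrow> 'b set \<Rightarrow> nat \<Rightarrow> ('b \<Rightarrow> 'b poly) \<Rightarrow> bool" where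
  "triangular A B n \<delta> \<longleftrightarrow> \<delta> \<in> EXP A B \<and>
     (\<exists>xs\<in>coord_systems A B n.
        (0 < n \<longrightarrow> (\<exists>p\<in>polys_over A. \<delta> (xs ! 0) - [:xs ! 0:] = pCons 0 p)) \<and>
        (\<forall>i. 0 < i \<and> i < n \<longrightarrow>
           (\<exists>p\<in>polys_over (adjoin A (set (take i xs))). \<delta> (xs ! i) - [:xs ! i:] = pCons 0 p)) \<and>
        (\<forall>i<n. \<delta> (xs ! i) \<noteq> [:xs ! i:] \<and> (\<forall>j<i. \<delta> (xs ! j) = [:xs ! j:])
           \<longrightarrow> local_slice B \<delta> (xs ! i)))"

text \<open>
  The localization \<open>S\<^sup>-\<^sup>1B\<close> at \<open>S = A - {0}\<close>, inside the fraction field of the ambient domain.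
  For \<open>B = A\<close> it is the fraction field of \<open>A\<close>.
\<close>

definition localization :: "'b::idom set \<Rightarrow> 'b set \<Rightarrow> 'b fract set" where
  "localization A B = {to_fract b / to_fract s | b s. b \<in> B \<and> s \<in> A - {0}}"

text \<open>The extension \<open>\<delta>\<^sub>K(b/s) = \<delta>(b)/s\<close>; see \<open>extend_exp_frac\<close> below for well-definedness.\<close>

definition extend_exp ::
    "'b::idom set \<Rightarrow> 'b set \<Rightarrow> ('b \<Rightarrow> 'b poly) \<Rightarrow> 'b fract \<Rightarrow> 'b fract poly" where
  "extend_exp A B \<delta> q =
     (THE p. \<exists>b\<in>B. \<exists>s\<in>A - {0}. q = to_fract b / to_fract s \<and>
        p = smult (1 / to_fract s) (map_poly to_fract (\<delta> b)))"

lemma extend_exp_frac: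
  fixes A B :: "'b::idom set"
  assumes "A \<subseteq> B" and \<delta>: "\<delta> \<in> EXP A B" and b: "b \<in> B" and s: "s \<in> A - {0}"
  shows "extend_exp A B \<delta> (to_fract b / to_fract s) =
           smult (1 / to_fract s) (map_poly to_fract (\<delta> b))"
  unfolding extend_exp_def
proof (rule the_equality)
  show "\<exists>b'\<in>B. \<exists>s'\<in>A - {0}. to_fract b / to_fract s = to_fract b' / to_fract s' \<and>
      smult (1 / to_fract s) (map_poly to_fract (\<delta> b)) =
      smult (1 / to_fract s') (map_poly to_fract (\<delta> b'))"
    using b s by blast
next
  fix p
  assume "\<exists>b'\<in>B. \<exists>s'\<in>A - {0}. to_fract b / to_fract s = to_fract b' / to_fract s' \<and>
      p = smult (1 / to_fract s') (map_poly to_fract (\<delta> b'))"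
  then obtain b' s' where b': "b' \<in> B" and s': "s' \<in> A - {0}"
    and eq: "to_fract b / to_fract s = to_fract b' / to_fract s'"
    and p: "p = smult (1 / to_fract s') (map_poly to_fract (\<delta> b'))"
    by blast
  from eq s s' have "to_fract (b * s') = to_fract (b' * s)"
    by (simp add: field_simps)
  then have "b * s' = b' * s"
    by (simp only: to_fract_eq_iff)
  moreover have "\<delta> (x * y) = \<delta> x * \<delta> y" if "x \<in> B" "y \<in> B" for x y
    using \<delta> that by (simp add: EXP_def)
  ultimately have "\<delta> b * \<delta> s' = \<delta> b' * \<delta> s"
    using b b' s s' \<open>A \<subseteq> B\<close> by (metis DiffD1 subsetD)
  moreover have "\<delta> s = [:s:]" "\<delta> s' = [:s':]"
    using \<delta> s s' by (auto simp: EXP_def)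
  ultimately have *: "smult s' (\<delta> b) = smult s (\<delta> b')"
    by (simp add: mult.commute)
  show "p = smult (1 / to_fract s) (map_poly to_fract (\<delta> b))"
  proof (rule poly_eqI)
    fix i
    have "s' * coeff (\<delta> b) i = s * coeff (\<delta> b') i"
      using arg_cong[OF *, of "\<lambda>q. coeff q i"] by simp
    then have "to_fract s' * to_fract (coeff (\<delta> b) i) = to_fract s * to_fract (coeff (\<delta> b') i)"
      by (metis to_fract_mult)
    then show "coeff p i = coeff (smult (1 / to_fract s) (map_poly to_fract (\<delta> b))) i"
      using s s' by (simp add: p coeff_map_poly field_simps)
  qed
qed

lemma map_poly_pcompose_hom:
  fixes h :: "'a::comm_ring_1 \<Rightarrow> 'c::comm_ring_1"
  assumes "h 0 = 0" and add: "\<And>x y. h (x + y) = h x + h y" and mul: "\<And>x y. h (x * y) = h x * h y"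
  shows "map_poly h (p \<circ>\<^sub>p q) = map_poly h p \<circ>\<^sub>p map_poly h q"
proof (induction p)
  case 0 then show ?case by simp
next
  case (pCons a p)
  have s: "h (sum f S) = (\<Sum>i\<in>S. h (f i))" for f :: "nat \<Rightarrow> 'a" and S
    by (induction S rule: infinite_finite_induct) (auto simp: assms)
  have A: "map_poly h (p + q) = map_poly h p + map_poly h q" for p q
    by (rule poly_eqI) (simp add: coeff_map_poly assms)
  have M: "map_poly h (p * q) = map_poly h p * map_poly h q" for p q
    by (rule poly_eqI) (simp add: coeff_map_poly assms coeff_mult s)
  show ?case
    by (simp add: pcompose_pCons A M pCons.IH map_poly_pCons assms(1))
qed

lemma extend_exp_in_EXP:
  fixes A B :: "'b::idom set"
  assumes sA: "is_subring A" and sB: "is_subring B" and AB: "A \<subseteq> B" and \<delta>: "\<delta> \<in> EXP A B"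
  shows "extend_exp A B \<delta> \<in> EXP (localization A A) (localization A B)"
proof -
  let ?D = "extend_exp A B \<delta>"
  let ?F = "map_poly (to_fract :: 'b \<Rightarrow> 'b fract)"
  note D = extend_exp_frac[OF AB \<delta>]
  have cl: "x * y \<in> B" "x - y \<in> B" if "x \<in> B" "y \<in> B" for x y using sB that by (auto simp: is_subring_def)
  have clA: "x * y \<in> A" if "x \<in> A" "y \<in> A" for x y using sA that by (auto simp: is_subring_def)
  have zA: "0 \<in> A" using sA unfolding is_subring_def by (metis diff_self)
  have oA: "1 \<in> A" using sA unfolding is_subring_def by simp
  have z: "0 \<in> B" using zA AB by auto
  have clp: "x + y \<in> B" if "x \<in> B" "y \<in> B" for x y using cl(2)[OF that(1) cl(2)[OF z that(2)]] by simp
  have d1: "\<delta> x \<in> polys_over B" if "x \<in> B" for x using \<delta> that by (auto simp: EXP_def)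
  have dadd: "\<delta> (x + y) = \<delta> x + \<delta> y" if "x \<in> B" "y \<in> B" for x y using \<delta> that by (auto simp: EXP_def)
  have dmul: "\<delta> (x * y) = \<delta> x * \<delta> y" if "x \<in> B" "y \<in> B" for x y using \<delta> that by (auto simp: EXP_def)
  have dA: "\<delta> a = [:a:]" if "a \<in> A" for a using \<delta> that by (auto simp: EXP_def)
  have d0: "poly (\<delta> x) 0 = x" if "x \<in> B" for x using \<delta> that by (auto simp: EXP_def)
  have dc: "map_poly \<delta> (\<delta> x) = map_poly (\<lambda>c. [:c:]) (\<delta> x) \<circ>\<^sub>p [:[:0, 1:], 1:]" if "x \<in> B" for x 
    using \<delta> that by (auto simp: EXP_def)
  have dz: "\<delta> 0 = 0" using dA[OF zA] by simp
  have FA: "?F (p + q) = ?F p + ?F q" for p q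
    by (rule poly_eqI) (simp add: coeff_map_poly)
  have Fs: "?F (smult c q) = smult (to_fract c) (?F q)" for c q
    by (rule poly_eqI) (simp add: coeff_map_poly)
  have tfs: "to_fract (sum f S) = (\<Sum>i\<in>S. to_fract (f i))" for f :: "nat \<Rightarrow> 'b" and S
    by (induction S rule: infinite_finite_induct) auto
  have FM: "?F (p * q) = ?F p * ?F q" for p q
    by (rule poly_eqI) (simp add: coeff_map_poly coeff_mult tfs)
  have L: "\<exists>b\<in>B. \<exists>s\<in>A-{0}. x = to_fract b / to_fract s" if "x \<in> localization A B" for x
    using that by (auto simp: localization_def)
  have tf0: "(0::'b fract) = to_fract 0 / to_fract 1" by simp
  have D0: "?D 0 = 0" using D[of 0 1] z oA by (simp add: dz)
  show ?thesis
    unfolding EXP_def mem_Collect_eq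
  proof (intro conjI ballI)
    fix x assume "x \<in> localization A B"
    then obtain b s where b: "b \<in> B" "s \<in> A - {0}" and x: "x = to_fract b / to_fract s" using L by blast
    show "?D x \<in> polys_over (localization A B)"
      unfolding x D[OF b] polys_over_def localization_def using d1[OF b(1)] b(2)
      by (auto simp: coeff_map_poly polys_over_def)
    show "poly (?D x) 0 = x"
      unfolding x D[OF b] using d0[OF b(1)] by (simp add: poly_0_coeff_0 coeff_map_poly)
    have L1: "map_poly ?D (?D x) = smult [:1 / to_fract s:] (map_poly ?F (map_poly \<delta> (\<delta> b)))"
    proof (rule poly_eqI)
      fix i
      have cB: "coeff (\<delta> b) i \<in> B" using d1[OF b(1)] by (auto simp: polys_over_def)
      show "coeff (map_poly ?D (?D x)) i = coeff (smult [:1 / to_fract s:] (map_poly ?F (map_poly \<delta> (\<delta> b)))) i"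
        using D[OF cB b(2)] by (simp add: coeff_map_poly D0 dz x D[OF b])
    qed
    have R1: "map_poly (\<lambda>c. [:c:]) (?D x) = smult [:1 / to_fract s:] (map_poly ?F (map_poly (\<lambda>c. [:c:]) (\<delta> b)))"
      by (rule poly_eqI) (simp add: coeff_map_poly x D[OF b] map_poly_pCons)
    have C: "map_poly ?F (p \<circ>\<^sub>p q) = map_poly ?F p \<circ>\<^sub>p map_poly ?F q" for p q
      by (rule map_poly_pcompose_hom) (simp_all add: FA FM)
    show "map_poly ?D (?D x) = map_poly (\<lambda>c. [:c:]) (?D x) \<circ>\<^sub>p [:[:0, 1:], 1:]"
      unfolding L1 R1 dc[OF b(1)] C pcompose_smult by (simp add: map_poly_pCons)
    fix y assume "y \<in> localization A B"
    then obtain b' s' where b': "b' \<in> B" "s' \<in> A - {0}" and y: "y = to_fract b' / to_fract s'" using L by blast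
    have ss: "s * s' \<in> A - {0}" using b b' clA by auto
    have sB': "s \<in> B" "s' \<in> B" using b b' AB by auto
    have e1: "x + y = to_fract (b * s' + b' * s) / to_fract (s * s')"
      using b b' by (simp add: x y field_simps)
    have e2: "x * y = to_fract (b * b') / to_fract (s * s')" by (simp add: x y)
    have ds: "\<delta> s = [:s:]" "\<delta> s' = [:s':]" using b b' dA by auto
    have n: "to_fract s \<noteq> 0" "to_fract s' \<noteq> 0" using b b' by auto
    have m1: "b * s' + b' * s \<in> B" using clp cl b b' sB' by blast
    have m2: "b * b' \<in> B" using cl b b' by blast
    show "?D (x + y) = ?D x + ?D y"
      unfolding e1 D[OF m1 ss] unfolding x y D[OF b] D[OF b'] using n
      by (simp add: dadd dmul cl b b' sB' ds FA Fs smult_add_right)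
    show "?D (x * y) = ?D x * ?D y"
      unfolding e2 D[OF m2 ss] unfolding x y D[OF b] D[OF b'] using n
      by (simp add: dadd dmul cl b b' sB' ds FA FM mult.commute)
  next
    fix a assume "a \<in> localization A A"
    then obtain b s where b: "b \<in> A" "s \<in> A - {0}" and x: "a = to_fract b / to_fract s" by (auto simp: localization_def)
    have bB: "b \<in> B" using b AB by auto
    show "?D a = [:a:]" unfolding x D[OF bB b(2)] by (simp add: dA b map_poly_pCons)
  qed
qed

end

theory Submission
  imports Defs "HOL-Algebra.Algebraic_Closure_Type" "HOL-Analysis.Determinants"
begin

text \<open>
  Suppose \<open>\<delta>\<close> is triangular with respect to \<open>U, V, W\<close>.  If \<open>\<delta>\<close> moves \<open>U\<close>, then \<open>U\<close> is a local
  slice whose leading coefficient is a unit of \<open>K\<close>, so \<open>S\<^sup>-\<^sup>1B\<close> is a polynomial ring in \<open>U\<close> over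
  the invariants of \<open>\<delta>\<^sub>K\<close>, these are isomorphic to \<open>K[V, W]\<close>, and \<open>rank \<delta>\<^sub>K \<le> 1\<close>.  So \<open>U\<close> is
  invariant and \<open>V\<close> is a local slice with leading coefficient in \<open>A[U]\<close>.  If \<open>A[U] = A[X]\<close>,
  then \<open>V, W\<close> witness triangularity over \<open>A[X]\<close>.

  Otherwise, let \<open>k\<close> be an algebraically closed field containing \<open>B\<close>.  Over \<open>k\<close> the invariants
  are \<open>k[U, F]\<close>, and the leading coefficients of elements of minimal positive degree form a principal
  ideal, generated by the leading coefficient \<open>a\<^sub>0 \<in> k[U]\<close> of some \<open>V\<^sub>0 \<in> B\<close>.  Now specialize
  the variable \<open>X\<close> of \<open>k[X, Y, Z]\<close> to the element \<open>X\<close> of \<open>k\<close>.  Every invariant of the resulting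
  exponential map on \<open>k[Y, Z]\<close> is constant modulo a prime factor \<open>q\<close> of \<open>U - u\<close>; if \<open>V\<^sub>0\<close> were
  algebraic over \<open>k\<close> modulo \<open>q\<close>, then \<open>V\<^sub>0 - \<mu> = q b\<close> would give the leading coefficient
  \<open>a\<^sub>0 / q\<close>, a contradiction.  Hence an expansion of \<open>a\<^sub>0\<^sup>N b\<close> in powers of \<open>V\<^sub>0\<close> with invariant
  coefficients can be divided by \<open>a\<^sub>0\<^sup>N\<close> over \<open>k(X)\<close>, and then also over \<open>k\<close>, since \<open>U - u\<close> does
  not divide \<open>X - \<xi>\<close>.  So \<open>K[U, V, W] = K[U, F, V\<^sub>0]\<close>, which contradicts \<open>rank \<delta>\<^sub>K = 2\<close>.
\<close>

text \<open>Three obstacles shape the proof. \<open>coord_systems\<close> asks only for generators,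
  while the arguments compare coefficients; independence of three generators is therefore proved
  first, with Jacobian matrices at the origin. The characteristic is arbitrary, so a local slice may
  have degree p^i; expansions in its powers still exist because its degree divides all others.
  Finally, the roots u live in the large field k, but the conclusion concerns K. Therefore
  \<open>F\<close> and \<open>V0\<close> are chosen inside B, with degrees minimal among elements of
  B, and independence of scalars over A shows that nothing over k does better. Conversely, an
  element of B in the k-span of an A-submodule of B lies in that submodule up to a denominator in A.
  The reason for specializing X: it is itself an invariant, so X = H(U, F). Once X is a scalar,
  reduction modulo a prime factor of U - u turns this into an equation for F over k, and F becomes
  constant. In k[U, V, W], by contrast, F stays transcendental modulo U - u.\<close>

hide_const (open) Polynomials.degree Polynomials.lead_coeff Divisibility.irreducible up_ring.coeff
  up_ring.monom Module.smult Coset.order Divisibility.prime UnivPoly.eval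
no_notation Polynomials.var (\<open>X\<index>\<close>)

section \<open>Subrings and ring homomorphisms\<close>

lemma subringD:
  assumes "is_subring R"
  shows subring_1: "1 \<in> R" and subring_0: "0 \<in> R"
    and subring_diff: "\<And>x y. x \<in> R \<Longrightarrow> y \<in> R \<Longrightarrow> x - y \<in> R"
    and subring_mult: "\<And>x y. x \<in> R \<Longrightarrow> y \<in> R \<Longrightarrow> x * y \<in> R"
    and subring_uminus: "\<And>x. x \<in> R \<Longrightarrow> - x \<in> R"
    and subring_add: "\<And>x y. x \<in> R \<Longrightarrow> y \<in> R \<Longrightarrow> x + y \<in> R"
proof -
  have 1: "1 \<in> R" and d: "\<And>x y. x \<in> R \<Longrightarrow> y \<in> R \<Longrightarrow> x - y \<in> R"
    and m: "\<And>x y. x \<in> R \<Longrightarrow> y \<in> R \<Longrightarrow> x * y \<in> R"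
    using assms unfolding is_subring_def by blast+
  have 0: "0 \<in> R" using d[OF 1 1] by simp
  have u: "- x \<in> R" if "x \<in> R" for x using d[OF 0 that] by simp
  have a: "x + y \<in> R" if "x \<in> R" "y \<in> R" for x y using d[OF that(1) u[OF that(2)]] by simp
  show "1 \<in> R" "0 \<in> R" "\<And>x y. x \<in> R \<Longrightarrow> y \<in> R \<Longrightarrow> x - y \<in> R"
    "\<And>x y. x \<in> R \<Longrightarrow> y \<in> R \<Longrightarrow> x * y \<in> R" "\<And>x. x \<in> R \<Longrightarrow> - x \<in> R"
    "\<And>x y. x \<in> R \<Longrightarrow> y \<in> R \<Longrightarrow> x + y \<in> R"
    by (fact 1 0 d m u a)+
qed

lemma subring_power: "is_subring R \<Longrightarrow> x \<in> R \<Longrightarrow> x ^ n \<in> R"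
  by (induction n) (auto intro: subringD)

lemma subring_sum: "is_subring R \<Longrightarrow> (\<And>i. i \<in> I \<Longrightarrow> f i \<in> R) \<Longrightarrow> sum f I \<in> R"
  by (induction I rule: infinite_finite_induct) (auto intro: subringD)

lemma is_subring_UNIV [simp]: "is_subring UNIV"
  by (simp add: is_subring_def)

lemma is_subring_adjoin: "is_subring (adjoin A S)"
  unfolding adjoin_def by (rule hull_in) (auto simp: is_subring_def)

lemma adjoin_base: "a \<in> A \<Longrightarrow> a \<in> adjoin A S"
  unfolding adjoin_def using hull_subset[of "A \<union> S" is_subring] by auto

lemma adjoin_gen: "a \<in> S \<Longrightarrow> a \<in> adjoin A S"
  unfolding adjoin_def using hull_subset[of "A \<union> S" is_subring] by auto

lemma adjoin_least: "is_subring R \<Longrightarrow> A \<subseteq> R \<Longrightarrow> S \<subseteq> R \<Longrightarrow> adjoin A S \<subseteq> R"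
  unfolding adjoin_def by (rule hull_minimal) auto

lemma adjoin_adjoin: "adjoin (adjoin A S) S' = adjoin A (S \<union> S')"
proof
  show "adjoin (adjoin A S) S' \<subseteq> adjoin A (S \<union> S')"
    by (intro adjoin_least is_subring_adjoin) (auto intro: adjoin_base adjoin_gen)
  show "adjoin A (S \<union> S') \<subseteq> adjoin (adjoin A S) S'"
    by (intro adjoin_least is_subring_adjoin) (auto intro: adjoin_base adjoin_gen)
qed

lemma is_subring_polys_over:
  assumes R: "is_subring R"
  shows "is_subring (polys_over R)"
  unfolding is_subring_def polys_over_def
  using subringD[OF R]
  by (auto simp: coeff_mult coeff_pCons split: nat.split intro!: subring_sum[OF R])

lemma const_polys_over: "is_subring R \<Longrightarrow> c \<in> R \<Longrightarrow> [:c:] \<in> polys_over R"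
  by (auto simp: polys_over_def coeff_pCons subringD split: nat.split)

lemma var_polys_over: "is_subring R \<Longrightarrow> [:0, 1:] \<in> polys_over R"
  by (auto simp: polys_over_def coeff_pCons subringD split: nat.split)

lemma poly_polys_over: "is_subring R \<Longrightarrow> p \<in> polys_over R \<Longrightarrow> x \<in> R \<Longrightarrow> poly p x \<in> R"
  unfolding poly_altdef by (intro subring_sum) (auto simp: polys_over_def intro: subringD subring_power)

definition ring_hom_on :: "'a::comm_ring_1 set \<Rightarrow> ('a \<Rightarrow> 'c::comm_ring_1) \<Rightarrow> bool" where
  "ring_hom_on B f \<longleftrightarrow> f 1 = 1 \<and> (\<forall>x\<in>B. \<forall>y\<in>B. f (x + y) = f x + f y \<and> f (x * y) = f x * f y)"

lemma hom_1: "ring_hom_on B f \<Longrightarrow> f 1 = 1"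
  and hom_add: "ring_hom_on B f \<Longrightarrow> x \<in> B \<Longrightarrow> y \<in> B \<Longrightarrow> f (x + y) = f x + f y"
  and hom_mult: "ring_hom_on B f \<Longrightarrow> x \<in> B \<Longrightarrow> y \<in> B \<Longrightarrow> f (x * y) = f x * f y"
  by (auto simp: ring_hom_on_def)

lemma hom_0: "ring_hom_on B f \<Longrightarrow> is_subring B \<Longrightarrow> f 0 = 0"
  using hom_add[of B f 0 0] subring_0[of B] by simp

lemma hom_uminus: "ring_hom_on B f \<Longrightarrow> is_subring B \<Longrightarrow> x \<in> B \<Longrightarrow> f (- x) = - f x"
  using hom_add[of B f x "- x"] subring_uminus[of B] hom_0[of B f] by (simp add: minus_unique)

lemma hom_diff: "ring_hom_on B f \<Longrightarrow> is_subring B \<Longrightarrow> x \<in> B \<Longrightarrow> y \<in> B \<Longrightarrow> f (x - y) = f x - f y"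
  using hom_add[of B f x "- y"] hom_uminus[of B f y] subring_uminus[of B] by simp

lemma hom_sum: "ring_hom_on B f \<Longrightarrow> is_subring B \<Longrightarrow> (\<And>i. i \<in> I \<Longrightarrow> g i \<in> B)
    \<Longrightarrow> f (\<Sum>i\<in>I. g i) = (\<Sum>i\<in>I. f (g i))"
  by (induction I rule: infinite_finite_induct) (auto simp: hom_0 hom_add subring_sum)

lemma hom_power: "ring_hom_on B f \<Longrightarrow> is_subring B \<Longrightarrow> x \<in> B \<Longrightarrow> f (x ^ n) = f x ^ n"
  by (induction n) (auto simp: hom_1 hom_mult subring_power)

lemma hom_mono: "ring_hom_on B f \<Longrightarrow> C \<subseteq> B \<Longrightarrow> ring_hom_on C f"
  by (auto simp: ring_hom_on_def)

lemma hom_comp: "ring_hom_on B f \<Longrightarrow> ring_hom_on UNIV g \<Longrightarrow> ring_hom_on B (\<lambda>x. g (f x))"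
  by (auto simp: ring_hom_on_def)

lemmas homU_simps = hom_1[of UNIV] hom_0[of UNIV, OF _ is_subring_UNIV]
  hom_add[of UNIV, OF _ UNIV_I UNIV_I] hom_mult[of UNIV, OF _ UNIV_I UNIV_I]
  hom_uminus[of UNIV, OF _ is_subring_UNIV UNIV_I]
  hom_diff[of UNIV, OF _ is_subring_UNIV UNIV_I UNIV_I]
  hom_power[of UNIV, OF _ is_subring_UNIV UNIV_I]
  hom_sum[of UNIV, OF _ is_subring_UNIV UNIV_I]

lemma hom_eq_on_adjoin:
  assumes f: "ring_hom_on (adjoin A S) f" and g: "ring_hom_on (adjoin A S) g"
    and A: "\<And>a. a \<in> A \<Longrightarrow> f a = g a" and S: "\<And>a. a \<in> S \<Longrightarrow> f a = g a"
    and x: "x \<in> adjoin A S"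
  shows "f x = g x"
proof -
  let ?R = "{x \<in> adjoin A S. f x = g x}"
  note sr = is_subring_adjoin[of A S]
  have "is_subring ?R"
    unfolding is_subring_def using subringD[OF sr] hom_1[OF f] hom_1[OF g]
    by (auto simp: hom_diff[OF f sr] hom_diff[OF g sr] hom_mult[OF f] hom_mult[OF g])
  from adjoin_least[OF this, of A S] have "adjoin A S \<subseteq> ?R"
    using A S by (auto intro: adjoin_base adjoin_gen)
  with x show ?thesis by blast
qed

lemma hom_poly:
  assumes f: "ring_hom_on R f" and R: "is_subring R" and p: "p \<in> polys_over R" and x: "x \<in> R"
  shows "f (poly p x) = poly (map_poly f p) (f x)"
proof -
  have c: "coeff p i \<in> R" for i using p by (auto simp: polys_over_def)
  have deg: "degree (map_poly f p) \<le> degree p" by (rule degree_le) (simp add: coeff_map_poly hom_0[OF f R] coeff_eq_0)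
  have "f (poly p x) = (\<Sum>i\<le>degree p. f (coeff p i) * f x ^ i)"
    unfolding poly_altdef
    using c x by (subst hom_sum[OF f R])
      (auto simp: hom_mult[OF f] hom_power[OF f R] subring_power[OF R] subringD[OF R])
  also have "\<dots> = poly (map_poly f p) (f x)"
    unfolding poly_altdef using deg hom_0[OF f R]
    by (intro sum.mono_neutral_cong_right) (auto simp: coeff_map_poly coeff_eq_0 intro!: le_degree)
  finally show ?thesis .
qed

lemma hom_map_poly:
  assumes f: "ring_hom_on R f" and R: "is_subring R"
  shows "ring_hom_on (polys_over R) (map_poly f)"
  unfolding ring_hom_on_def
proof (intro conjI ballI)
  note f0 = hom_0[OF f R]
  show "map_poly f 1 = 1" using hom_1[OF f] f0 by (simp add: one_pCons map_poly_pCons)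
  fix p q assume pq: "p \<in> polys_over R" "q \<in> polys_over R"
  then have c: "coeff p i \<in> R" "coeff q i \<in> R" for i by (auto simp: polys_over_def)
  show "map_poly f (p + q) = map_poly f p + map_poly f q"
    by (rule poly_eqI) (simp add: coeff_map_poly f0 hom_add[OF f c])
  show "map_poly f (p * q) = map_poly f p * map_poly f q"
    by (rule poly_eqI)
      (simp add: coeff_map_poly f0 coeff_mult hom_sum[OF f R] subring_mult[OF R] c hom_mult[OF f])
qed

lemma polys_over_UNIV [simp]: "polys_over UNIV = UNIV"
  by (auto simp: polys_over_def)

lemma hom_map_poly_UNIV: "ring_hom_on UNIV f \<Longrightarrow> ring_hom_on UNIV (map_poly f)"
  using hom_map_poly[of UNIV f] by simp

lemma hom_eval: "ring_hom_on UNIV (\<lambda>p. poly p x)"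
  by (simp add: ring_hom_on_def)

lemma hom_id: "ring_hom_on B (\<lambda>x. x)"
  by (simp add: ring_hom_on_def)

lemma hom_const: "ring_hom_on B (\<lambda>x. [:x:])"
  by (simp add: ring_hom_on_def one_pCons)

lemma hom_poly_unique:
  fixes f g :: "'a::comm_ring_1 poly \<Rightarrow> 'c::comm_ring_1"
  assumes f: "ring_hom_on UNIV f" and g: "ring_hom_on UNIV g"
    and c: "\<And>c. f [:c:] = g [:c:]" and x: "f [:0, 1:] = g [:0, 1:]"
  shows "f p = g p"
proof (induction p)
  case 0 then show ?case using f g by (simp add: homU_simps)
next
  case (pCons a p)
  have "pCons a p = [:a:] + [:0, 1:] * p" by simp
  then show ?case using c x pCons.IH by (simp only: homU_simps[OF f] homU_simps[OF g])
qed

section \<open>Polynomials in three variables\<close>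

text \<open>The first variable is the innermost one.\<close>

abbreviation const3 :: "'a::comm_ring_1 \<Rightarrow> 'a poly poly poly" where "const3 c \<equiv> [:[:[:c:]:]:]"
abbreviation var1 :: "'a::comm_ring_1 poly poly poly" where "var1 \<equiv> [:[:[:0, 1:]:]:]"
abbreviation var2 :: "'a::comm_ring_1 poly poly poly" where "var2 \<equiv> [:[:0, 1:]:]"
abbreviation var3 :: "'a::comm_ring_1 poly poly poly" where "var3 \<equiv> [:0, 1:]"
abbreviation polys3 :: "'a::comm_ring_1 set \<Rightarrow> 'a poly poly poly set" where
  "polys3 A \<equiv> polys_over (polys_over (polys_over A))"
abbreviation coeff3 :: "'a::zero poly poly poly \<Rightarrow> nat \<Rightarrow> nat \<Rightarrow> nat \<Rightarrow> 'a" where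
  "coeff3 p i j l \<equiv> coeff (coeff (coeff p i) j) l"
abbreviation map_poly3 :: "('a::zero \<Rightarrow> 'c::zero) \<Rightarrow> 'a poly poly poly \<Rightarrow> 'c poly poly poly" where
  "map_poly3 f \<equiv> map_poly (map_poly (map_poly f))"

definition eval3 :: "('a::comm_ring_1 \<Rightarrow> 'c::comm_ring_1) \<Rightarrow> 'c \<Rightarrow> 'c \<Rightarrow> 'c \<Rightarrow> 'a poly poly poly \<Rightarrow> 'c" where
  "eval3 h a b c g =
     poly (map_poly (\<lambda>p. poly (map_poly (\<lambda>q. poly (map_poly h q) a) p) b) g) c"

lemma eval3_hom:
  assumes h: "ring_hom_on UNIV h"
  shows "ring_hom_on UNIV (eval3 h a b c)"
proof -
  have 1: "ring_hom_on UNIV (\<lambda>q. poly (map_poly h q) a)"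
    by (rule hom_comp[OF hom_map_poly_UNIV[OF h] hom_eval])
  have 2: "ring_hom_on UNIV (\<lambda>p. poly (map_poly (\<lambda>q. poly (map_poly h q) a) p) b)"
    by (rule hom_comp[OF hom_map_poly_UNIV[OF 1] hom_eval])
  show ?thesis
    unfolding eval3_def[abs_def] by (rule hom_comp[OF hom_map_poly_UNIV[OF 2] hom_eval])
qed

lemma eval3_simps:
  assumes h: "ring_hom_on UNIV h"
  shows "eval3 h a b c (const3 x) = h x" "eval3 h a b c var1 = a"
    "eval3 h a b c var2 = b" "eval3 h a b c var3 = c"
  using h by (simp_all add: eval3_def map_poly_pCons homU_simps)

lemma hom3_unique:
  assumes f: "ring_hom_on UNIV f" and g: "ring_hom_on UNIV g"
    and c: "\<And>c. f (const3 c) = g (const3 c)"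
    and x: "f var1 = g var1" "f var2 = g var2" "f var3 = g var3"
  shows "f p = g p"
proof -
  have 1: "f [:[:q:]:] = g [:[:q:]:]" for q
    by (rule hom_poly_unique[where f = "\<lambda>q. f [:[:q:]:]" and g = "\<lambda>q. g [:[:q:]:]"])
      (use c x in \<open>auto intro!: hom_comp[OF _ f] hom_comp[OF _ g] hom_comp[OF _ hom_const] hom_const\<close>)
  have 2: "f [:q:] = g [:q:]" for q
    by (rule hom_poly_unique[where f = "\<lambda>q. f [:q:]" and g = "\<lambda>q. g [:q:]"])
      (use 1 x in \<open>auto intro!: hom_comp[OF _ f] hom_comp[OF _ g] hom_const\<close>)
  show ?thesis
    by (rule hom_poly_unique[OF f g]) (use 2 x in auto)
qed

lemma polys3_mem:
  assumes A: "is_subring A"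
  shows "is_subring (polys3 A)" "\<And>a. a \<in> A \<Longrightarrow> const3 a \<in> polys3 A"
    "var1 \<in> polys3 A" "var2 \<in> polys3 A" "var3 \<in> polys3 A"
  by (auto intro!: is_subring_polys_over const_polys_over var_polys_over A)

lemma eval3_id_mem:
  assumes R: "is_subring R" and A: "A \<subseteq> R" and mem: "a \<in> R" "b \<in> R" "c \<in> R" and g: "g \<in> polys3 A"
  shows "eval3 (\<lambda>x. x) a b c g \<in> R"
proof -
  have 1: "poly q a \<in> R" if "q \<in> polys_over A" for q
    using that A mem R by (intro poly_polys_over) (auto simp: polys_over_def)
  have 2: "poly (map_poly (\<lambda>q. poly q a) p) b \<in> R" if "p \<in> polys_over (polys_over A)" for p
    using that 1 mem R by (intro poly_polys_over) (auto simp: polys_over_def coeff_map_poly)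
  show ?thesis
    unfolding eval3_def using g 2 mem R
    by (intro poly_polys_over) (auto simp: polys_over_def coeff_map_poly)
qed

lemma eval3_image:
  assumes A: "is_subring A"
  shows "eval3 (\<lambda>x. x) a b c ` polys3 A = adjoin A {a, b, c}" (is "?E ` _ = _")
proof
  have h: "ring_hom_on UNIV ?E" by (rule eval3_hom[OF hom_id])
  note s = eval3_simps[OF hom_id, of a b c]
  show "?E ` polys3 A \<subseteq> adjoin A {a, b, c}"
    using eval3_id_mem[OF is_subring_adjoin, of A A "{a, b, c}" a b c] adjoin_base[of _ A] adjoin_gen[of _ "{a, b, c}" A]
    by blast
  have "is_subring (?E ` polys3 A)"
    unfolding is_subring_def
  proof (intro conjI ballI)
    have "?E 1 = 1" using h by (simp add: homU_simps)
    then show "1 \<in> ?E ` polys3 A" using subring_1[OF polys3_mem(1)[OF A]] by (metis imageI)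
    fix x y assume "x \<in> ?E ` polys3 A" "y \<in> ?E ` polys3 A"
    then obtain p q where "p \<in> polys3 A" "q \<in> polys3 A" "x = ?E p" "y = ?E q" by blast
    moreover have "?E p - ?E q = ?E (p - q)" "?E p * ?E q = ?E (p * q)" for p q
      using h by (simp_all add: homU_simps)
    ultimately show "x - y \<in> ?E ` polys3 A" "x * y \<in> ?E ` polys3 A"
      using subringD[OF polys3_mem(1)[OF A]] by auto
  qed
  moreover have "x \<in> ?E ` polys3 A" if "x \<in> A" for x
    using imageI[OF polys3_mem(2)[OF A that], of ?E] by (simp only: s)
  moreover have "a \<in> ?E ` polys3 A" "b \<in> ?E ` polys3 A" "c \<in> ?E ` polys3 A"
    using imageI[OF polys3_mem(3)[OF A], of ?E] imageI[OF polys3_mem(4)[OF A], of ?E]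
      imageI[OF polys3_mem(5)[OF A], of ?E] by (simp_all only: s)
  ultimately show "adjoin A {a, b, c} \<subseteq> ?E ` polys3 A"
    by (intro adjoin_least) auto
qed

lemma map_poly3_hom:
  "ring_hom_on UNIV f \<Longrightarrow> ring_hom_on UNIV (map_poly3 f)"
  by (intro hom_map_poly_UNIV)

section \<open>Exponential maps and local slices\<close>

text \<open>Isolates what survives base change without transporting the law \<open>\<delta>\<^sub>s
  \<circ> \<delta>\<^sub>t = \<delta>\<^sub>s\<^sub>+\<^sub>t\<close>: degrees, invariants and their
  factorial closedness. The extensions of \<open>\<delta>\<close> to polynomial rings over
  \<open>'k\<close> are only shown to be instances of this locale.\<close>

locale pre_exp =
  fixes B :: "'b::idom set" and \<delta> :: "'b \<Rightarrow> 'b poly"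
  assumes sB: "is_subring B" and exp_hom: "ring_hom_on B \<delta>" and D_0: "x \<in> B \<Longrightarrow> coeff (\<delta> x) 0 = x"
begin

abbreviation C where "C \<equiv> invariants B \<delta>"

lemma invariant_iff_degree: "x \<in> B \<Longrightarrow> x \<in> C \<longleftrightarrow> degree (\<delta> x) = 0"
  using D_0[of x] by (auto simp: invariants_def elim: degree_eq_zeroE)

lemma invariantD: "x \<in> C \<Longrightarrow> x \<in> B" "x \<in> C \<Longrightarrow> \<delta> x = [:x:]"
  by (auto simp: invariants_def)

lemma is_subring_invariants: "is_subring C"
  unfolding is_subring_def invariants_def
  using subringD[OF sB] hom_1[OF exp_hom] hom_diff[OF exp_hom sB] hom_mult[OF exp_hom]
  by (auto simp: one_pCons)

lemma exp_eq_0_iff: "x \<in> B \<Longrightarrow> \<delta> x = 0 \<longleftrightarrow> x = 0"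
  using D_0[of x] hom_0[OF exp_hom sB] by auto

lemma degree_exp_mult:
  "x \<in> B \<Longrightarrow> y \<in> B \<Longrightarrow> x \<noteq> 0 \<Longrightarrow> y \<noteq> 0 \<Longrightarrow> degree (\<delta> (x * y)) = degree (\<delta> x) + degree (\<delta> y)"
  by (simp add: hom_mult[OF exp_hom] degree_mult_eq exp_eq_0_iff)

text \<open>In a domain the t-degree of \<open>\<delta>\<close> is additive on nonzero products, so
  a product of degree 0 has factors of degree 0.\<close>

lemma factorially_closed:
  assumes "x \<in> B" "y \<in> B" "x * y \<in> C" "x * y \<noteq> 0"
  shows "x \<in> C" "y \<in> C"
  using assms degree_exp_mult[of x y] invariant_iff_degree[of "x * y"] subring_mult[OF sB, of x y]
  by (auto simp: invariant_iff_degree)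

lemma invariant_mult_exp: "c \<in> C \<Longrightarrow> x \<in> B \<Longrightarrow> \<delta> (c * x) = smult c (\<delta> x)"
  using invariantD[of c] by (simp add: hom_mult[OF exp_hom])

end

locale exp_map =
  fixes A B :: "'b::idom set" and \<delta> :: "'b \<Rightarrow> 'b poly"
  assumes sA: "is_subring A" and subring_B: "is_subring B" and AB: "A \<subseteq> B" and \<delta>: "\<delta> \<in> EXP A B"

sublocale exp_map \<subseteq> pre_exp B \<delta>
proof
  show "is_subring B" by (rule subring_B)
  have "\<delta> 1 = 1" using \<delta> subring_1[OF sA] by (auto simp: EXP_def one_pCons)
  then show "ring_hom_on B \<delta>" using \<delta> by (auto simp: EXP_def ring_hom_on_def)
  show "coeff (\<delta> x) 0 = x" if "x \<in> B" for x using \<delta> that by (auto simp: EXP_def poly_0_coeff_0)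
qed

context exp_map
begin

lemma exp_const: "a \<in> A \<Longrightarrow> \<delta> a = [:a:]"
  using \<delta> by (auto simp: EXP_def)

lemma D_mem: "x \<in> B \<Longrightarrow> coeff (\<delta> x) i \<in> B"
  using \<delta> by (auto simp: EXP_def polys_over_def)

lemma exp_polys_over: "x \<in> B \<Longrightarrow> \<delta> x \<in> polys_over B"
  using \<delta> by (auto simp: EXP_def)

lemma base_invariants: "A \<subseteq> C"
  using AB exp_const by (auto simp: invariants_def)

text \<open>The coefficients of \<open>\<delta>\<close> form an iterative higher derivation: this is
  the composition law read off at t^i s^j, where (s + t)^m contributes a binomial coefficient for m
  = i + j only.\<close>

lemma D_D:
  assumes x: "x \<in> B"
  shows "coeff (\<delta> (coeff (\<delta> x) i)) j = of_nat ((i + j) choose i) * coeff (\<delta> x) (i + j)"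
proof -
  let ?v = "[:[:0, 1:], 1:] :: 'b poly poly"
  have p: "\<delta> 0 = 0" using hom_0[OF exp_hom sB] .
  have e: "map_poly \<delta> (\<delta> x) = map_poly (\<lambda>c. [:c:]) (\<delta> x) \<circ>\<^sub>p ?v"
    using \<delta> x by (auto simp: EXP_def)
  let ?q = "map_poly (\<lambda>c. [:c:]) (\<delta> x)"
  define n where "n = degree (\<delta> x)"
  have "coeff (\<delta> (coeff (\<delta> x) i)) j = coeff (coeff (map_poly \<delta> (\<delta> x)) i) j"
    by (simp add: coeff_map_poly p)
  also have "?q \<circ>\<^sub>p ?v = (\<Sum>m\<le>n. smult [:coeff (\<delta> x) m:] (?v ^ m))"
    unfolding pcompose_altdef poly_altdef by (simp add: n_def coeff_map_poly degree_map_poly)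
  then have "coeff (coeff (map_poly \<delta> (\<delta> x)) i) j =
      (\<Sum>m\<le>n. coeff (coeff (smult [:coeff (\<delta> x) m:] (?v ^ m)) i) j)"
    unfolding e by (simp add: coeff_sum)
  also have "\<dots> = (\<Sum>m\<le>n. if m = i + j then of_nat ((i + j) choose i) * coeff (\<delta> x) (i + j) else 0)"
  proof (intro sum.cong refl)
    fix m
    show "coeff (coeff (smult [:coeff (\<delta> x) m:] (?v ^ m)) i) j =
        (if m = i + j then of_nat ((i + j) choose i) * coeff (\<delta> x) (i + j) else 0)"
    proof (cases "i \<le> m")
      case True
      have "coeff ([:0, 1:] ^ (m - i) :: 'b poly) j = (if j = m - i then 1 else 0)"
        by (metis coeff_monom monom_altdef mult.left_neutral smult_1_left)
      then show ?thesis using True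
        by (auto simp: coeff_linear_poly_power of_nat_poly ac_simps)
    next
      case False
      then have "coeff (?v ^ m) i = 0"
        by (intro coeff_eq_0 le_less_trans[OF degree_power_le]) auto
      then show ?thesis using False by simp
    qed
  qed
  also have "\<dots> = of_nat ((i + j) choose i) * coeff (\<delta> x) (i + j)"
    by (simp add: sum.delta n_def coeff_eq_0)
  finally show ?thesis .
qed

text \<open>By \<open>D_D\<close> every coefficient of positive index is a multiple of a coefficient
  of \<open>\<delta> x\<close> beyond its degree.\<close>

lemma lead_coeff_invariant:
  assumes x: "x \<in> B"
  shows "coeff (\<delta> x) (degree (\<delta> x)) \<in> C"
proof -
  let ?n = "degree (\<delta> x)"
  have "degree (\<delta> (coeff (\<delta> x) ?n)) = 0"
    by (rule ccontr) (metis D_D[OF x] coeff_eq_0 leading_coeff_0_iff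
        less_add_same_cancel1 mult_zero_right not_gr_zero degree_0)
  then show ?thesis using invariant_iff_degree[OF D_mem[OF x]] by simp
qed

end

section \<open>Degrees of local slices in arbitrary characteristic\<close>

lemma binomial_expansion_order2: "\<exists>r. (1 + y) ^ l = 1 + of_nat l * y + y ^ 2 * (r::'a::comm_ring_1)"
proof (induction l)
  case 0
  show ?case by (rule exI[of _ 0]) simp
next
  case (Suc l)
  then obtain r where r: "(1 + y) ^ l = 1 + of_nat l * y + y ^ 2 * r" by blast
  show ?case
    by (rule exI[of _ "of_nat l + r + y * r"]) (simp add: r algebra_simps power2_eq_square)
qed

text \<open>In characteristic \<open>0\<close> the divisor is \<open>1\<close>, in characteristic \<open>p\<close> it is the largest power
  of \<open>p\<close> dividing \<open>m\<close>.\<close>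

lemma char_power_divisor:
  assumes m: "m > 0"
  defines "q \<equiv> if CHAR('a::idom) = 0 then 1 else CHAR('a)"
  shows "\<exists>j. q ^ j dvd m \<and> of_nat (m choose (q ^ j)) \<noteq> (0::'a)"
proof (cases "CHAR('a) = 0")
  case True
  have "of_nat m \<noteq> (0::'a)" using m True by (simp add: of_nat_eq_0_iff_char_dvd)
  then show ?thesis using True by (simp add: q_def)
next
  case False
  then have p: "prime CHAR('a)" by (simp add: prime_CHAR_semidom)
  define d where "d = CHAR('a) ^ multiplicity CHAR('a) m"
  have d: "d dvd m" "d > 0" using False by (auto simp: d_def multiplicity_dvd)
  from m p obtain l where l: "m = d * l" "\<not> CHAR('a) dvd l"
    unfolding d_def using multiplicity_decompose'[of m "CHAR('a)"] by (metis not_prime_unit gr_implies_not0)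
  let ?Y = "monom 1 d :: 'a poly"
  have cp: "CHAR('a poly) = CHAR('a)" by simp
  obtain r where r: "(1 + ?Y) ^ l = 1 + of_nat l * ?Y + ?Y ^ 2 * r"
    using binomial_expansion_order2 by blast
  \<comment> \<open>The Frobenius power \<open>d\<close> turns (1 + x)^m into (1 + x^d)^l, whose
    coefficient at x^d is \<open>l\<close>, nonzero because the characteristic does not divide
    it.\<close>
  have "([:1, 1:] :: 'a poly) = 1 + monom 1 1" by (simp add: monom_altdef one_pCons)
  also have "\<dots> ^ d = 1 ^ d + monom 1 1 ^ d"
    by (rule freshmans_dream'[where n = "multiplicity CHAR('a) m"]) (use p in \<open>simp_all add: cp d_def\<close>)
  finally have "([:1, 1:] :: 'a poly) ^ d = 1 + ?Y" by (simp add: monom_power)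
  then have e: "[:1, 1:] ^ m = (1 + ?Y) ^ l" by (simp add: l power_mult)
  have "d \<le> m" using d m by (simp add: dvd_imp_le)
  then have "of_nat (m choose d) = coeff ([:1, 1:] ^ m :: 'a poly) d"
    by (simp add: coeff_linear_poly_power)
  also have "\<dots> = of_nat l"
  proof -
    have "coeff (?Y ^ 2 * r) d = 0" using d by (simp add: monom_power coeff_monom_mult)
    moreover have "coeff (of_nat l * ?Y) d = of_nat l" by (simp add: of_nat_poly)
    ultimately show ?thesis using d unfolding e r by simp
  qed
  also have "of_nat l \<noteq> (0::'a)" using l by (simp add: of_nat_eq_0_iff_char_dvd)
  finally show ?thesis using d False by (auto simp: q_def d_def)
qed

context exp_map
begin

text \<open>By \<open>D_D\<close> the coefficient at index \<open>d\<close> is the leading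
  coefficient of \<open>\<delta> x\<close> times \<open>m choose d\<close>, and everything beyond
  vanishes. This produces small degrees from arbitrary elements.\<close>

lemma degree_drop:
  assumes x: "x \<in> B" and m: "degree (\<delta> x) = m" and d: "0 < d" "d \<le> m"
    and nz: "of_nat (m choose d) \<noteq> (0::'b)"
  shows "degree (\<delta> (coeff (\<delta> x) (m - d))) = d"
proof (rule antisym)
  show "degree (\<delta> (coeff (\<delta> x) (m - d))) \<le> d"
    by (rule degree_le) (use m d in \<open>auto simp: D_D[OF x] coeff_eq_0\<close>)
  have "m choose (m - d) = m choose d" using d by (simp add: binomial_symmetric[symmetric])
  then have "coeff (\<delta> (coeff (\<delta> x) (m - d))) d \<noteq> 0"
    using nz m d by (auto simp: D_D[OF x])
  then show "d \<le> degree (\<delta> (coeff (\<delta> x) (m - d)))" by (rule le_degree)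
qed

text \<open>By \<open>degree_drop\<close>, for every positive degree m there is an element of some
  degree q^j dividing m. So the minimal positive degree is itself a power q^i, and q^i \<le> q^j
  gives divisibility. In characteristic 0, where q = 1, slices have degree 1.\<close>

lemma local_slice_degree_dvd:
  assumes x: "local_slice B \<delta> x" and b: "b \<in> B"
  shows "degree (\<delta> x) dvd degree (\<delta> b)"
proof (cases "degree (\<delta> b) = 0")
  case False
  define q where "q = (if CHAR('b) = 0 then 1 else CHAR('b))"
  have q: "q > 0" by (simp add: q_def)
  have x': "x \<in> B" "degree (\<delta> x) > 0" "\<And>y. y \<in> B \<Longrightarrow> degree (\<delta> y) > 0 \<Longrightarrow> degree (\<delta> x) \<le> degree (\<delta> y)"
    using x by (auto simp: local_slice_def)
  have *: "\<exists>j. q ^ j dvd degree (\<delta> y) \<and> degree (\<delta> x) \<le> q ^ j" if y: "y \<in> B" "degree (\<delta> y) > 0" for y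
  proof -
    obtain j where j: "q ^ j dvd degree (\<delta> y)" "of_nat (degree (\<delta> y) choose (q ^ j)) \<noteq> (0::'b)"
      using char_power_divisor[OF y(2), where 'a='b] unfolding q_def by blast
    have "degree (\<delta> (coeff (\<delta> y) (degree (\<delta> y) - q ^ j))) = q ^ j"
      using j y q by (intro degree_drop) (auto simp: dvd_imp_le)
    with x'(3)[OF D_mem[OF y(1), of "degree (\<delta> y) - q ^ j"]] q have "degree (\<delta> x) \<le> q ^ j" by simp
    with j show ?thesis by blast
  qed
  obtain i where i: "q ^ i dvd degree (\<delta> x)" "degree (\<delta> x) \<le> q ^ i" using *[OF x'(1,2)] by blast
  then have n: "degree (\<delta> x) = q ^ i" using x'(2) by (simp add: dvd_imp_le le_antisym)
  obtain j where j: "q ^ j dvd degree (\<delta> b)" "q ^ i \<le> q ^ j" using *[OF b] False n by auto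
  have "q ^ i dvd q ^ j"
  proof (cases "i \<le> j")
    case False
    then have "q ^ j dvd q ^ i" by (simp add: le_imp_power_dvd)
    then have "q ^ j \<le> q ^ i" using q by (simp add: dvd_imp_le)
    with j show ?thesis by simp
  qed (simp add: le_imp_power_dvd)
  then show ?thesis using n j dvd_trans by metis
qed simp

text \<open>Induction on the degree of \<open>b\<close>, which is l times that of the slice. Both
  leading coefficients \<open>a\<close> and \<open>c\<close> are invariant, so
  \<open>\<delta>\<close> is linear over them and \<open>a ^ l * b - c * x ^ l\<close> loses its top
  term.\<close>

theorem slice_expansion:
  assumes x: "local_slice B \<delta> x" and b: "b \<in> B"
  shows "\<exists>N p. p \<in> polys_over C \<and> coeff (\<delta> x) (degree (\<delta> x)) ^ N * b = poly p x"
  using b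
proof (induction "degree (\<delta> b)" arbitrary: b rule: less_induct)
  case less
  note sC = is_subring_invariants
  let ?n = "degree (\<delta> x)" and ?m = "degree (\<delta> b)"
  let ?a = "coeff (\<delta> x) ?n" and ?c = "coeff (\<delta> b) ?m"
  have xB: "x \<in> B" and n: "?n > 0" using x by (auto simp: local_slice_def)
  have a: "?a \<in> C" and c: "?c \<in> C" using lead_coeff_invariant xB less.prems by auto
  show ?case
  proof (cases "?m = 0")
    case True
    then have "b \<in> C" using invariant_iff_degree less.prems by simp
    then show ?thesis by (intro exI[of _ 0] exI[of _ "[:b:]"]) (simp add: const_polys_over sC)
  next
    case False
    obtain l where l: "?m = ?n * l" using local_slice_degree_dvd[OF x less.prems] by blast
    define b' where "b' = ?a ^ l * b - ?c * x ^ l"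
    have aB: "?a ^ l \<in> B" and xlB: "x ^ l \<in> B" and cB: "?c \<in> B"
      using a c xB invariantD(1) by (auto intro: subring_power[OF sB])
    have b'B: "b' \<in> B" unfolding b'_def using aB xlB cB less.prems by (auto intro: subringD[OF sB])
    have da: "\<delta> (?a ^ l) = [:?a ^ l:]" using invariantD(2)[OF subring_power[OF sC a]] .
    have db: "\<delta> b' = smult (?a ^ l) (\<delta> b) - smult ?c (\<delta> x ^ l)"
      unfolding b'_def
      using aB xlB cB less.prems invariantD(2)[OF c] da
      by (simp add: hom_diff[OF exp_hom sB] hom_mult[OF exp_hom] hom_power[OF exp_hom sB xB] subring_mult[OF sB])
    have dx: "degree (\<delta> x ^ l) = ?m" using l n by (metis degree_0 degree_power_eq less_irrefl mult.commute)
    have lx: "coeff (\<delta> x ^ l) ?m = ?a ^ l" using lead_coeff_power[of "\<delta> x" l] unfolding dx .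
    have "degree (\<delta> b') < ?m"
    proof (rule degree_lessI)
      show "\<delta> b' \<noteq> 0 \<or> 0 < ?m" using False by simp
      show "\<forall>k\<ge>?m. coeff (\<delta> b') k = 0"
        unfolding db using lx dx by (auto simp: le_less coeff_eq_0 mult.commute)
    qed
    from less.hyps[OF this b'B] obtain N p where
      p: "p \<in> polys_over C" and e: "?a ^ N * b' = poly p x" by blast
    let ?p = "p + monom (?a ^ N * ?c) l"
    have "?p \<in> polys_over C"
      using p a c by (auto simp: polys_over_def intro!: subringD[OF sC] subring_power[OF sC])
    moreover have "?a ^ (N + l) * b = poly ?p x"
      using e by (simp add: b'_def poly_monom power_add algebra_simps)
    ultimately show ?thesis by blast
  qed
qed

end

section \<open>Generating triples of a polynomial ring in three variables\<close>

text \<open>The N-th power of the ideal of the origin, described by vanishing coefficients.\<close>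

definition order_ge :: "nat \<Rightarrow> 'a::comm_ring_1 poly poly poly set" where
  "order_ge N = {p. \<forall>i j l. i + j + l < N \<longrightarrow> coeff3 p i j l = 0}"

lemma order_ge_D: "p \<in> order_ge N \<Longrightarrow> i + j + l < N \<Longrightarrow> coeff3 p i j l = 0"
  by (simp add: order_ge_def)

lemma order_ge_0 [simp]: "p \<in> order_ge 0"
  by (simp add: order_ge_def)

lemma zero_order_ge [simp]: "0 \<in> order_ge N"
  by (simp add: order_ge_def)

lemma order_ge_mono: "p \<in> order_ge N \<Longrightarrow> M \<le> N \<Longrightarrow> p \<in> order_ge M"
  by (auto simp: order_ge_def)

lemma order_ge_add: "p \<in> order_ge N \<Longrightarrow> q \<in> order_ge N \<Longrightarrow> p + q \<in> order_ge N"
  by (simp add: order_ge_def)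

lemma order_ge_diff: "p \<in> order_ge N \<Longrightarrow> q \<in> order_ge N \<Longrightarrow> p - q \<in> order_ge N"
  by (simp add: order_ge_def)

lemma order_ge_mult:
  assumes p: "p \<in> order_ge M" and q: "q \<in> order_ge N"
  shows "p * q \<in> order_ge (M + N)"
  unfolding order_ge_def mem_Collect_eq
proof (intro allI impI)
  fix i j l assume ijl: "i + j + l < M + N"
  have "coeff3 p a b c * coeff3 q (i - a) (j - b) (l - c) = 0" if "a \<le> i" "b \<le> j" "c \<le> l" for a b c
  proof (cases "a + b + c < M")
    case True
    then show ?thesis using order_ge_D[OF p] by simp
  next
    case False
    then have "(i - a) + (j - b) + (l - c) < N" using ijl that by linarith
    then show ?thesis using order_ge_D[OF q] by simp
  qed
  then show "coeff3 (p * q) i j l = 0"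
    by (simp add: coeff_mult coeff_sum)
qed

lemma vars_order_ge: "var1 \<in> order_ge (Suc 0)" "var2 \<in> order_ge (Suc 0)" "var3 \<in> order_ge (Suc 0)"
  by (auto simp: order_ge_def)

lemma decompose_order_ge:
  assumes "p \<in> order_ge (Suc N)"
  obtains p1 p2 p3 where "p1 \<in> order_ge N" "p2 \<in> order_ge N" "p3 \<in> order_ge N"
    "p = var1 * p1 + var2 * p2 + var3 * p3"
proof -
  obtain q p3 where 3: "p = pCons q p3" by (cases p) auto
  obtain r p2 where 2: "q = pCons r p2" by (cases q) auto
  obtain s p1 where 1: "r = pCons s p1" by (cases r) auto
  have s: "s = 0" using order_ge_D[OF assms, of 0 0 0] by (simp add: 1 2 3)
  have o3: "p3 \<in> order_ge N"
    using order_ge_D[OF assms, of "Suc _" _ _] by (simp add: order_ge_def 3)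
  have o2: "[:p2:] \<in> order_ge N"
    using order_ge_D[OF assms, of 0 "Suc _" _]
    by (auto simp: order_ge_def 2 3 coeff_pCons split: nat.split)
  have o1: "[:[:p1:]:] \<in> order_ge N"
    using order_ge_D[OF assms, of 0 0 "Suc _"]
    by (auto simp: order_ge_def 1 2 3 coeff_pCons split: nat.split)
  have "p = var1 * [:[:p1:]:] + var2 * [:p2:] + var3 * p3"
    by (simp add: 1 2 3 s)
  with o1 o2 o3 show ?thesis by (rule that)
qed

lemma order_ge_all: "(\<And>N. p \<in> order_ge N) \<Longrightarrow> p = 0"
  by (intro poly_eqI) (auto intro!: order_ge_D lessI)

lemma decompose_const:
  "\<exists>p1 p2 p3. p = const3 (coeff3 p 0 0 0) + var1 * p1 + var2 * p2 + var3 * p3"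
proof -
  have "p - const3 (coeff3 p 0 0 0) \<in> order_ge (Suc 0)"
    by (auto simp: order_ge_def)
  then obtain p1 p2 p3 where "p - const3 (coeff3 p 0 0 0) = var1 * p1 + var2 * p2 + var3 * p3"
    by (rule decompose_order_ge)
  moreover have "x = c + a + b + d" if "x - c = a + b + d" for x c a b d :: "'a poly poly poly"
    using that by (simp add: algebra_simps)
  ultimately show ?thesis by blast
qed

lemma hom_order_ge:
  assumes h: "ring_hom_on UNIV h"
    and v: "h var1 \<in> order_ge (Suc 0)" "h var2 \<in> order_ge (Suc 0)" "h var3 \<in> order_ge (Suc 0)"
    and p: "p \<in> order_ge N"
  shows "h p \<in> order_ge N"
  using p
proof (induction N arbitrary: p)
  case (Suc N)
  from Suc.prems obtain p1 p2 p3 where p: "p1 \<in> order_ge N" "p2 \<in> order_ge N" "p3 \<in> order_ge N"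
    "p = var1 * p1 + var2 * p2 + var3 * p3" by (rule decompose_order_ge)
  have "h p = h var1 * h p1 + h var2 * h p2 + h var3 * h p3"
    unfolding p(4) by (simp only: homU_simps[OF h])
  also have "\<dots> \<in> order_ge (Suc 0 + N)"
    using v p(1-3) Suc.IH by (intro order_ge_add order_ge_mult) auto
  finally show ?case by simp
qed simp

text \<open>Induction on the order: for p = sum x_i p_i the difference h p - p is the sum of the
  terms (h x_i - x_i) h p_i and x_i (h p_i - p_i), and both kinds gain one order over p.\<close>

lemma hom_unipotent:
  assumes h: "ring_hom_on UNIV h" and c: "\<And>c. h (const3 c) = const3 c"
    and v: "h var1 - var1 \<in> order_ge 2" "h var2 - var2 \<in> order_ge 2" "h var3 - var3 \<in> order_ge 2"
    and p: "p \<in> order_ge N"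
  shows "h p - p \<in> order_ge (Suc N)"
proof -
  have v1: "h var1 \<in> order_ge (Suc 0)" "h var2 \<in> order_ge (Suc 0)" "h var3 \<in> order_ge (Suc 0)"
    using order_ge_add[OF order_ge_mono[OF v(1), of "Suc 0"] vars_order_ge(1)]
      order_ge_add[OF order_ge_mono[OF v(2), of "Suc 0"] vars_order_ge(2)]
      order_ge_add[OF order_ge_mono[OF v(3), of "Suc 0"] vars_order_ge(3)] by simp_all
  note hog = hom_order_ge[OF h v1]
  show ?thesis
    using p
  proof (induction N arbitrary: p)
    case 0
    obtain p1 p2 p3 where p: "p = const3 (coeff3 p 0 0 0) + var1 * p1 + var2 * p2 + var3 * p3"
      using decompose_const by blast
    have "h p = const3 (coeff3 p 0 0 0) + h var1 * h p1 + h var2 * h p2 + h var3 * h p3"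
      by (subst p) (simp only: homU_simps[OF h] c)
    moreover have "x * y \<in> order_ge (Suc 0)" if "x \<in> order_ge (Suc 0)" for x y :: "'a poly poly poly"
      using order_ge_mult[OF that order_ge_0[of y]] by simp
    then have "(h var1 * h p1 + h var2 * h p2 + h var3 * h p3) - (var1 * p1 + var2 * p2 + var3 * p3) \<in> order_ge (Suc 0)"
      using v1 vars_order_ge by (intro order_ge_diff order_ge_add) blast+
    moreover have "h p - p = (h var1 * h p1 + h var2 * h p2 + h var3 * h p3) - (var1 * p1 + var2 * p2 + var3 * p3)"
    proof -
      have "x - y = (a1 + a2 + a3) - (b1 + b2 + b3)"
        if "x = c + a1 + a2 + a3" "y = c + b1 + b2 + b3" for x y c a1 a2 a3 b1 b2 b3 :: "'a poly poly poly"
        using that by simp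
      then show ?thesis using calculation(1) p by blast
    qed
    ultimately show ?case by metis
  next
    case (Suc N)
    from Suc.prems obtain p1 p2 p3 where p: "p1 \<in> order_ge N" "p2 \<in> order_ge N" "p3 \<in> order_ge N"
      "p = var1 * p1 + var2 * p2 + var3 * p3" by (rule decompose_order_ge)
    have "h p = h var1 * h p1 + h var2 * h p2 + h var3 * h p3"
      unfolding p(4) by (simp only: homU_simps[OF h])
    then have "h p - p = ((h var1 - var1) * h p1 + (h var2 - var2) * h p2 + (h var3 - var3) * h p3)
       + (var1 * (h p1 - p1) + var2 * (h p2 - p2) + var3 * (h p3 - p3))"
    proof -
      have "(a1 * q1 + a2 * q2 + a3 * q3) - (x1 * p1 + x2 * p2 + x3 * p3) =
        ((a1 - x1) * q1 + (a2 - x2) * q2 + (a3 - x3) * q3) + (x1 * (q1 - p1) + x2 * (q2 - p2) + x3 * (q3 - p3))"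
        for a1 a2 a3 q1 q2 q3 x1 x2 x3 p1 p2 p3 :: "'a poly poly poly"
        by (simp add: algebra_simps)
      then show ?thesis using \<open>h p = _\<close> p(4) by metis
    qed
    also have "\<dots> \<in> order_ge (Suc (Suc N))"
    proof (rule order_ge_add)
      have "(h var1 - var1) * h p1 + (h var2 - var2) * h p2 + (h var3 - var3) * h p3 \<in> order_ge (2 + N)"
        using v p(1-3) hog by (intro order_ge_add order_ge_mult) auto
      then show "(h var1 - var1) * h p1 + (h var2 - var2) * h p2 + (h var3 - var3) * h p3 \<in> order_ge (Suc (Suc N))"
        by simp
      have "var1 * (h p1 - p1) + var2 * (h p2 - p2) + var3 * (h p3 - p3) \<in> order_ge (Suc 0 + Suc N)"
        using Suc.IH p(1-3) vars_order_ge by (intro order_ge_add order_ge_mult) auto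
      then show "var1 * (h p1 - p1) + var2 * (h p2 - p2) + var3 * (h p3 - p3) \<in> order_ge (Suc (Suc N))"
        by simp
    qed
    finally show ?case .
  qed
qed

text \<open>Indexed by the type \<open>3\<close>, so that linear parts become square matrices and
  \<open>matrix_left_right_inverse\<close> applies.\<close>

definition var3_of :: "3 \<Rightarrow> 'a::comm_ring_1 poly poly poly" where
  "var3_of i = (if i = 1 then var1 else if i = 2 then var2 else var3)"

text \<open>The gradient at the origin. Index 1 is the innermost variable and hence the last index
  of \<open>coeff3\<close>.\<close>

definition lin3 :: "'a::comm_ring_1 poly poly poly \<Rightarrow> 3 \<Rightarrow> 'a" where
  "lin3 p i = (if i = 1 then coeff3 p 0 0 1 else if i = 2 then coeff3 p 0 1 0 else coeff3 p 1 0 0)"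

lemma lin3_order_ge: "p \<in> order_ge 2 \<Longrightarrow> lin3 p i = 0"
  by (simp add: lin3_def order_ge_D)

lemma lin3_add: "lin3 (p + q) i = lin3 p i + lin3 q i"
  and lin3_sum: "lin3 (\<Sum>x\<in>I. f x) i = (\<Sum>x\<in>I. lin3 (f x) i)"
  and lin3_const_mult: "lin3 (const3 c * p) i = c * lin3 p i"
  by (simp_all add: lin3_def coeff_sum)

lemma lin3_var3_of: "lin3 (var3_of j) i = (if i = j then 1 else 0)"
proof -
  have "(1::3) \<noteq> 2" "(1::3) \<noteq> 3" "(2::3) \<noteq> 3" by simp_all
  then show ?thesis using exhaust_3[of i] exhaust_3[of j] by (auto simp: lin3_def var3_of_def)
qed

lemma var3_of_order_ge: "var3_of i \<in> order_ge (Suc 0)"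
  by (simp add: var3_of_def vars_order_ge)

lemma linear_part:
  assumes "p \<in> order_ge (Suc 0)"
  shows "p - (\<Sum>i\<in>UNIV. const3 (lin3 p i) * var3_of i) \<in> order_ge 2"
  unfolding order_ge_def mem_Collect_eq
proof (intro allI impI)
  fix i j l :: nat assume "i + j + l < 2"
  then consider "i = 0" "j = 0" "l = 0" | "i = 1" "j = 0" "l = 0" | "i = 0" "j = 1" "l = 0"
    | "i = 0" "j = 0" "l = 1" by linarith
  then show "coeff3 (p - (\<Sum>i\<in>UNIV. const3 (lin3 p i) * var3_of i)) i j l = 0"
    using order_ge_D[OF assms, of 0 0 0] by cases (auto simp: sum_3 lin3_def var3_of_def)
qed

text \<open>The chain rule for gradients at the origin; terms of order 2 in \<open>p\<close> stay of
  order 2 under \<open>h\<close>.\<close>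

lemma linear_part_hom:
  fixes h :: "'a::comm_ring_1 poly poly poly \<Rightarrow> 'a poly poly poly"
  assumes h: "ring_hom_on UNIV h" and c: "\<And>c. h (const3 c) = const3 c"
    and v: "\<And>i. h (var3_of i) \<in> order_ge (Suc 0)" and p: "p \<in> order_ge (Suc 0)"
  shows "lin3 (h p) k = (\<Sum>i\<in>UNIV. lin3 p i * lin3 (h (var3_of i)) k)"
proof -
  have v': "h var1 \<in> order_ge (Suc 0)" "h var2 \<in> order_ge (Suc 0)" "h var3 \<in> order_ge (Suc 0)"
    using v[of 1] v[of 2] v[of 3] by (simp_all add: var3_of_def)
  let ?l = "\<Sum>i\<in>UNIV. const3 (lin3 p i) * var3_of i"
  have "h p = h (p - ?l) + h ?l" by (simp only: homU_simps[OF h]) simp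
  moreover have "lin3 (h (p - ?l)) k = 0"
    by (intro lin3_order_ge hom_order_ge[OF h v'] linear_part p)
  moreover have "h ?l = (\<Sum>i\<in>UNIV. const3 (lin3 p i) * h (var3_of i))"
    by (simp only: homU_simps[OF h] c)
  ultimately show ?thesis by (simp add: lin3_add lin3_sum lin3_const_mult del: mult_pCons_left)
qed

text \<open>If \<open>h\<close> has the right inverse \<open>g\<close>, then the linear parts of \<open>h\<close> and \<open>g\<close> are
  inverse matrices, so \<open>g \<circ> h\<close> is the identity modulo terms of higher order and an element
  of the kernel of \<open>h\<close> has infinite order at the origin.\<close>

lemma surjective_hom_injective_origin:
  fixes h :: "'a::field poly poly poly \<Rightarrow> 'a poly poly poly"
  assumes h: "ring_hom_on UNIV h" and c: "\<And>c. h (const3 c) = const3 c"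
    and v: "\<And>i. h (var3_of i) \<in> order_ge (Suc 0)"
    and G: "\<And>i. h (G i) = var3_of i" and G1: "\<And>i. G i \<in> order_ge (Suc 0)"
    and p: "h p = 0"
  shows "p = 0"
proof -
  define g where "g = eval3 const3 (G 1) (G 2) (G 3)"
  have ch: "ring_hom_on UNIV (const3 :: 'a \<Rightarrow> _)" by (simp add: ring_hom_on_def one_pCons)
  have g: "ring_hom_on UNIV g" unfolding g_def by (rule eval3_hom[OF ch])
  have gc: "g (const3 c) = const3 c" for c unfolding g_def by (simp add: eval3_simps[OF ch])
  have gv: "g (var3_of i) = G i" for i
    using exhaust_3[of i] by (auto simp: g_def var3_of_def eval3_simps[OF ch])
  define L where "L = (\<chi> i k. lin3 (h (var3_of i)) k)"
  define M where "M = (\<chi> i k. lin3 (G i) k)"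
  have "M ** L = mat 1"
  proof -
    have "(\<Sum>j\<in>UNIV. lin3 (G i) j * lin3 (h (var3_of j)) k) = (if i = k then 1 else 0)" for i k
      using linear_part_hom[OF h c v G1, of i k] by (simp only: G lin3_var3_of) auto
    then show ?thesis by (simp add: matrix_matrix_mult_def M_def L_def mat_def vec_eq_iff)
  qed
  \<comment> \<open>For square matrices over a field a left inverse is a right inverse. This is
    where having as many generators as variables matters.\<close>
  then have LM: "L ** M = mat 1" by (simp add: matrix_left_right_inverse)
  define e where "e = (\<lambda>p. g (h p))"
  have e: "ring_hom_on UNIV e" unfolding e_def by (rule hom_comp[OF h g])
  have ec: "e (const3 c) = const3 c" for c by (simp add: e_def c gc)
  have gv1: "g (var3_of i) \<in> order_ge (Suc 0)" for i by (simp add: gv G1)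
  have g1: "g var1 \<in> order_ge (Suc 0)" "g var2 \<in> order_ge (Suc 0)" "g var3 \<in> order_ge (Suc 0)"
    using gv1[of 1] gv1[of 2] gv1[of 3] by (simp_all add: var3_of_def)
  have ev: "e (var3_of i) - var3_of i \<in> order_ge 2" for i
  proof -
    let ?d = "e (var3_of i) - var3_of i"
    have d1: "?d \<in> order_ge (Suc 0)"
      unfolding e_def using hom_order_ge[OF g g1 v] by (intro order_ge_diff var3_of_order_ge)
    have "lin3 (e (var3_of i)) k = (if i = k then 1 else 0)" for k
    proof -
      have "lin3 (e (var3_of i)) k = (\<Sum>j\<in>UNIV. vec_nth (vec_nth L i) j * vec_nth (vec_nth M j) k)"
        unfolding e_def linear_part_hom[OF g gc gv1 v] by (simp add: L_def M_def gv)
      also have "\<dots> = vec_nth (vec_nth (L ** M) i) k" by (simp add: matrix_matrix_mult_def)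
      finally show ?thesis by (simp add: LM mat_def)
    qed
    then have "lin3 ?d k = 0" for k
      using lin3_add[of ?d "var3_of i" k] by (simp only: diff_add_cancel lin3_var3_of) (auto split: if_splits)
    then show ?thesis using linear_part[OF d1] by simp
  qed
  have "p \<in> order_ge N" for N
  proof (induction N)
    case (Suc N)
    have "e p - p \<in> order_ge (Suc N)"
      using ev[of 1] ev[of 2] ev[of 3] by (intro hom_unipotent[OF e ec _ _ _ Suc.IH]) (simp_all add: var3_of_def)
    moreover have "e p = 0" using p homU_simps(2)[OF g] by (simp add: e_def)
    ultimately have "0 - (e p - p) \<in> order_ge (Suc N)" by (metis order_ge_diff zero_order_ge)
    with \<open>e p = 0\<close> show ?case by (simp add: order_ge_def)
  qed simp
  then show ?thesis by (rule order_ge_all)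
qed

text \<open>A translation reduces this to the case of the origin: \<open>t\<close> subtracts from
  each variable the constant term of its image under \<open>h\<close>, so that
  \<open>h \<circ> t\<close> preserves constant terms, and \<open>s\<close> is the inverse
  translation.\<close>

lemma surjective_hom_injective:
  fixes h :: "'a::field poly poly poly \<Rightarrow> 'a poly poly poly"
  assumes h: "ring_hom_on UNIV h" and c: "\<And>c. h (const3 c) = const3 c"
    and G: "\<And>i. h (G i) = var3_of i"
    and p: "h p = 0"
  shows "p = 0"
proof -
  have ch: "ring_hom_on UNIV (const3 :: 'a \<Rightarrow> _)" by (simp add: ring_hom_on_def one_pCons)
  note es = eval3_simps[OF ch]
  define z :: "'a poly poly poly \<Rightarrow> 'a" where "z p = coeff3 p 0 0 0" for p
  have z: "ring_hom_on UNIV z" by (simp add: ring_hom_on_def z_def coeff_mult_0)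
  define t where "t = eval3 const3 (var1 - const3 (z (h var1))) (var2 - const3 (z (h var2))) (var3 - const3 (z (h var3)))"
  define s where "s = eval3 const3 (var1 + const3 (z (h var1))) (var2 + const3 (z (h var2))) (var3 + const3 (z (h var3)))"
  have t: "ring_hom_on UNIV t" and s: "ring_hom_on UNIV s"
    unfolding t_def s_def by (rule eval3_hom[OF ch])+
  have tv: "t (const3 x) = const3 x" "t var1 = var1 - const3 (z (h var1))"
    "t var2 = var2 - const3 (z (h var2))" "t var3 = var3 - const3 (z (h var3))" for x
    unfolding t_def by (simp_all only: es)
  have sv: "s (const3 x) = const3 x" "s var1 = var1 + const3 (z (h var1))"
    "s var2 = var2 + const3 (z (h var2))" "s var3 = var3 + const3 (z (h var3))" for x
    unfolding s_def by (simp_all only: es)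
  have ts: "t (s q) = q" for q
    by (rule hom3_unique[OF hom_comp[OF s t] hom_id]) (simp_all only: sv tv homU_simps[OF t] diff_add_cancel)
  have ht: "ring_hom_on UNIV (\<lambda>q. h (t q))" by (rule hom_comp[OF t h])
  have htc: "h (t (const3 x)) = const3 x" for x by (simp only: tv c)
  have htv: "h (t var1) = h var1 - const3 (z (h var1))" "h (t var2) = h var2 - const3 (z (h var2))"
     "h (t var3) = h var3 - const3 (z (h var3))"
    by (simp_all only: tv homU_simps[OF h] c)
  have zv: "z var1 = 0" "z var2 = 0" "z var3 = 0" "z (const3 x) = x" for x by (simp_all add: z_def)
  have zz: "z (h (t q)) = z q" for q
    by (rule hom3_unique[OF hom_comp[OF ht z] z]) (simp_all only: htc htv homU_simps[OF z] zv diff_self)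
  have o: "q \<in> order_ge (Suc 0) \<longleftrightarrow> z q = 0" for q by (auto simp: order_ge_def z_def)
  have v: "h (t (var3_of i)) \<in> order_ge (Suc 0)" for i
    using zz[of "var3_of i"] o var3_of_order_ge by metis
  have Gs: "h (t (s (G i))) = var3_of i" for i by (simp only: ts G)
  have G1: "s (G i) \<in> order_ge (Suc 0)" for i
    using zz[of "s (G i)"] Gs[of i] o var3_of_order_ge by metis
  have "s p = 0"
    by (rule surjective_hom_injective_origin[OF ht htc v Gs G1]) (simp only: ts p)
  then show ?thesis using ts[of p] homU_simps(2)[OF t] by simp
qed

section \<open>Independence of three generators\<close>

lemma poly_bounded_sum:
  fixes p :: "'a::comm_ring_1 poly"
  assumes "\<And>i. i > N \<Longrightarrow> coeff p i = 0"
  shows "poly p x = (\<Sum>i\<le>N. coeff p i * x ^ i)"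
proof -
  have "degree p \<le> N" using assms by (simp add: degree_le)
  then show ?thesis
    unfolding poly_altdef by (auto intro!: sum.mono_neutral_left le_degree)
qed

lemma coeff3_bound: "\<exists>N. \<forall>i j l. coeff3 g i j l \<noteq> 0 \<longrightarrow> i \<le> N \<and> j \<le> N \<and> l \<le> N"
proof -
  let ?a = "degree g" and ?b = "\<Sum>i\<le>degree g. degree (coeff g i)"
    and ?c = "\<Sum>i\<le>degree g. \<Sum>j\<le>degree (coeff g i). degree (coeff (coeff g i) j)"
  have "i \<le> ?a + ?b + ?c \<and> j \<le> ?a + ?b + ?c \<and> l \<le> ?a + ?b + ?c" if nz: "coeff3 g i j l \<noteq> 0" for i j l
  proof -
    have "coeff g i \<noteq> 0" "coeff (coeff g i) j \<noteq> 0" using nz by auto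
    then have i: "i \<le> degree g" and j: "j \<le> degree (coeff g i)" and l: "l \<le> degree (coeff (coeff g i) j)"
      using nz by (auto intro: le_degree)
    have "degree (coeff g i) \<le> ?b" by (rule member_le_sum) (use i in auto)
    moreover have "degree (coeff (coeff g i) j) \<le> (\<Sum>j\<le>degree (coeff g i). degree (coeff (coeff g i) j))"
      by (rule member_le_sum) (use j in auto)
    moreover have "\<dots> \<le> ?c"
      by (rule member_le_sum[where f = "\<lambda>i. \<Sum>j\<le>degree (coeff g i). degree (coeff (coeff g i) j)"]) (use i in auto)
    ultimately show ?thesis using i j l by linarith
  qed
  then show ?thesis by blast
qed

lemma eval3_sum:
  assumes h: "h 0 = 0" and N: "\<And>i j l. coeff3 g i j l \<noteq> 0 \<Longrightarrow> i \<le> N \<and> j \<le> N \<and> l \<le> N"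
  shows "eval3 h a b c g = (\<Sum>i\<le>N. \<Sum>j\<le>N. \<Sum>l\<le>N. h (coeff3 g i j l) * a ^ l * b ^ j * c ^ i)"
proof -
  have z0: "coeff3 g i j l = 0" if "i > N \<or> j > N \<or> l > N" for i j l
    using N[of i j l] that by linarith
  have z: "coeff (coeff g i) j = 0" if "i > N \<or> j > N" for i j
    by (intro poly_eqI) (use z0[of i j] that in auto)
  have z': "coeff g i = 0" if "i > N" for i
    by (intro poly_eqI) (use z[of i] that in auto)
  have 1: "poly (map_poly h (coeff (coeff g i) j)) a = (\<Sum>l\<le>N. h (coeff3 g i j l) * a ^ l)" for i j
    by (subst poly_bounded_sum[of N]) (use z0 in \<open>auto simp: coeff_map_poly h\<close>)
  have 2: "poly (map_poly (\<lambda>q. poly (map_poly h q) a) (coeff g i)) b =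
      (\<Sum>j\<le>N. (\<Sum>l\<le>N. h (coeff3 g i j l) * a ^ l) * b ^ j)" for i
    by (subst poly_bounded_sum[of N]) (use z[of i] in \<open>auto simp: coeff_map_poly h 1\<close>)
  show ?thesis
    unfolding eval3_def
    by (subst poly_bounded_sum[of N])
      (use z' in \<open>auto simp: coeff_map_poly h 2 sum_distrib_right mult.assoc\<close>)
qed

lemma alg_independent_eval3:
  assumes A: "is_subring A" and ind: "alg_independent A [a, b, c]"
    and g: "g \<in> polys3 A" and e: "eval3 (\<lambda>x. x) a b c g = 0"
  shows "g = 0"
proof -
  obtain N where N: "\<And>i j l. coeff3 g i j l \<noteq> 0 \<Longrightarrow> i \<le> N \<and> j \<le> N \<and> l \<le> N"
    using coeff3_bound[of g] by blast
  let ?S = "{..N} \<times> {..N} \<times> {..N}"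
  \<comment> \<open>An exponent vector lists the exponents of \<open>a, b, c\<close>, while
    \<open>coeff3\<close> starts with the outermost variable, that of \<open>c\<close>; hence the
    reversal.\<close>
  let ?f = "\<lambda>(i, j, l). [l, j, i] :: nat list"
  let ?c = "\<lambda>e. coeff3 g (e ! 2) (e ! 1) (e ! 0)"
  have inj: "inj_on ?f ?S" by (auto simp: inj_on_def)
  have "(\<Sum>e\<in>?f ` ?S. ?c e * (\<Prod>i<length [a, b, c]. ([a, b, c] ! i) ^ (e ! i)))
      = (\<Sum>(i, j, l)\<in>?S. coeff3 g i j l * a ^ l * b ^ j * c ^ i)"
    by (subst sum.reindex[OF inj])
      (auto intro!: sum.cong simp: numeral_eq_Suc lessThan_Suc ac_simps)
  also have "\<dots> = eval3 (\<lambda>x. x) a b c g"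
    by (simp add: eval3_sum[OF _ N] sum.cartesian_product[symmetric])
  finally have s: "(\<Sum>e\<in>?f ` ?S. ?c e * (\<Prod>i<length [a, b, c]. ([a, b, c] ! i) ^ (e ! i))) = 0"
    using e by simp
  have "finite (?f ` ?S)" "\<forall>e\<in>?f ` ?S. length e = length [a, b, c] \<and> ?c e \<in> A"
    using g by (auto simp: polys_over_def)
  with s have "\<forall>e\<in>?f ` ?S. ?c e = 0"
    using ind[unfolded alg_independent_def, THEN spec, THEN spec, of "?f ` ?S" ?c] by blast
  then have *: "coeff3 g i j l = 0" if "i \<le> N" "j \<le> N" "l \<le> N" for i j l
    using that by force
  have "coeff3 g i j l = 0" for i j l using * N by blast
  then show ?thesis by (intro poly_eqI) simp
qed

text \<open>Writing \<open>a, b, c\<close> as polynomials in an independent system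
  \<open>u, v, w\<close> gives an endomorphism of the polynomial ring. Since \<open>u, v, w\<close>
  are polynomials in \<open>a, b, c\<close>, all variables have preimages. The coefficients pass to
  the fraction field because the matrix argument in \<open>surjective_hom_injective\<close> is over
  a field.\<close>

theorem generators_independent:
  fixes A B :: "'b::idom set"
  assumes A: "is_subring A" and B: "is_polynomial_ring A B 3" and gen: "B = adjoin A {a, b, c}"
    and g: "g \<in> polys3 A" and e: "eval3 (\<lambda>x. x) a b c g = 0"
  shows "g = 0"
proof -
  obtain xs where xs: "length xs = 3" "alg_independent A xs" "B = adjoin A (set xs)"
    using B by (auto simp: is_polynomial_ring_def)
  then obtain u v w where uvw: "xs = [u, v, w]"
    by (auto simp: numeral_eq_Suc length_Suc_conv)
  let ?E = "eval3 (\<lambda>x. x) u v w" and ?P = "eval3 (\<lambda>x. x) a b c"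
  note es = eval3_simps[OF hom_id]
  have E: "ring_hom_on UNIV ?E" and P: "ring_hom_on UNIV ?P" by (rule eval3_hom[OF hom_id])+
  have imE: "?E ` polys3 A = B" and imP: "?P ` polys3 A = B"
    using eval3_image[OF A] xs(3) uvw gen by simp_all
  have "a \<in> B" "b \<in> B" "c \<in> B" unfolding gen by (auto intro: adjoin_gen)
  then obtain y1 y2 y3 where y: "y1 \<in> polys3 A" "y2 \<in> polys3 A" "y3 \<in> polys3 A"
    "?E y1 = a" "?E y2 = b" "?E y3 = c" unfolding imE[symmetric] by blast
  have "u \<in> B" "v \<in> B" "w \<in> B" unfolding xs(3) uvw by (auto intro: adjoin_gen)
  then obtain G1 G2 G3 where G: "G1 \<in> polys3 A" "G2 \<in> polys3 A" "G3 \<in> polys3 A"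
    "?P G1 = u" "?P G2 = v" "?P G3 = w" unfolding imP[symmetric] by blast
  let ?F = "map_poly3 (to_fract :: 'b \<Rightarrow> 'b fract)"
  have tf: "ring_hom_on UNIV (to_fract :: 'b \<Rightarrow> 'b fract)" by (simp add: ring_hom_on_def)
  note F = map_poly3_hom[OF tf]
  have chb: "ring_hom_on UNIV (const3 :: 'b \<Rightarrow> _)" and chf: "ring_hom_on UNIV (const3 :: 'b fract \<Rightarrow> _)"
    by (simp_all add: ring_hom_on_def one_pCons)
  let ?s = "eval3 const3 y1 y2 y3" and ?h = "eval3 const3 (?F y1) (?F y2) (?F y3)"
  have s: "ring_hom_on UNIV ?s" and h: "ring_hom_on UNIV ?h" by (rule eval3_hom[OF chb] eval3_hom[OF chf])+
  have Fv: "?F (const3 x) = const3 (to_fract x)" "?F var1 = var1" "?F var2 = var2" "?F var3 = var3" for x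
    by (simp_all add: map_poly_pCons)
  have 1: "?E (?s q) = ?P q" for q
    by (rule hom3_unique[OF hom_comp[OF s E] P]) (simp_all only: es eval3_simps[OF chb] y)
  have 2: "?F (?s q) = ?h (?F q)" for q
    by (rule hom3_unique[OF hom_comp[OF s F] hom_comp[OF F h]])
      (simp_all only: Fv eval3_simps[OF chb] eval3_simps[OF chf])
  have smem: "?s q \<in> polys3 A" if q: "q \<in> polys3 A" for q
  proof -
    obtain N where N: "\<And>i j l. coeff3 q i j l \<noteq> 0 \<Longrightarrow> i \<le> N \<and> j \<le> N \<and> l \<le> N"
      using coeff3_bound[of q] by blast
    note sr = polys3_mem(1)[OF A]
    have "const3 (coeff3 q i j l) \<in> polys3 A" for i j l
      using q by (intro polys3_mem A) (auto simp: polys_over_def)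
    moreover have "?s q = (\<Sum>i\<le>N. \<Sum>j\<le>N. \<Sum>l\<le>N. const3 (coeff3 q i j l) * y1 ^ l * y2 ^ j * y3 ^ i)"
      by (rule eval3_sum) (simp_all add: N)
    ultimately show ?thesis
      using y by (auto simp only: intro!: subring_sum[OF sr] subring_mult[OF sr] subring_power[OF sr])
  qed
  have inj: "p = q" if "p \<in> polys3 A" "q \<in> polys3 A" "?E p = ?E q" for p q
    using alg_independent_eval3[OF A xs(2)[unfolded uvw] subring_diff[OF polys3_mem(1)[OF A] that(1,2)]] that(3)
    by (simp only: homU_simps[OF E]) simp
  have h0: "?h (?F q) = ?F r" if "q \<in> polys3 A" "r \<in> polys3 A" "?P q = ?E r" for q r
    using inj[OF smem[OF that(1)] that(2)] that(3) by (simp only: 1 2[symmetric])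
  define G where "G i = (if i = (1::3) then ?F G1 else if i = 2 then ?F G2 else ?F G3)" for i
  have Gh: "?h (G i) = var3_of i" for i
    using h0[OF G(1) polys3_mem(3)[OF A]] h0[OF G(2) polys3_mem(4)[OF A]] h0[OF G(3) polys3_mem(5)[OF A]]
    by (simp only: es G Fv G_def var3_of_def) simp
  have hg: "?h (?F g) = 0"
    using h0[OF g subring_0[OF polys3_mem(1)[OF A]]] e homU_simps(2)[OF E] homU_simps(2)[OF F] by simp
  have hc: "?h (const3 x) = const3 x" for x by (simp only: eval3_simps[OF chf])
  have Fg: "?F g = 0" by (rule surjective_hom_injective[OF h hc Gh hg])
  have "coeff3 (?F g) i j l = to_fract (coeff3 g i j l)" for i j l
    by (simp add: coeff_map_poly)
  then have "to_fract (coeff3 g i j l) = 0" for i j l using Fg by (metis coeff_0)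
  then show ?thesis by (intro poly_eqI) simp
qed

section \<open>Coordinates over a larger field\<close>

locale field_embedding =
  fixes emb :: "'b::idom \<Rightarrow> 'k::field"
  assumes emb_hom: "ring_hom_on UNIV emb" and emb_eq_0: "emb x = 0 \<Longrightarrow> x = 0"
begin

lemma emb_0: "emb 0 = 0" and emb_1: "emb 1 = 1"
  using emb_hom by (simp_all add: homU_simps)

end

locale coordinates = field_embedding emb
  for emb :: "'b::idom \<Rightarrow> 'k::field" +
  fixes A B :: "'b set" and a b c :: 'b
  assumes sA: "is_subring A" and gen: "B = adjoin A {a, b, c}"
    and indep: "g \<in> polys3 A \<Longrightarrow> eval3 (\<lambda>x. x) a b c g = 0 \<Longrightarrow> g = 0"
begin

abbreviation "val \<equiv> eval3 (\<lambda>x. x) a b c"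

lemma val_hom: "ring_hom_on UNIV val"
  by (rule eval3_hom[OF hom_id])

lemma val_simps: "val (const3 x) = x" "val var1 = a" "val var2 = b" "val var3 = c"
  by (rule eval3_simps[OF hom_id])+

lemma val_inj: "p \<in> polys3 A \<Longrightarrow> q \<in> polys3 A \<Longrightarrow> val p = val q \<Longrightarrow> p = q"
  using indep[OF subring_diff[OF polys3_mem(1)[OF sA]], of p q] homU_simps(6)[OF val_hom, of p q] by simp

lemma val_image: "val ` polys3 A = B"
  using eval3_image[OF sA] gen by simp

text \<open>The map from \<open>B\<close> to k[a, b, c], the tensor product of k and
  \<open>B\<close> over \<open>A\<close>.\<close>

definition coord :: "'b \<Rightarrow> 'k poly poly poly" where
  "coord x = map_poly3 emb (the_inv_into (polys3 A) val x)"

lemma coord_val: "p \<in> polys3 A \<Longrightarrow> coord (val p) = map_poly3 emb p"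
  unfolding coord_def by (subst the_inv_into_f_f) (auto intro: inj_onI val_inj)

lemma coord_ex: "x \<in> B \<Longrightarrow> \<exists>p\<in>polys3 A. x = val p \<and> coord x = map_poly3 emb p"
  using val_image coord_val by blast

lemma sB': "is_subring B"
  unfolding gen by (rule is_subring_adjoin)

lemma base_mem: "x \<in> A \<Longrightarrow> x \<in> B" and gen_mem: "a \<in> B" "b \<in> B" "c \<in> B"
  unfolding gen by (auto intro: adjoin_base adjoin_gen)

lemma coord_hom: "ring_hom_on B coord"
  unfolding ring_hom_on_def
proof (intro conjI ballI)
  note sr = polys3_mem(1)[OF sA] and mh = map_poly3_hom[OF emb_hom]
  have v1: "val 1 = 1" by (rule homU_simps(1)[OF val_hom])
  show "coord 1 = 1"
    using coord_val[OF subring_1[OF sr]] unfolding v1 by (simp only: homU_simps[OF mh])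
  fix x y assume "x \<in> B" "y \<in> B"
  then obtain p q where p: "p \<in> polys3 A" "x = val p" and q: "q \<in> polys3 A" "y = val q"
    unfolding val_image[symmetric] by blast
  have s: "x + y = val (p + q)" "x * y = val (p * q)"
    unfolding p q by (simp_all only: homU_simps[OF val_hom])
  show "coord (x + y) = coord x + coord y" "coord (x * y) = coord x * coord y"
    unfolding s coord_val[OF subring_add[OF sr p(1) q(1)]] coord_val[OF subring_mult[OF sr p(1) q(1)]]
    unfolding p(2) q(2) coord_val[OF p(1)] coord_val[OF q(1)] by (simp_all only: homU_simps[OF mh])
qed

lemma coord_simps: "x \<in> A \<Longrightarrow> coord x = const3 (emb x)" "coord a = var1" "coord b = var2" "coord c = var3"
proof -
  show "coord x = const3 (emb x)" if "x \<in> A"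
    using coord_val[OF polys3_mem(2)[OF sA that]] unfolding val_simps by (simp add: map_poly_pCons emb_0)
  show "coord a = var1" "coord b = var2" "coord c = var3"
    using coord_val[OF polys3_mem(3)[OF sA]] coord_val[OF polys3_mem(4)[OF sA]] coord_val[OF polys3_mem(5)[OF sA]]
    unfolding val_simps by (simp_all add: map_poly_pCons emb_0 emb_1)
qed

lemma coord_coeff: "x \<in> B \<Longrightarrow> coeff3 (coord x) i j l \<in> emb ` A"
  using coord_ex[of x] by (force simp: polys_over_def coeff_map_poly emb_0)

lemma coord_eq_0: "x \<in> B \<Longrightarrow> coord x = 0 \<Longrightarrow> x = 0"
proof -
  assume x: "x \<in> B" "coord x = 0"
  obtain p where p: "p \<in> polys3 A" "x = val p" "coord x = map_poly3 emb p" using coord_ex[OF x(1)] by blast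
  have "emb (coeff3 p i j l) = coeff3 (coord x) i j l" for i j l
    by (simp add: p(3) coeff_map_poly emb_0)
  then have "coeff3 p i j l = 0" for i j l using emb_eq_0 x(2) by simp
  then have "p = 0" by (intro poly_eqI) simp
  then show "x = 0" using p homU_simps(2)[OF val_hom] by simp
qed

end

lemma const3_hom: "ring_hom_on UNIV (const3 :: 'a::comm_ring_1 \<Rightarrow> _)"
  by (simp add: ring_hom_on_def one_pCons)

lemma poly3_expansion: "\<exists>N. p = (\<Sum>i\<le>N. \<Sum>j\<le>N. \<Sum>l\<le>N. const3 (coeff3 p i j l) * (var1 ^ l * var2 ^ j * var3 ^ i))"
proof -
  have "eval3 const3 var1 var2 var3 p = p"
    by (rule hom3_unique[OF eval3_hom[OF const3_hom] hom_id]) (simp_all only: eval3_simps[OF const3_hom])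
  moreover obtain N where "\<And>i j l. coeff3 p i j l \<noteq> 0 \<Longrightarrow> i \<le> N \<and> j \<le> N \<and> l \<le> N"
    using coeff3_bound[of p] by blast
  then have "eval3 const3 var1 var2 var3 p = (\<Sum>i\<le>N. \<Sum>j\<le>N. \<Sum>l\<le>N. const3 (coeff3 p i j l) * var1 ^ l * var2 ^ j * var3 ^ i)"
    by (intro eval3_sum) auto
  ultimately show ?thesis by (metis (no_types, lifting) mult.assoc sum.cong)
qed

section \<open>Base change of an exponential map to a field\<close>

text \<open>The ring \<open>'r\<close> plays the role of \<open>'k \<otimes>\<^bsub>R\<^esub> B\<close>; the coefficient functionals \<open>cf\<close>
  make the elements of \<open>'k\<close> that are linearly independent over \<open>R\<close> independent over \<open>B\<close>.\<close>

locale base_change = pre_exp B \<delta> + field_embedding emb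
  for B :: "'b::idom set" and \<delta> :: "'b \<Rightarrow> 'b poly" and emb :: "'b \<Rightarrow> 'k::field" +
  fixes R :: "'b set" and const :: "'k \<Rightarrow> 'r::idom" and bc :: "'b \<Rightarrow> 'r"
    and cf :: "'i \<Rightarrow> 'r \<Rightarrow> 'k" and \<delta>' :: "'r \<Rightarrow> 'r poly"
  assumes sR: "is_subring R" and RB: "R \<subseteq> B"
    and D_mem: "x \<in> B \<Longrightarrow> coeff (\<delta> x) i \<in> B"
    and const_hom: "ring_hom_on UNIV const" and bc_hom: "ring_hom_on B bc"
    and bc_eq_0: "x \<in> B \<Longrightarrow> bc x = 0 \<Longrightarrow> x = 0"
    and bc_R: "s \<in> R \<Longrightarrow> bc s = const (emb s)"
    and cf_add: "cf k (r + r') = cf k r + cf k r'" and cf_const: "cf k (const e * r) = e * cf k r"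
    and cf_eq_0: "(\<And>k. cf k r = 0) \<Longrightarrow> r = 0"
    and cf_bc: "x \<in> B \<Longrightarrow> cf k (bc x) \<in> emb ` R"
    and spanning: "\<exists>I e b. finite (I::nat set) \<and> (\<forall>i\<in>I. b i \<in> B) \<and> r = (\<Sum>i\<in>I. const (e i) * bc (b i))"
    and exp'_hom: "ring_hom_on UNIV \<delta>'" and exp'_const: "\<delta>' (const e) = [:const e:]"
    and exp'_bc: "x \<in> B \<Longrightarrow> \<delta>' (bc x) = map_poly bc (\<delta> x)"
begin

definition lin_indep :: "nat set \<Rightarrow> (nat \<Rightarrow> 'k) \<Rightarrow> bool" where
  "lin_indep I e \<longleftrightarrow> (\<forall>s. (\<forall>i\<in>I. s i \<in> R) \<and> (\<Sum>i\<in>I. e i * emb (s i)) = 0 \<longrightarrow> (\<forall>i\<in>I. s i = 0))"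

definition spanned :: "'b set \<Rightarrow> 'r \<Rightarrow> bool" where
  "spanned S r \<longleftrightarrow> (\<exists>I e b. finite (I::nat set) \<and> (\<forall>i\<in>I. b i \<in> S) \<and> r = (\<Sum>i\<in>I. const (e i) * bc (b i)))"

definition submodule :: "'b set \<Rightarrow> bool" where
  "submodule S \<longleftrightarrow> 0 \<in> S \<and> S \<subseteq> B \<and> (\<forall>x\<in>S. \<forall>y\<in>S. x + y \<in> S) \<and> (\<forall>s\<in>R. \<forall>x\<in>S. s * x \<in> S)"

lemma submodule_B: "submodule B"
  using subringD[OF sB] RB by (auto simp: submodule_def)

lemma spanned_B: "spanned B r"
  unfolding spanned_def by (rule spanning)

text \<open>A representation with the fewest terms is independent: a relation with
  \<open>s j \<noteq> 0\<close> would eliminate the index \<open>j\<close>.\<close>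

lemma spanned_indep:
  assumes S: "submodule S" and r: "spanned S r"
  shows "\<exists>I e b. finite I \<and> (\<forall>i\<in>I. b i \<in> S) \<and> r = (\<Sum>i\<in>I. const (e i) * bc (b i)) \<and> lin_indep I e"
proof -
  let ?P = "\<lambda>n. \<exists>I e b. finite (I::nat set) \<and> card I = n \<and> (\<forall>i\<in>I. b i \<in> S) \<and> r = (\<Sum>i\<in>I. const (e i) * bc (b i))"
  have ex: "\<exists>n. ?P n" using r unfolding spanned_def by blast
  define n where "n = (LEAST n. ?P n)"
  have "?P n" unfolding n_def using ex by (rule LeastI_ex)
  then obtain I :: "nat set" and e b where I: "finite I" "card I = n" and b: "\<And>i. i \<in> I \<Longrightarrow> b i \<in> S"
    and r: "r = (\<Sum>i\<in>I. const (e i) * bc (b i))" by blast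
  have "lin_indep I e"
    unfolding lin_indep_def
  proof (intro allI impI, rule ccontr)
    fix s assume s: "(\<forall>i\<in>I. s i \<in> R) \<and> (\<Sum>i\<in>I. e i * emb (s i)) = 0" and "\<not> (\<forall>i\<in>I. s i = 0)"
    then obtain j where j: "j \<in> I" "s j \<noteq> 0" by blast
    have ej: "emb (s j) \<noteq> 0" using emb_eq_0 j by blast
    have sR': "s i \<in> R" if "i \<in> I" for i using s that by blast
    \<comment> \<open>Division by \<open>s j\<close> takes place among the scalars, multiplication
      by it in \<open>S\<close>. So the new elements stay in the \<open>R\<close>-submodule
      \<open>S\<close>, and \<open>b' j = 0\<close>.\<close>
    define b' where "b' i = s j * b i + (- s i) * b j" for i
    define e' where "e' i = e i / emb (s j)" for i
    have b'S: "b' i \<in> S" if "i \<in> I" for i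
      using S b[OF that] b[OF j(1)] sR'[OF j(1)] subring_uminus[OF sR sR'[OF that]]
      unfolding b'_def submodule_def by blast
    have bB: "b i \<in> B" "s i \<in> B" if "i \<in> I" for i using b[OF that] S sR'[OF that] RB by (auto simp: submodule_def)
    have bc': "const (e' i) * bc (b' i) = const (e i) * bc (b i) - const (e' i * emb (s i)) * bc (b j)" if i: "i \<in> I" for i
    proof -
      have "bc (b' i) = const (emb (s j)) * bc (b i) - const (emb (s i)) * bc (b j)"
        unfolding b'_def using bB[OF i] bB[OF j(1)] sR'[OF i] sR'[OF j(1)]
        by (simp add: hom_add[OF bc_hom] hom_mult[OF bc_hom] hom_diff[OF bc_hom sB] hom_uminus[OF bc_hom sB]
            subringD[OF sB] bc_R)
      moreover have "const (e' i) * const (emb (s j)) = const (e i)"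
        using ej homU_simps(4)[OF const_hom, of "e' i" "emb (s j)"] by (simp add: e'_def)
      ultimately show ?thesis
        by (simp add: right_diff_distrib homU_simps(4)[OF const_hom] mult.assoc[symmetric])
    qed
    have "(\<Sum>i\<in>I. const (e' i) * bc (b' i)) = r - (\<Sum>i\<in>I. const (e' i * emb (s i)) * bc (b j))"
      unfolding r by (simp add: bc' sum_subtractf)
    also have "(\<Sum>i\<in>I. const (e' i * emb (s i)) * bc (b j)) = const (\<Sum>i\<in>I. e' i * emb (s i)) * bc (b j)"
      by (simp add: sum_distrib_right homU_simps(8)[OF const_hom])
    also have "(\<Sum>i\<in>I. e' i * emb (s i)) = (\<Sum>i\<in>I. e i * emb (s i)) / emb (s j)"
      by (simp add: e'_def sum_divide_distrib)
    also have "\<dots> = 0" using s by simp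
    finally have "r = (\<Sum>i\<in>I. const (e' i) * bc (b' i))" by (simp add: homU_simps(2)[OF const_hom])
    also have "\<dots> = (\<Sum>i\<in>I - {j}. const (e' i) * bc (b' i))"
      using I j by (intro sum.mono_neutral_right) (auto simp: b'_def hom_0[OF bc_hom sB])
    finally have "?P (card (I - {j}))" using I(1) b'S by blast
    then have "n \<le> card (I - {j})" unfolding n_def by (rule Least_le)
    moreover have "card (I - {j}) < card I" using I j by (intro psubset_card_mono) auto
    ultimately show False using I by simp
  qed
  with I b r show ?thesis by blast
qed

lemma indep_representation:
  "\<exists>I e b. finite I \<and> (\<forall>i\<in>I. b i \<in> B) \<and> r = (\<Sum>i\<in>I. const (e i) * bc (b i)) \<and> lin_indep I e"
  by (rule spanned_indep[OF submodule_B spanned_B])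

lemma cf_0: "cf k 0 = 0"
  using cf_add[of k 0 0] by (metis add.right_neutral add_left_cancel)

lemma cf_sum: "cf k (\<Sum>i\<in>I. f i) = (\<Sum>i\<in>I. cf k (f i))"
  by (induction I rule: infinite_finite_induct) (auto simp: cf_0 cf_add)

text \<open>Each functional maps the elements \<open>bc (b i)\<close> into the image of
  \<open>R\<close>, so a vanishing value of the sum is an \<open>R\<close>-linear relation among the
  scalars \<open>e i\<close>.\<close>

lemma indep_cf_eq_0:
  assumes I: "lin_indep I e" and b: "\<And>i. i \<in> I \<Longrightarrow> b i \<in> B"
    and z: "cf k (\<Sum>i\<in>I. const (e i) * bc (b i)) = 0" and i: "i \<in> I"
  shows "cf k (bc (b i)) = 0"
proof -
  have "\<forall>i\<in>I. \<exists>s. s \<in> R \<and> cf k (bc (b i)) = emb s" using cf_bc b by blast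
  then obtain s where s: "\<And>i. i \<in> I \<Longrightarrow> s i \<in> R \<and> cf k (bc (b i)) = emb (s i)" by metis
  have "(\<Sum>i\<in>I. e i * emb (s i)) = 0" using z s by (simp add: cf_sum cf_const)
  then have "s i = 0" using I s i unfolding lin_indep_def by blast
  then show ?thesis using s[OF i] emb_0 by simp
qed

lemma indep_eq_0:
  assumes I: "lin_indep I e" and b: "\<And>i. i \<in> I \<Longrightarrow> b i \<in> B"
    and z: "(\<Sum>i\<in>I. const (e i) * bc (b i)) = 0" and i: "i \<in> I"
  shows "b i = 0"
proof -
  have "cf k (bc (b i)) = 0" for k
    by (rule indep_cf_eq_0[OF I b _ i]) (simp_all add: z cf_0)
  then show ?thesis using cf_eq_0 bc_eq_0[OF b[OF i]] by blast
qed

text \<open>Compare the scalar 1 with the independent scalars \<open>e i\<close>. If 1 is related to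
  them over \<open>R\<close>, multiplying \<open>bc y\<close> by the relation and using independence
  gives \<open>t * b i + s i * y = 0\<close> for all \<open>i\<close>, with some \<open>s i\<close>
  nonzero. If not, 1 and the \<open>e i\<close> together are independent, and the representation of
  \<open>bc y\<close> forces \<open>y = 0\<close>.\<close>

lemma descent:
  assumes S: "submodule S" and y: "y \<in> B" and sp: "spanned S (bc y)"
  obtains s where "s \<in> R" "s \<noteq> 0" "s * y \<in> S"
proof -
  obtain I e b where I: "finite I" and b: "\<And>i. i \<in> I \<Longrightarrow> b i \<in> S"
    and r: "bc y = (\<Sum>i\<in>I. const (e i) * bc (b i))" and ind: "lin_indep I e"
    using spanned_indep[OF S sp] by blast
  have bB: "b i \<in> B" if "i \<in> I" for i using b[OF that] S by (auto simp: submodule_def)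
  show ?thesis
  proof (cases "\<exists>t s. t \<in> R \<and> t \<noteq> 0 \<and> (\<forall>i\<in>I. s i \<in> R) \<and> emb t + (\<Sum>i\<in>I. e i * emb (s i)) = 0")
    case True
    then obtain t s where t: "t \<in> R" "t \<noteq> 0" and s: "\<And>i. i \<in> I \<Longrightarrow> s i \<in> R"
      and e: "emb t + (\<Sum>i\<in>I. e i * emb (s i)) = 0" by blast
    have sB': "s i \<in> B" if "i \<in> I" for i using s[OF that] RB by blast
    have tB: "t \<in> B" using t RB by blast
    have "0 = const (emb t + (\<Sum>i\<in>I. e i * emb (s i))) * bc y"
      by (simp add: e homU_simps(2)[OF const_hom])
    also have "\<dots> = const (emb t) * bc y + (\<Sum>i\<in>I. const (e i) * (const (emb (s i)) * bc y))"
      by (simp add: homU_simps[OF const_hom] distrib_right sum_distrib_right mult.assoc)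
    also have "const (emb t) * bc y = (\<Sum>i\<in>I. const (e i) * (const (emb t) * bc (b i)))"
      unfolding r by (simp add: sum_distrib_left mult.left_commute)
    also have "\<dots> + (\<Sum>i\<in>I. const (e i) * (const (emb (s i)) * bc y))
        = (\<Sum>i\<in>I. const (e i) * bc (t * b i + s i * y))"
      unfolding sum.distrib[symmetric]
      by (intro sum.cong refl)
        (simp add: hom_add[OF bc_hom] hom_mult[OF bc_hom] subringD[OF sB] tB bB sB' y bc_R t s distrib_left)
    finally have z: "(\<Sum>i\<in>I. const (e i) * bc (t * b i + s i * y)) = 0" ..
    have *: "t * b i + s i * y = 0" if "i \<in> I" for i
      by (rule indep_eq_0[OF ind _ z that]) (auto intro!: subringD[OF sB] tB bB sB' y)
    obtain i where i: "i \<in> I" "s i \<noteq> 0"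
      using e t emb_eq_0 emb_0 by (metis (no_types, lifting) add.right_neutral mult_zero_right sum.neutral)
    have "s i * y = (- t) * b i" using *[OF i(1)] by (simp add: eq_neg_iff_add_eq_0 add.commute)
    moreover have "(- t) * b i \<in> S" using S b[OF i(1)] subring_uminus[OF sR t(1)] unfolding submodule_def by blast
    ultimately show ?thesis using that[OF s[OF i(1)] i(2)] by simp
  next
    case False
    \<comment> \<open>A fresh index for the scalar 1, to be paired with \<open>- y\<close>.\<close>
    obtain j where j: "j \<notin> I" using I ex_new_if_finite[of I] infinite_UNIV_nat by blast
    let ?e = "e(j := 1)" and ?b = "b(j := - y)"
    have "lin_indep (insert j I) ?e"
      unfolding lin_indep_def
    proof (intro allI impI)
      fix s assume s: "(\<forall>i\<in>insert j I. s i \<in> R) \<and> (\<Sum>i\<in>insert j I. ?e i * emb (s i)) = 0"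
      have "(\<Sum>i\<in>I. ?e i * emb (s i)) = (\<Sum>i\<in>I. e i * emb (s i))"
        using j by (intro sum.cong) auto
      then have eq: "emb (s j) + (\<Sum>i\<in>I. e i * emb (s i)) = 0" using s I j by simp
      then have "s j = 0" using False s by blast
      then show "\<forall>i\<in>insert j I. s i = 0" using eq s ind emb_0 unfolding lin_indep_def by simp
    qed
    moreover have "(\<Sum>i\<in>insert j I. const (?e i) * bc (?b i)) = 0"
    proof -
      have "(\<Sum>i\<in>I. const (?e i) * bc (?b i)) = (\<Sum>i\<in>I. const (e i) * bc (b i))"
        using j by (intro sum.cong) auto
      then show ?thesis using I j r y by (simp add: homU_simps(1)[OF const_hom] hom_uminus[OF bc_hom sB])
    qed
    moreover have "?b i \<in> B" if "i \<in> insert j I" for i using that y bB by (auto intro: subringD[OF sB])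
    ultimately have "?b j = 0" by (intro indep_eq_0[of "insert j I" ?e ?b j]) auto
    then have "1 * y = 0" by simp
    then show ?thesis using that[OF subring_1[OF sR]] S by (simp add: submodule_def)
  qed
qed

lemma D'_bc: "x \<in> B \<Longrightarrow> coeff (\<delta>' (bc x)) m = bc (coeff (\<delta> x) m)"
  by (simp add: exp'_bc coeff_map_poly hom_0[OF bc_hom sB])

lemma D'_sum:
  assumes "\<And>i. i \<in> I \<Longrightarrow> b i \<in> B"
  shows "coeff (\<delta>' (\<Sum>i\<in>I. const (e i) * bc (b i))) m = (\<Sum>i\<in>I. const (e i) * bc (coeff (\<delta> (b i)) m))"
  unfolding homU_simps[OF exp'_hom] coeff_sum
  by (intro sum.cong refl) (simp add: exp'_const D'_bc assms)

sublocale ext: pre_exp UNIV \<delta>'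
proof
  show "is_subring (UNIV :: 'r set)" by simp
  show "ring_hom_on UNIV \<delta>'" by (rule exp'_hom)
  show "coeff (\<delta>' r) 0 = r" for r
  proof -
    obtain I e b where b: "\<forall>i\<in>I. b i \<in> B" and r: "r = (\<Sum>i\<in>(I::nat set). const (e i) * bc (b i))"
      using spanning by blast
    have "coeff (\<delta>' r) 0 = (\<Sum>i\<in>I. const (e i) * bc (coeff (\<delta> (b i)) 0))"
      unfolding r using b by (intro D'_sum) blast
    then show ?thesis using b D_0 r by simp
  qed
qed

text \<open>Coefficients above \<open>d\<close> vanish in the sum, hence by independence in every
  term: top degrees do not cancel.\<close>

lemma degree_indep:
  assumes I: "lin_indep I e" and b: "\<And>i. i \<in> I \<Longrightarrow> b i \<in> B"
    and d: "degree (\<delta>' (\<Sum>i\<in>I. const (e i) * bc (b i))) \<le> d" and i: "i \<in> I"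
  shows "degree (\<delta> (b i)) \<le> d"
proof (rule degree_le, intro allI impI)
  fix m assume m: "d < m"
  have "(\<Sum>i\<in>I. const (e i) * bc (coeff (\<delta> (b i)) m)) = 0"
    using d m D'_sum[of I b e m] b by (simp add: coeff_eq_0)
  then show "coeff (\<delta> (b i)) m = 0"
    using indep_eq_0[OF I _ _ i, of "\<lambda>i. coeff (\<delta> (b i)) m"] D_mem b by blast
qed

lemma degree_bc:
  assumes "x \<in> B" shows "degree (\<delta>' (bc x)) = degree (\<delta> x)"
  unfolding exp'_bc[OF assms]
proof (rule antisym)
  show "degree (map_poly bc (\<delta> x)) \<le> degree (\<delta> x)"
    by (rule degree_le) (simp add: coeff_map_poly hom_0[OF bc_hom sB] coeff_eq_0)
  show "degree (\<delta> x) \<le> degree (map_poly bc (\<delta> x))"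
  proof (cases "\<delta> x = 0")
    case False
    then have "bc (coeff (\<delta> x) (degree (\<delta> x))) \<noteq> 0" using bc_eq_0 D_mem[OF assms] by (metis leading_coeff_0_iff)
    then show ?thesis by (intro le_degree) (simp add: coeff_map_poly hom_0[OF bc_hom sB])
  qed simp
qed

lemma bc_invariant_iff: "x \<in> B \<Longrightarrow> bc x \<in> ext.C \<longleftrightarrow> x \<in> C"
  using degree_bc ext.invariant_iff_degree invariant_iff_degree by simp

text \<open>Being invariant means having degree 0, and \<open>degree_indep\<close> passes this to
  every term; so invariants commute with base change.\<close>

lemma invariant_indep:
  assumes "r \<in> ext.C"
  shows "\<exists>I e b. finite I \<and> (\<forall>i\<in>I. b i \<in> C) \<and> r = (\<Sum>i\<in>I. const (e i) * bc (b i)) \<and> lin_indep I e"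
proof -
  obtain I e b where I: "finite I" and b: "\<And>i. i \<in> I \<Longrightarrow> b i \<in> B"
    and r: "r = (\<Sum>i\<in>I. const (e i) * bc (b i))" and ind: "lin_indep I e"
    using indep_representation[of r] by blast
  have "degree (\<delta>' r) \<le> 0" using assms ext.invariant_iff_degree by simp
  then have "b i \<in> C" if "i \<in> I" for i
    using degree_indep[of I e b 0 i] ind b that r invariant_iff_degree[OF b[OF that]] by simp
  with I r ind show ?thesis by blast
qed

text \<open>Scalars do not create smaller positive degrees, again because the terms of an
  independent representation have no larger degree than their sum.\<close>

lemma min_degree:
  assumes n: "\<And>x. x \<in> B \<Longrightarrow> 0 < degree (\<delta> x) \<Longrightarrow> n \<le> degree (\<delta> x)" and r: "degree (\<delta>' r) < n"
  shows "r \<in> ext.C"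
proof -
  obtain I e b where I: "finite I" and b: "\<And>i. i \<in> I \<Longrightarrow> b i \<in> B"
    and r': "r = (\<Sum>i\<in>I. const (e i) * bc (b i))" and ind: "lin_indep I e"
    using indep_representation[of r] by blast
  have "degree (\<delta> (b i)) \<le> degree (\<delta>' r)" if "i \<in> I" for i
    using degree_indep[of I e b "degree (\<delta>' r)" i] ind b that r' by simp
  then have "degree (\<delta> (b i)) = 0" if "i \<in> I" for i using n[OF b[OF that]] r that
    by (metis le_less_trans not_le gr0I)
  then have "coeff (\<delta>' r) m = 0" if "m > 0" for m
    using that D'_sum[of I b e m] b by (simp add: r' coeff_eq_0 hom_0[OF bc_hom sB])
  then have "degree (\<delta>' r) \<le> 0" by (intro degree_le) simp
  then show ?thesis using ext.invariant_iff_degree by simp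
qed

end

section \<open>Base change to \<open>k[a, b, c]\<close> and, for invariant \<open>a\<close>, to
  \<open>k[b, c]\<close>\<close>

lemma hom_comp_on:
  "ring_hom_on B f \<Longrightarrow> (\<And>x. x \<in> B \<Longrightarrow> f x \<in> B') \<Longrightarrow> ring_hom_on B' g \<Longrightarrow> ring_hom_on B (\<lambda>x. g (f x))"
  by (auto simp: ring_hom_on_def)

lemma poly_in_adjoin: "q \<in> polys_over A \<Longrightarrow> poly q a \<in> adjoin A {a}"
  by (rule poly_polys_over[OF is_subring_adjoin]) (auto simp: polys_over_def intro: adjoin_base adjoin_gen)

abbreviation const2 :: "'a::comm_ring_1 \<Rightarrow> 'a poly poly" where "const2 c \<equiv> [:[:c:]:]"

lemma const2_hom: "ring_hom_on UNIV (const2 :: 'a::comm_ring_1 \<Rightarrow> _)"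
  by (simp add: ring_hom_on_def one_pCons)

definition eval2 :: "('a::comm_ring_1 \<Rightarrow> 'c::comm_ring_1) \<Rightarrow> 'c \<Rightarrow> 'c \<Rightarrow> 'a poly poly \<Rightarrow> 'c" where
  "eval2 h b c g = poly (map_poly (\<lambda>p. poly (map_poly h p) b) g) c"

lemma eval2_hom:
  assumes h: "ring_hom_on UNIV h"
  shows "ring_hom_on UNIV (eval2 h b c)"
proof -
  have 1: "ring_hom_on UNIV (\<lambda>q. poly (map_poly h q) b)"
    by (rule hom_comp[OF hom_map_poly_UNIV[OF h] hom_eval])
  show ?thesis
    unfolding eval2_def[abs_def] by (rule hom_comp[OF hom_map_poly_UNIV[OF 1] hom_eval])
qed

lemma eval2_simps:
  assumes h: "ring_hom_on UNIV h"
  shows "eval2 h b c (const2 x) = h x" "eval2 h b c [:[:0, 1:]:] = b" "eval2 h b c [:0, 1:] = c"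
  using h by (simp_all add: eval2_def map_poly_pCons homU_simps)

definition specialize :: "'k::comm_ring_1 \<Rightarrow> 'k poly poly poly \<Rightarrow> 'k poly poly" where
  "specialize u = map_poly (map_poly (\<lambda>p. poly p u))"

lemma specialize_hom: "ring_hom_on UNIV (specialize u)"
  unfolding specialize_def by (intro hom_map_poly_UNIV hom_eval)

lemma specialize_simps:
  "specialize u (const3 x) = const2 x" "specialize u [:[:p:]:] = const2 (poly p u)"
  "specialize u var2 = [:[:0, 1:]:]" "specialize u var3 = [:0, 1:]"
  by (simp_all add: specialize_def map_poly_pCons)

lemma coeff_specialize: "coeff (coeff (specialize u p) i) j = poly (coeff (coeff p i) j) u"
  by (simp add: specialize_def coeff_map_poly)

lemma specialize_eq_0:
  fixes u :: "'k::idom"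
  assumes "specialize u p = 0"
  shows "[:[:[:-u, 1:]:]:] dvd p"
proof -
  have "[:-u, 1:] dvd coeff (coeff p i) j" for i j
    using assms coeff_specialize[of u p i j] by (simp add: poly_eq_0_iff_dvd)
  then show ?thesis by (simp add: const_poly_dvd_iff)
qed

lemma specialize_surj: "specialize u (map_poly (map_poly (\<lambda>c. [:c:])) p) = p"
  by (intro poly_eqI) (simp add: coeff_specialize coeff_map_poly)

lemma reindex_nat:
  assumes "finite J"
  obtains I :: "nat set" and f where "finite I" "bij_betw f I J"
  using ex_bij_betw_nat_finite[OF assms] finite_atLeastLessThan by blast

locale exp_coordinates = exp_map A B \<delta> + coordinates emb A B a b c
  for A B :: "'b::idom set" and \<delta> :: "'b \<Rightarrow> 'b poly" and emb :: "'b \<Rightarrow> 'k::field" and a b c :: 'b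
begin

definition exp3 :: "'k poly poly poly \<Rightarrow> 'k poly poly poly poly" where
  "exp3 = eval3 (\<lambda>e. [:const3 e:]) (map_poly coord (\<delta> a)) (map_poly coord (\<delta> b)) (map_poly coord (\<delta> c))"

lemma exp3_base_hom: "ring_hom_on UNIV (\<lambda>e::'k. [:const3 e:])"
  by (rule hom_comp[OF const3_hom hom_const])

lemma exp3_coord:
  assumes x: "x \<in> B" shows "exp3 (coord x) = map_poly coord (\<delta> x)"
proof (rule hom_eq_on_adjoin[of A "{a, b, c}"])
  show "ring_hom_on (adjoin A {a, b, c}) (\<lambda>x. exp3 (coord x))"
    using hom_comp[OF coord_hom eval3_hom[OF exp3_base_hom]] unfolding exp3_def gen .
  show "ring_hom_on (adjoin A {a, b, c}) (\<lambda>x. map_poly coord (\<delta> x))"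
    using hom_comp_on[OF exp_hom exp_polys_over hom_map_poly[OF coord_hom sB]] unfolding gen .
  show "x \<in> adjoin A {a, b, c}" using x gen by simp
  show "exp3 (coord y) = map_poly coord (\<delta> y)" if "y \<in> A" for y
    using that by (simp add: coord_simps exp_const exp3_def eval3_simps[OF exp3_base_hom] map_poly_pCons
        hom_0[OF coord_hom sB])
  show "exp3 (coord y) = map_poly coord (\<delta> y)" if "y \<in> {a, b, c}" for y
    using that by (auto simp: coord_simps exp3_def eval3_simps[OF exp3_base_hom])
qed

text \<open>The tensor product over \<open>A\<close>. The functionals are the coefficients of the
  monomials in \<open>a, b, c\<close>, and these monomials also span.\<close>

sublocale lev3: base_change B \<delta> emb A const3 coord "\<lambda>(i, j, l) p. coeff3 p i j l" exp3
proof (unfold_locales, goal_cases)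
  case 1 show ?case by (rule sA)
next
  case 2 show ?case by (rule AB)
next
  case 3 then show ?case by (rule D_mem)
next
  case 4 show ?case by (rule const3_hom)
next
  case 5 show ?case by (rule coord_hom)
next
  case 6 then show ?case by (rule coord_eq_0)
next
  case 7 then show ?case by (rule coord_simps)
next
  case 8 then show ?case by (auto split: prod.split)
next
  case 9 then show ?case by (auto split: prod.split)
next
  case (10 r) then show ?case by (intro poly_eqI) (auto split: prod.splits)
next
  case (11 x k) then show ?case using coord_coeff by (auto split: prod.split)
next
  case (12 r)
  obtain N where N: "r = (\<Sum>i\<le>N. \<Sum>j\<le>N. \<Sum>l\<le>N. const3 (coeff3 r i j l) * (var1 ^ l * var2 ^ j * var3 ^ i))"
    using poly3_expansion by blast
  let ?J = "{..N} \<times> {..N} \<times> {..N}"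
  obtain I :: "nat set" and f where I: "finite I" "bij_betw f I ?J" using reindex_nat[of ?J] by auto
  let ?e = "\<lambda>(i, j, l). coeff3 r i j l" and ?b = "\<lambda>(i, j, l). a ^ l * b ^ j * c ^ i"
  have bm: "?b t \<in> B" for t
    using gen_mem by (auto intro!: subring_mult[OF sB] subring_power[OF sB] split: prod.split)
  have "var1 ^ l * var2 ^ j * var3 ^ i = coord (a ^ l * b ^ j * c ^ i)" for i j l
    using gen_mem by (simp only: hom_mult[OF coord_hom] hom_power[OF coord_hom sB] subring_mult[OF sB]
      subring_power[OF sB] coord_simps)
  then have "r = (\<Sum>i\<le>N. \<Sum>j\<le>N. \<Sum>l\<le>N. const3 (coeff3 r i j l) * coord (a ^ l * b ^ j * c ^ i))"
    using N by simp
  also have "\<dots> = (\<Sum>t\<in>?J. const3 (?e t) * coord (?b t))"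
    by (simp add: sum.cartesian_product split_def)
  also have "\<dots> = (\<Sum>i\<in>I. const3 (?e (f i)) * coord (?b (f i)))"
    by (rule sum.reindex_bij_betw[OF I(2), symmetric])
  finally show ?case using I(1) bm
    by (intro exI[of _ I] exI[of _ "\<lambda>i. ?e (f i)"] exI[of _ "\<lambda>i. ?b (f i)"]) blast
next
  case 13 show ?case unfolding exp3_def by (rule eval3_hom[OF exp3_base_hom])
next
  case 14 show ?case unfolding exp3_def by (rule eval3_simps[OF exp3_base_hom])
next
  case 15 then show ?case by (rule exp3_coord)
qed

end

text \<open>Invariance of \<open>a\<close> makes the exponential map linear over
  \<open>A[a]\<close>, so that \<open>a\<close> can be specialized to a scalar.\<close>

locale exp_coordinates2 = exp_coordinates +
  assumes a_inv: "a \<in> invariants B \<delta>"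
begin

definition coord2 :: "'a \<Rightarrow> 'b poly poly" where
  "coord2 x = specialize (emb a) (coord x)"

definition exp2 :: "'b poly poly \<Rightarrow> 'b poly poly poly" where
  "exp2 = eval2 (\<lambda>e. [:const2 e:]) (map_poly coord2 (\<delta> b)) (map_poly coord2 (\<delta> c))"

lemma exp2_base_hom: "ring_hom_on UNIV (\<lambda>e::'b. [:const2 e:])"
  by (rule hom_comp[OF const2_hom hom_const])

lemma coord2_hom: "ring_hom_on B coord2"
  unfolding coord2_def[abs_def] by (rule hom_comp[OF coord_hom specialize_hom])

lemma coord2_simps: "x \<in> A \<Longrightarrow> coord2 x = const2 (emb x)" "coord2 a = const2 (emb a)"
    "coord2 b = [:[:0, 1:]:]" "coord2 c = [:0, 1:]"
  by (simp_all add: coord2_def coord_simps specialize_simps)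

lemma adjoin_a: "adjoin A {a} \<subseteq> B" "adjoin A {a} \<subseteq> C"
  using adjoin_least[OF is_subring_invariants, of A "{a}"] base_invariants a_inv invariantD(1) by auto

lemma coord2_base: "s \<in> adjoin A {a} \<Longrightarrow> coord2 s = const2 (emb s)"
  by (rule hom_eq_on_adjoin[of A "{a}"])
    (auto simp: coord2_simps intro: hom_mono[OF coord2_hom adjoin_a(1)]
      intro!: hom_comp[OF hom_mono[OF emb_hom] const2_hom])

lemma exp2_coord2:
  assumes x: "x \<in> B" shows "exp2 (coord2 x) = map_poly coord2 (\<delta> x)"
proof (rule hom_eq_on_adjoin[of A "{a, b, c}"])
  show "ring_hom_on (adjoin A {a, b, c}) (\<lambda>x. exp2 (coord2 x))"
    using hom_comp[OF coord2_hom eval2_hom[OF exp2_base_hom]] unfolding exp2_def gen .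
  show "ring_hom_on (adjoin A {a, b, c}) (\<lambda>x. map_poly coord2 (\<delta> x))"
    using hom_comp_on[OF exp_hom exp_polys_over hom_map_poly[OF coord2_hom sB]] unfolding gen .
  show "x \<in> adjoin A {a, b, c}" using x gen by simp
  show "exp2 (coord2 y) = map_poly coord2 (\<delta> y)" if "y \<in> A" for y
    using that by (simp add: coord2_simps exp_const exp2_def eval2_simps[OF exp2_base_hom] map_poly_pCons
        hom_0[OF coord2_hom sB])
  show "exp2 (coord2 y) = map_poly coord2 (\<delta> y)" if "y \<in> {a, b, c}" for y
    using that invariantD(2)[OF a_inv]
    by (auto simp: coord2_simps exp2_def eval2_simps[OF exp2_base_hom] map_poly_pCons hom_0[OF coord2_hom sB])
qed

lemma coeff_coord2:
  assumes "p \<in> polys3 A" "x = val p"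
  shows "coeff (coeff (coord2 x) i) j = emb (poly (coeff (coeff p i) j) a)"
proof -
  have "poly (map_poly emb q) (emb a) = emb (poly q a)" for q
    using hom_poly[OF emb_hom is_subring_UNIV, of q a] by simp
  then show ?thesis using assms
    by (simp add: coord2_def coeff_specialize coord_val coeff_map_poly emb_0)
qed

text \<open>The tensor product over \<open>A[a]\<close>, where \<open>a\<close> acts as the scalar
  \<open>emb a\<close>. As \<open>emb\<close> is injective on \<open>A[a]\<close>, the
  specialization is still injective on \<open>B\<close>.\<close>

sublocale lev2: base_change B \<delta> emb "adjoin A {a}" const2 coord2 "\<lambda>(i, j) p. coeff (coeff p i) j" exp2
proof (unfold_locales, goal_cases)
  case 1 show ?case by (rule is_subring_adjoin)
next
  case 2 show ?case by (rule adjoin_a)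
next
  case 3 then show ?case by (rule D_mem)
next
  case 4 show ?case by (rule const2_hom)
next
  case 5 show ?case by (rule coord2_hom)
next
  case (6 x)
  obtain p where p: "p \<in> polys3 A" "x = val p" using coord_ex[OF 6(1)] by blast
  have "emb (poly (coeff (coeff p i) j) a) = 0" for i j
    using coeff_coord2[OF p, of i j] 6(2) by simp
  then have z: "poly (coeff (coeff p i) j) a = 0" for i j using emb_eq_0 by blast
  have "map_poly (\<lambda>q. poly q a) (coeff p i) = 0" for i
    by (rule poly_eqI) (simp add: coeff_map_poly z)
  then have "map_poly (\<lambda>p. poly (map_poly (\<lambda>q. poly q a) p) b) p = 0"
    by (intro poly_eqI) (simp add: coeff_map_poly)
  then show ?case by (simp add: p eval3_def)
next
  case 7 then show ?case by (rule coord2_base)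
next
  case 8 then show ?case by (auto split: prod.split)
next
  case 9 then show ?case by (auto split: prod.split)
next
  case (10 r) then show ?case by (intro poly_eqI) (auto split: prod.splits)
next
  case (11 x k)
  obtain p where p: "p \<in> polys3 A" "x = val p" using coord_ex[OF 11] by blast
  then have "coeff (coeff p i) j \<in> polys_over A" for i j by (auto simp: polys_over_def)
  then show ?case by (auto simp: coeff_coord2[OF p] split: prod.split intro!: imageI poly_in_adjoin)
next
  \<comment> \<open>Spanning is inherited from \<open>lev3\<close>: lift \<open>r\<close> with
    coefficients constant in the first variable, represent the lift, and specialize.\<close>
  case (12 r)
  obtain I e t where I: "finite (I::nat set)" "\<forall>i\<in>I. t i \<in> B"
    and r: "map_poly (map_poly (\<lambda>c. [:c:])) r = (\<Sum>i\<in>I. const3 (e i) * coord (t i))"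
    using lev3.spanning[of "map_poly (map_poly (\<lambda>c. [:c:])) r"] by (elim exE conjE) (rule that)
  have "r = specialize (emb a) (\<Sum>i\<in>I. const3 (e i) * coord (t i))"
    by (simp only: specialize_surj r[symmetric])
  also have "\<dots> = (\<Sum>i\<in>I. const2 (e i) * coord2 (t i))"
    by (simp only: homU_simps[OF specialize_hom] specialize_simps(1) coord2_def)
  finally have "r = (\<Sum>i\<in>I. const2 (e i) * coord2 (t i))" .
  with I show ?case by (intro exI[of _ I] exI[of _ e] exI[of _ t] conjI)
next
  case 13 show ?case unfolding exp2_def by (rule eval2_hom[OF exp2_base_hom])
next
  case 14 show ?case unfolding exp2_def by (rule eval2_simps[OF exp2_base_hom])
next
  case 15 then show ?case by (rule exp2_coord2)
qed

end

section \<open>The invariant ring over an algebraically closed field\<close>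

text \<open>Used for the zero ideal and for ideals generated by prime elements.\<close>

lemma alg_closed_root_ideal:
  fixes G :: "'k::alg_closed_field poly" and const :: "'k \<Rightarrow> 'r::comm_ring_1"
  assumes hom: "ring_hom_on UNIV const"
    and prime: "\<And>x y. I (x * y) \<Longrightarrow> I x \<or> I y" and const: "\<And>e. e \<noteq> 0 \<Longrightarrow> \<not> I (const e)"
    and G: "G \<noteq> 0" and I: "I (poly (map_poly const G) x)"
  shows "\<exists>\<mu>. I (x - const \<mu>)"
  using G I
proof (induction "degree G" arbitrary: G rule: less_induct)
  case less
  note mh = hom_map_poly_UNIV[OF hom]
  show ?case
  proof (cases "degree G = 0")
    case True
    then obtain e where "G = [:e:]" by (auto elim: degree_eq_zeroE)
    then show ?thesis using less.prems const[of e] homU_simps(2)[OF hom] by (simp add: map_poly_pCons)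
  next
    case False
    then obtain \<mu> where "poly G \<mu> = 0" using alg_closed_imp_poly_has_root by blast
    then obtain H where H: "G = [:-\<mu>, 1:] * H" by (auto simp: poly_eq_0_iff_dvd)
    have "poly (map_poly const G) x = (x - const \<mu>) * poly (map_poly const H) x"
      unfolding H homU_simps(4)[OF mh] poly_mult
      by (simp add: map_poly_pCons homU_simps[OF hom])
    then consider "I (x - const \<mu>)" | "I (poly (map_poly const H) x)" using less.prems prime by metis
    then show ?thesis
    proof cases
      case 2
      have "H \<noteq> 0" using H less.prems by auto
      moreover from this have "degree H < degree G" unfolding H by (subst degree_mult_eq) auto
      ultimately show ?thesis using less.hyps 2 by blast
    qed blast
  qed
qed

lemma const2_unit:
  fixes p :: "'k::field poly poly"
  assumes "p dvd const2 e" "e \<noteq> 0"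
  shows "\<exists>x. p = const2 x"
proof -
  have "is_unit (const2 e)" using assms by (simp add: is_unit_const_poly_iff dvd_field_iff)
  then have "is_unit p" using assms by (meson dvd_trans)
  then show ?thesis by (auto simp: is_unit_poly_iff)
qed

abbreviation evalc :: "'k::field poly poly \<Rightarrow> 'k poly \<Rightarrow> 'k poly poly" where
  "evalc f s \<equiv> poly (map_poly const2 s) f"

lemma evalc_hom: "ring_hom_on UNIV (evalc f)"
  by (rule hom_comp[OF hom_map_poly_UNIV[OF const2_hom] hom_eval])

lemma evalc_simps: "evalc f [:e:] = const2 e" "evalc f [:-e, 1:] = f - const2 e"
  by (simp_all add: map_poly_pCons one_pCons[symmetric])

text \<open>A polynomial relation over an algebraically closed field splits into linear factors, so
  in a domain \<open>f\<close> would be a constant.\<close>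

lemma evalc_inj:
  fixes f :: "'k::alg_closed_field poly poly"
  assumes f: "\<And>x. f \<noteq> const2 x" and s: "evalc f s = 0"
  shows "s = 0"
proof (rule ccontr)
  assume "s \<noteq> 0"
  have "\<exists>\<mu>. f - const2 \<mu> = 0"
    by (rule alg_closed_root_ideal[OF const2_hom, where I = "\<lambda>x. x = 0"]) (use s \<open>s \<noteq> 0\<close> in auto)
  with f show False by auto
qed

text \<open>Division by \<open>s\<close> is possible because \<open>f - \<phi>\<close> is not a unit.\<close>

lemma evalc_divide:
  fixes f v :: "'k::alg_closed_field poly poly"
  assumes f: "\<And>x. f \<noteq> const2 x" and s: "s \<noteq> 0" and e: "evalc f s * v = evalc f t"
  shows "\<exists>g. v = evalc f g"
  using s e
proof (induction "degree s" arbitrary: s t rule: less_induct)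
  case less
  note eh = homU_simps[OF evalc_hom]
  show ?case
  proof (cases "degree s = 0")
    case True
    then obtain e where s: "s = [:e:]" by (auto elim: degree_eq_zeroE)
    then have "e \<noteq> 0" using less.prems by simp
    have "evalc f ([:1 / e:] * t) = const2 (1 / e) * evalc f t"
      by (simp only: eh evalc_simps)
    also have "\<dots> = const2 (1 / e) * const2 e * v"
      using less.prems(2) by (simp only: s evalc_simps mult.assoc)
    also have "\<dots> = v" using \<open>e \<noteq> 0\<close> by (simp add: one_pCons[symmetric])
    finally show ?thesis by metis
  next
    case False
    then obtain \<phi> where "poly s \<phi> = 0" using alg_closed_imp_poly_has_root by blast
    then obtain s' where s': "s = [:-\<phi>, 1:] * s'" by (auto simp: poly_eq_0_iff_dvd)
    have "[:-\<phi>, 1:] dvd t - [:poly t \<phi>:]" by (simp add: poly_eq_0_iff_dvd[symmetric])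
    then obtain t' where "t - [:poly t \<phi>:] = [:-\<phi>, 1:] * t'" by blast
    then have t': "t = [:-\<phi>, 1:] * t' + [:poly t \<phi>:]" by (metis diff_add_cancel)
    have e: "(f - const2 \<phi>) * (evalc f s' * v) = (f - const2 \<phi>) * evalc f t' + const2 (poly t \<phi>)"
      using less.prems(2)
      by (subst (asm) s', subst (asm) t') (simp only: eh evalc_simps mult.assoc)
    then have "(f - const2 \<phi>) * (evalc f s' * v - evalc f t') = const2 (poly t \<phi>)"
      by (simp only: right_diff_distrib) simp
    then have d: "(f - const2 \<phi>) dvd const2 (poly t \<phi>)" by (metis dvd_triv_left)
    have "poly t \<phi> = 0"
    proof (rule ccontr)
      assume "poly t \<phi> \<noteq> 0"
      from const2_unit[OF d this] obtain x where "f - const2 \<phi> = const2 x" by blast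
      then have "f = const2 (\<phi> + x)" by (simp add: algebra_simps)
      with f show False by blast
    qed
    then have "(f - const2 \<phi>) * (evalc f s' * v) = (f - const2 \<phi>) * evalc f t'" using e by simp
    moreover have "f - const2 \<phi> \<noteq> 0" using f by auto
    ultimately have "evalc f s' * v = evalc f t'" by simp
    moreover have "s' \<noteq> 0" using s' less.prems by auto
    moreover from this have "degree s' < degree s" unfolding s' by (subst degree_mult_eq) auto
    ultimately show ?thesis using less.hyps by blast
  qed
qed

text \<open>Take H(y) = r^m h((y - s)/r), with m large enough to clear the denominators.\<close>

lemma smult_power_pcompose: "\<exists>m H. smult (r ^ m) h = pcompose H [:s, r::'a::comm_ring_1:]"
proof (induction h)
  case 0
  show ?case by (rule exI[of _ 0], rule exI[of _ 0]) simp
next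
  case (pCons a h)
  then obtain m H where H: "smult (r ^ m) h = pcompose H [:s, r:]" by blast
  have "smult (r ^ Suc m) (pCons a h) = [:r ^ Suc m * a:] + [:0, r:] * smult (r ^ m) h"
    by (simp add: mult.commute)
  also have "\<dots> = pcompose ([:r ^ Suc m * a:] + [:- s, 1:] * H) [:s, r:]"
    by (simp add: H pcompose_add pcompose_mult pcompose_pCons del: mult_pCons_left)
  finally show ?case by blast
qed

locale invariant_slice = exp_coordinates A B \<delta> emb U V W
  for A B :: "'b::idom set" and \<delta> :: "'b \<Rightarrow> 'b poly" and emb :: "'b \<Rightarrow> 'k::alg_closed_field"
    and U V W :: 'b +
  assumes U_inv: "U \<in> invariants B \<delta>" and V_slice: "local_slice B \<delta> V"
    and V_lead: "coeff (\<delta> V) (degree (\<delta> V)) \<in> adjoin A {U}"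
begin

abbreviation "inU p \<equiv> [:[:p :: 'k poly:]:]"
abbreviation "CT \<equiv> lev3.ext.C"
definition "n = degree (\<delta> V)"

lemma n_pos: "n > 0" and n_min: "x \<in> B \<Longrightarrow> 0 < degree (\<delta> x) \<Longrightarrow> n \<le> degree (\<delta> x)"
  using V_slice by (auto simp: n_def local_slice_def)

lemma inU_hom: "ring_hom_on UNIV inU"
  by (rule hom_comp[OF hom_const hom_const])

lemma coord_adjoin_U: "x \<in> adjoin A {U} \<Longrightarrow> \<exists>p. coord x = inU p"
proof -
  let ?R = "{x \<in> B. \<exists>p. coord x = inU p}"
  have "is_subring ?R"
    unfolding is_subring_def
  proof (intro conjI ballI)
    show "1 \<in> ?R" using subring_1[OF sB] hom_1[OF coord_hom] by (auto intro!: exI[of _ 1] simp: one_pCons)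
    fix x y assume "x \<in> ?R" "y \<in> ?R"
    then obtain p q where xy: "x \<in> B" "y \<in> B" "coord x = inU p" "coord y = inU q" by blast
    then have "coord (x - y) = inU (p - q)" "coord (x * y) = inU (p * q)"
      by (simp_all add: hom_diff[OF coord_hom sB] hom_mult[OF coord_hom])
    then show "x - y \<in> ?R" "x * y \<in> ?R" using xy subringD[OF sB] by auto
  qed
  then have "adjoin A {U} \<subseteq> ?R"
    using base_mem gen_mem(1) coord_simps by (intro adjoin_least) auto
  then show "x \<in> adjoin A {U} \<Longrightarrow> \<exists>p. coord x = inU p" by blast
qed

lemma const3_CT: "const3 e \<in> CT"
  using lev3.exp'_const by (simp add: invariants_def)

lemma coord_CT: "x \<in> C \<Longrightarrow> coord x \<in> CT"
  using lev3.bc_invariant_iff invariantD(1) by blast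

lemmas sCT = lev3.ext.is_subring_invariants

lemma inU_CT: "inU p \<in> CT"
proof (induction p)
  case 0
  show ?case using const3_CT[of 0] by simp
next
  case (pCons a p)
  have "inU (pCons a p) = const3 a + coord U * inU p" by (simp add: coord_simps)
  also have "\<dots> \<in> CT"
    by (intro subring_add[OF sCT] subring_mult[OF sCT] const3_CT coord_CT U_inv pCons.IH)
  finally show ?case .
qed

lemma V_not_CT: "coord V \<notin> CT"
  using lev3.bc_invariant_iff[OF gen_mem(2)] n_pos invariant_iff_degree[OF gen_mem(2)] by (simp add: n_def)

lemma CT_factorially_closed: "x * y \<in> CT \<Longrightarrow> x * y \<noteq> 0 \<Longrightarrow> x \<in> CT" "x * y \<in> CT \<Longrightarrow> x * y \<noteq> 0 \<Longrightarrow> y \<in> CT"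
  using lev3.ext.factorially_closed by blast+

text \<open>Reduction modulo \<open>V\<close>, from k[U, V, W] to k[U][W]. By \<open>psi_inj\<close>
  it embeds the invariants.\<close>

definition psi :: "'k poly poly poly \<Rightarrow> 'k poly poly" where
  "psi = map_poly (\<lambda>q. poly q 0)"

lemma psi_hom: "ring_hom_on UNIV psi"
  unfolding psi_def by (intro hom_map_poly_UNIV hom_eval)

lemma coeff_psi: "coeff (psi p) i = coeff (coeff p i) 0"
  by (simp add: psi_def coeff_map_poly poly_0_coeff_0)

lemma psi_simps: "psi (inU p) = [:p:]" "psi var2 = 0" "psi var3 = [:0, 1:]"
  by (simp_all add: psi_def map_poly_pCons)

lemma psi_eq_0: assumes "psi p = 0" shows "coord V dvd p"
proof -
  have "[:0, 1:] dvd coeff p i" for i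
    using assms coeff_psi[of p i] poly_eq_0_iff_dvd[of "coeff p i" 0] by (simp add: poly_0_coeff_0)
  then show ?thesis by (simp add: const_poly_dvd_iff coord_simps)
qed

text \<open>A nonzero invariant multiple of \<open>V\<close> would make the slice \<open>V\<close>
  invariant, by factorial closedness.\<close>

lemma psi_inj: assumes "p \<in> CT" "psi p = 0" shows "p = 0"
proof (rule ccontr)
  assume "p \<noteq> 0"
  obtain g where "p = coord V * g" using psi_eq_0[OF assms(2)] by blast
  then show False using CT_factorially_closed(1)[of "coord V" g] assms \<open>p \<noteq> 0\<close> V_not_CT by simp
qed

text \<open>The constant term of the expansion of \<open>?a ^ N * W\<close> in powers of
  \<open>V\<close> is an invariant, and modulo \<open>V\<close> it equals a power of an element of
  k[U] times \<open>W\<close>.\<close>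

lemma degree_one_invariant: "\<exists>F\<in>C. \<exists>s r. psi (coord F) = [:s, r:] \<and> r \<noteq> 0"
proof -
  let ?a = "coeff (\<delta> V) (degree (\<delta> V))"
  obtain N p where p: "p \<in> polys_over C" "?a ^ N * W = poly p V"
    using slice_expansion[OF V_slice gen_mem(3)] by blast
  obtain F q where F: "p = pCons F q" by (cases p) auto
  have FC: "F \<in> C" using p by (auto simp: F polys_over_def dest: spec[of _ 0])
  have "coeff q i \<in> C" for i using p by (auto simp: F polys_over_def dest: spec[of _ "Suc i"])
  then have "q \<in> polys_over B" using invariantD(1) by (auto simp: polys_over_def)
  then have qB: "poly q V \<in> B" by (intro poly_polys_over[OF sB] gen_mem)
  have aB: "?a \<in> B" "?a \<noteq> 0" using D_mem gen_mem(2) n_pos by (auto simp: n_def)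
  obtain a0 where a0: "coord ?a = inU a0" using coord_adjoin_U[OF V_lead] by blast
  have "a0 \<noteq> 0" using coord_eq_0[OF aB(1)] aB(2) a0 by auto
  have e: "?a ^ N * W = F + V * poly q V" using p by (simp add: F)
  have "coord (?a ^ N * W) = coord F + coord V * coord (poly q V)"
    unfolding e using FC qB gen_mem invariantD(1)
    by (simp add: hom_add[OF coord_hom] hom_mult[OF coord_hom] subringD[OF sB])
  moreover have "coord (?a ^ N * W) = inU a0 ^ N * var3"
    using aB gen_mem
    by (simp only: hom_mult[OF coord_hom] hom_power[OF coord_hom sB] subring_power[OF sB] a0 coord_simps)
  ultimately have "psi (inU a0 ^ N * var3) = psi (coord F) + psi var2 * psi (coord (poly q V))"
    by (simp only: homU_simps[OF psi_hom] coord_simps)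
  then have "psi (coord F) = [:0, a0 ^ N:]"
    by (simp only: homU_simps[OF psi_hom] psi_simps) (simp add: poly_const_pow)
  then show ?thesis using FC \<open>a0 \<noteq> 0\<close> by (metis power_not_zero)
qed

text \<open>The minimality of the leading coefficient of \<open>F\<close> at \<open>V = 0\<close> keeps \<open>F\<close> non-constant modulo every
  \<open>U - u\<close>, see \<open>F_specialize\<close>.\<close>

definition "inv_deg d \<longleftrightarrow> (\<exists>F\<in>C. \<exists>s r. psi (coord F) = [:s, r:] \<and> r \<noteq> 0 \<and> degree r = d)"

definition F :: 'b where
  "F = (SOME F. F \<in> C \<and> (\<exists>s r. psi (coord F) = [:s, r:] \<and> r \<noteq> 0 \<and> degree r = (LEAST d. inv_deg d)))"

lemma F_props: "F \<in> C" "\<exists>s r. psi (coord F) = [:s, r:] \<and> r \<noteq> 0 \<and> degree r = (LEAST d. inv_deg d)"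
proof -
  have "\<exists>d. inv_deg d" using degree_one_invariant unfolding inv_deg_def by blast
  then have "inv_deg (LEAST d. inv_deg d)" by (rule LeastI_ex)
  then have "\<exists>F. F \<in> C \<and> (\<exists>s r. psi (coord F) = [:s, r:] \<and> r \<noteq> 0 \<and> degree r = (LEAST d. inv_deg d))"
    unfolding inv_deg_def by blast
  from someI_ex[OF this] show "F \<in> C" "\<exists>s r. psi (coord F) = [:s, r:] \<and> r \<noteq> 0 \<and> degree r = (LEAST d. inv_deg d)"
    unfolding F_def by blast+
qed

text \<open>The minimum over \<open>B\<close> is not lowered by scalars of k: in an independent
  representation of \<open>p\<close> every term has zero coefficients wherever \<open>p\<close> has,
  and some term is nonzero at the position of the leading coefficient of \<open>r\<close>.\<close>

lemma F_min:
  assumes p: "p \<in> CT" "psi p = [:s, r:]" "r \<noteq> 0"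
  shows "(LEAST d. inv_deg d) \<le> degree r"
proof -
  obtain I e b where b: "\<And>i. i \<in> I \<Longrightarrow> b i \<in> C"
    and pe: "p = (\<Sum>i\<in>I. const3 (e i) * coord (b i))" and ind: "lev3.lin_indep I e"
    using lev3.invariant_indep[OF p(1)] by blast
  have bB: "b i \<in> B" if "i \<in> I" for i using b[OF that] invariantD(1) by blast
  have z: "coeff3 (coord (b t)) i j l = 0" if "t \<in> I" "coeff3 p i j l = 0" for t i j l
    using lev3.indep_cf_eq_0[OF ind, of b "(i, j, l)" t] bB that pe by simp
  have p2: "coeff3 p i 0 l = 0" if "i \<ge> 2" for i l
  proof -
    have "coeff (psi p) i = 0" using p(2) that by (simp add: coeff_pCons split: nat.split)
    then show ?thesis by (simp add: coeff_psi)
  qed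
  have p1: "coeff3 p 1 0 l = coeff r l" for l
    using coeff_psi[of p 1] p(2) by simp
  have "\<exists>t\<in>I. coeff3 (coord (b t)) 1 0 (degree r) \<noteq> 0"
  proof (rule ccontr)
    assume "\<not> ?thesis"
    then have "coeff3 p 1 0 (degree r) = 0" by (simp add: pe coeff_sum)
    then show False using p1[of "degree r"] p(3) by simp
  qed
  then obtain t where t: "t \<in> I" and nz: "coeff3 (coord (b t)) 1 0 (degree r) \<noteq> 0" by blast
  let ?q = "coord (b t)"
  let ?r = "coeff (psi ?q) 1"
  have "psi ?q = [:coeff (psi ?q) 0, ?r:]"
  proof (rule poly_eqI)
    fix i :: nat
    consider "i = 0" | "i = 1" | "i \<ge> 2" by linarith
    then show "coeff (psi ?q) i = coeff [:coeff (psi ?q) 0, ?r:] i"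
    proof cases
      case 3
      then have "coeff (psi ?q) i = 0" using z[OF t p2] by (intro poly_eqI) (simp add: coeff_psi)
      then show ?thesis using 3 by (simp add: coeff_pCons split: nat.split)
    qed simp_all
  qed
  moreover have "?r \<noteq> 0" using nz by (auto simp: coeff_psi)
  moreover have "degree ?r \<le> degree r"
    by (rule degree_le) (use z[OF t, of 1 0] p1 in \<open>auto simp: coeff_psi coeff_eq_0\<close>)
  ultimately have "inv_deg (degree ?r)" using b[OF t] unfolding inv_deg_def by blast
  then have "(LEAST d. inv_deg d) \<le> degree ?r" by (rule Least_le)
  with \<open>degree ?r \<le> degree r\<close> show ?thesis by simp
qed

abbreviation "lin u \<equiv> [:[:[:-u, 1:]:]:] :: 'k poly poly poly"

text \<open>Otherwise (F - x)/(U - u) would be an invariant, by factorial closedness, and its image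
  under \<open>psi\<close> would have leading coefficient r/(U - u), against
  \<open>F_min\<close>.\<close>

lemma F_specialize: "specialize u (coord F) \<noteq> const2 x"
proof
  assume "specialize u (coord F) = const2 x"
  then have "specialize u (coord F - const3 x) = 0"
    by (simp only: homU_simps[OF specialize_hom] specialize_simps(1)) simp
  from specialize_eq_0[OF this] obtain g where g: "coord F - const3 x = lin u * g" by blast
  obtain s r where sr: "psi (coord F) = [:s, r:]" "r \<noteq> 0" "degree r = (LEAST d. inv_deg d)"
    using F_props(2) by blast
  have ps: "psi (lin u * g) = [:s - [:x:], r:]"
    unfolding g[symmetric] by (simp only: homU_simps[OF psi_hom] psi_simps sr) simp
  have "lin u * g \<in> CT"
    unfolding g[symmetric] using coord_CT[OF F_props(1)] const3_CT by (intro subringD[OF sCT])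
  moreover have "lin u * g \<noteq> 0"
  proof
    assume "lin u * g = 0"
    then have "[:s - [:x:], r:] = 0" using ps homU_simps(2)[OF psi_hom] by metis
    then show False using sr(2) by simp
  qed
  ultimately have gC: "g \<in> CT" by (rule CT_factorially_closed(2))
  have psg: "[:[:-u, 1:]:] * psi g = [:s - [:x:], r:]"
    using ps by (simp only: homU_simps[OF psi_hom] psi_simps)
  have cg: "[:-u, 1:] * coeff (psi g) i = coeff [:s - [:x:], r:] i" for i
    using arg_cong[OF psg, of "\<lambda>p. coeff p i"] by simp
  let ?r = "coeff (psi g) 1"
  have "psi g = [:coeff (psi g) 0, ?r:]"
  proof (rule poly_eqI)
    fix i :: nat
    consider "i = 0" | "i = 1" | "i \<ge> 2" by linarith
    then show "coeff (psi g) i = coeff [:coeff (psi g) 0, ?r:] i"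
    proof cases
      case 3
      then have "[:-u, 1:] * coeff (psi g) i = 0" using cg[of i] by (simp add: coeff_pCons split: nat.splits)
      then have "coeff (psi g) i = 0" by (metis mult_eq_0_iff pCons_eq_0_iff one_neq_zero)
      then show ?thesis using 3 by (simp add: coeff_pCons split: nat.split)
    qed simp_all
  qed
  moreover have r: "r = [:-u, 1:] * ?r" using cg[of 1] by simp
  then have "?r \<noteq> 0" using sr(2) by auto
  ultimately have "degree r \<le> degree ?r" using F_min[OF gC] sr(3) by metis
  moreover have "degree r = Suc (degree ?r)"
    using \<open>?r \<noteq> 0\<close> by (subst r, subst degree_mult_eq) auto
  ultimately show False by simp
qed

definition evalF :: "'k poly poly \<Rightarrow> 'k poly poly poly" where
  "evalF H = poly (map_poly inU H) (coord F)"

lemma evalF_hom: "ring_hom_on UNIV evalF"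
  unfolding evalF_def[abs_def] by (rule hom_comp[OF hom_map_poly_UNIV[OF inU_hom] hom_eval])

lemma evalF_simps: "evalF [:p:] = inU p" "evalF [:0, 1:] = coord F"
  by (simp_all add: evalF_def map_poly_pCons one_pCons[symmetric])

lemma evalF_CT: "evalF H \<in> CT"
  unfolding evalF_def
  by (rule poly_polys_over[OF sCT]) (auto simp: polys_over_def coeff_map_poly inU_CT coord_CT F_props)

lemma specialize_evalF:
  "specialize u (evalF H) = evalc (specialize u (coord F)) (map_poly (\<lambda>p. poly p u) H)"
proof (rule hom_poly_unique[where f = "\<lambda>H. specialize u (evalF H)"])
  show "ring_hom_on UNIV (\<lambda>H. specialize u (evalF H))" by (rule hom_comp[OF evalF_hom specialize_hom])
  show "ring_hom_on UNIV (\<lambda>H. evalc (specialize u (coord F)) (map_poly (\<lambda>p. poly p u) H))"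
    by (rule hom_comp[OF hom_map_poly_UNIV[OF hom_eval] evalc_hom])
  show "specialize u (evalF [:p:]) = evalc (specialize u (coord F)) (map_poly (\<lambda>p. poly p u) [:p:])" for p
    by (simp add: evalF_simps specialize_simps map_poly_pCons)
  show "specialize u (evalF [:0, 1:]) = evalc (specialize u (coord F)) (map_poly (\<lambda>p. poly p u) [:0, 1:])"
    unfolding evalF_simps by (simp add: map_poly_pCons one_pCons[symmetric])
qed

text \<open>One root u of \<open>r\<close> at a time: modulo U - u the element H(u, F) vanishes, and
  F is not constant there, hence transcendental; so U - u divides all coefficients of
  \<open>H\<close>.\<close>

lemma evalF_divide:
  assumes "r \<noteq> 0" "inU r * c = evalF H"
  shows "\<exists>H'. c = evalF H'"
  using assms
proof (induction "degree r" arbitrary: r H rule: less_induct)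
  case less
  note eh = homU_simps[OF evalF_hom]
  show ?case
  proof (cases "degree r = 0")
    case True
    then obtain e where r: "r = [:e:]" by (auto elim: degree_eq_zeroE)
    then have "e \<noteq> 0" using less.prems by simp
    have "evalF ([:[:1 / e:]:] * H) = const3 (1 / e) * const3 e * c"
      using less.prems(2) by (simp only: eh evalF_simps r mult.assoc)
    also have "\<dots> = c" using \<open>e \<noteq> 0\<close> by (simp add: one_pCons[symmetric])
    finally show ?thesis by metis
  next
    case False
    then obtain u where "poly r u = 0" using alg_closed_imp_poly_has_root by blast
    then obtain r' where r': "r = [:-u, 1:] * r'" by (auto simp: poly_eq_0_iff_dvd)
    have "specialize u (evalF H) = 0"
      using less.prems(2)[symmetric] \<open>poly r u = 0\<close>
      by (simp only: homU_simps[OF specialize_hom] specialize_simps) simp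
    then have "map_poly (\<lambda>p. poly p u) H = 0"
      unfolding specialize_evalF using evalc_inj[of "specialize u (coord F)"] F_specialize by blast
    then have "poly (coeff H i) u = 0" for i by (metis coeff_map_poly coeff_0 poly_0)
    then have "[:[:-u, 1:]:] dvd H" by (simp add: const_poly_dvd_iff poly_eq_0_iff_dvd)
    then obtain H' where H': "H = [:[:-u, 1:]:] * H'" by blast
    have "lin u * (inU r' * c) = inU r * c"
      unfolding r' homU_simps(4)[OF inU_hom] by (simp only: mult.assoc)
    also have "\<dots> = lin u * evalF H'"
      unfolding less.prems(2) H' by (simp only: eh evalF_simps)
    finally have "inU r' * c = evalF H'"
      by (metis mult_cancel_left pCons_eq_0_iff one_neq_zero)
    moreover have "r' \<noteq> 0" using r' less.prems by auto
    moreover from this have "degree r' < degree r" unfolding r' by (subst degree_mult_eq) auto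
    ultimately show ?thesis using less.hyps by blast
  qed
qed

text \<open>Modulo \<open>V\<close>, F is s + r W with s, r in k[U], so r^m c agrees there with a
  polynomial in U and F. By \<open>psi_inj\<close> the two are equal, and
  \<open>evalF_divide\<close> removes r^m.\<close>

theorem CT_generated:
  assumes c: "c \<in> CT" shows "\<exists>H. c = evalF H"
proof -
  obtain s r where sr: "psi (coord F) = [:s, r:]" "r \<noteq> 0" using F_props(2) by blast
  have pe: "psi (evalF H) = pcompose H [:s, r:]" for H
  proof (rule hom_poly_unique[where f = "\<lambda>H. psi (evalF H)"])
    show "ring_hom_on UNIV (\<lambda>H. psi (evalF H))" by (rule hom_comp[OF evalF_hom psi_hom])
    show "ring_hom_on UNIV (\<lambda>H. pcompose H [:s, r:])"
      by (simp add: ring_hom_on_def pcompose_add pcompose_mult one_pCons)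
  qed (simp_all add: evalF_simps psi_simps sr pcompose_pCons)
  obtain m H where H: "smult (r ^ m) (psi c) = pcompose H [:s, r:]"
    using smult_power_pcompose by blast
  have "psi (inU (r ^ m) * c - evalF H) = 0"
    by (simp only: homU_simps[OF psi_hom] psi_simps pe H[symmetric]) simp
  moreover have "inU (r ^ m) * c - evalF H \<in> CT"
    using c inU_CT evalF_CT by (intro subringD[OF sCT])
  ultimately have "inU (r ^ m) * c = evalF H" using psi_inj by force
  then show ?thesis using evalF_divide[of "r ^ m"] sr(2) by simp
qed

text \<open>Likewise \<open>V0\<close> is congruent to no invariant modulo a divisor \<open>U - u\<close> of its leading
  coefficient, see \<open>specialize_V0\<close>.\<close>

definition "slice_deg d \<longleftrightarrow> (\<exists>x\<in>B. degree (\<delta> x) = n \<and> (\<exists>p. coord (coeff (\<delta> x) n) = inU p \<and> degree p = d))"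

definition V0 :: 'b where
  "V0 = (SOME x. x \<in> B \<and> degree (\<delta> x) = n \<and>
     (\<exists>p. coord (coeff (\<delta> x) n) = inU p \<and> degree p = (LEAST d. slice_deg d)))"

lemma V0_props: "V0 \<in> B" "degree (\<delta> V0) = n"
  "\<exists>p. coord (coeff (\<delta> V0) n) = inU p \<and> degree p = (LEAST d. slice_deg d)"
proof -
  obtain p where "coord (coeff (\<delta> V) n) = inU p" using coord_adjoin_U[OF V_lead] n_def by auto
  then have "slice_deg (degree p)" unfolding slice_deg_def using gen_mem(2)
    by (intro bexI[of _ V] conjI exI[of _ p]) (simp_all add: n_def)
  then have "\<exists>d. slice_deg d" ..
  then have "slice_deg (LEAST d. slice_deg d)" by (rule LeastI_ex)
  then have "\<exists>x. x \<in> B \<and> degree (\<delta> x) = n \<and>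
     (\<exists>p. coord (coeff (\<delta> x) n) = inU p \<and> degree p = (LEAST d. slice_deg d))"
    unfolding slice_deg_def by blast
  from someI_ex[OF this] show "V0 \<in> B" "degree (\<delta> V0) = n"
    "\<exists>p. coord (coeff (\<delta> V0) n) = inU p \<and> degree p = (LEAST d. slice_deg d)"
    unfolding V0_def by blast+
qed

definition a0 :: "'k poly" where "a0 = (SOME p. coord (coeff (\<delta> V0) n) = inU p)"

lemma a0: "coord (coeff (\<delta> V0) n) = inU a0" "degree a0 = (LEAST d. slice_deg d)"
proof -
  obtain p where p: "coord (coeff (\<delta> V0) n) = inU p" "degree p = (LEAST d. slice_deg d)"
    using V0_props(3) by blast
  then show 1: "coord (coeff (\<delta> V0) n) = inU a0" unfolding a0_def by (metis (mono_tags, lifting) someI)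
  then show "degree a0 = (LEAST d. slice_deg d)" using p by simp
qed

lemma lead_V0: "coeff (\<delta> V0) n \<in> C" "coeff (\<delta> V0) n \<noteq> 0" "a0 \<noteq> 0"
proof -
  show 1: "coeff (\<delta> V0) n \<in> C" using lead_coeff_invariant[OF V0_props(1)] V0_props(2) by simp
  show 2: "coeff (\<delta> V0) n \<noteq> 0" using V0_props(2) n_pos by (metis degree_0 less_irrefl leading_coeff_0_iff)
  show "a0 \<noteq> 0" using 1 2 coord_eq_0 a0(1) invariantD(1) by fastforce
qed

lemma V0_slice: "local_slice B \<delta> V0"
  using V0_props n_pos n_min by (simp add: local_slice_def)

lemma exp3_V0: "degree (exp3 (coord V0)) = n" "coeff (exp3 (coord V0)) n = inU a0"
  using lev3.degree_bc[OF V0_props(1)] V0_props(2) lev3.D'_bc[OF V0_props(1)] a0 by simp_all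

text \<open>As in \<open>F_min\<close>, some term of an independent representation does at least as
  well as \<open>r\<close>, and it comes from \<open>B\<close>. The zero coefficients of
  \<open>inU p\<close> keep its leading coefficient in k[U].\<close>

lemma V0_min:
  assumes "degree (exp3 r) = n" "coeff (exp3 r) n = inU p"
  shows "degree a0 \<le> degree p"
proof -
  obtain I e b where I: "finite I" and b: "\<And>i. i \<in> I \<Longrightarrow> b i \<in> B"
    and re: "r = (\<Sum>i\<in>I. const3 (e i) * coord (b i))" and ind: "lev3.lin_indep I e"
    using lev3.indep_representation[of r] by blast
  have deg: "degree (\<delta> (b i)) \<le> n" if "i \<in> I" for i
    using lev3.degree_indep[of I e b n i] ind b that re assms(1) by simp
  have Dm: "coeff (\<delta> (b i)) n \<in> B" if "i \<in> I" for i using D_mem[OF b[OF that]] .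
  have s: "inU p = (\<Sum>i\<in>I. const3 (e i) * coord (coeff (\<delta> (b i)) n))"
    using lev3.D'_sum[of I b e n] b re assms(2) by simp
  have z: "coeff3 (coord (coeff (\<delta> (b t)) n)) i j l = 0" if "t \<in> I" "coeff3 (inU p) i j l = 0" for t i j l
    using lev3.indep_cf_eq_0[OF ind, of "\<lambda>i. coeff (\<delta> (b i)) n" "(i, j, l)" t] Dm that s by simp
  have "coeff (exp3 r) n \<noteq> 0" using assms(1) n_pos by (metis degree_0 less_irrefl leading_coeff_0_iff)
  then obtain t where t: "t \<in> I" "coord (coeff (\<delta> (b t)) n) \<noteq> 0"
    using s assms(2) by (metis (no_types, lifting) mult_zero_right sum.neutral)
  let ?q = "coord (coeff (\<delta> (b t)) n)"
  let ?p = "coeff (coeff ?q 0) 0"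
  have "?q = inU ?p"
  proof (intro poly_eqI)
    fix i j l
    show "coeff3 ?q i j l = coeff3 (inU ?p) i j l"
      using z[OF t(1), of i j l] by (cases i; cases j) (auto simp: coeff_pCons)
  qed
  moreover have "degree ?p \<le> degree p"
    by (rule degree_le) (use z[OF t(1), of 0 0] in \<open>auto simp: coeff_eq_0\<close>)
  moreover have "degree (\<delta> (b t)) = n"
  proof (rule antisym[OF deg[OF t(1)]])
    have "coeff (\<delta> (b t)) n \<noteq> 0" using t(2) hom_0[OF coord_hom sB] by auto
    then show "n \<le> degree (\<delta> (b t))" by (rule le_degree)
  qed
  ultimately have "slice_deg (degree ?p)" using b[OF t(1)] unfolding slice_deg_def by blast
  then have "(LEAST d. slice_deg d) \<le> degree ?p" by (rule Least_le)
  with \<open>degree ?p \<le> degree p\<close> show ?thesis using a0 by simp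
qed

lemma CT_min_degree: "degree (exp3 r) < n \<Longrightarrow> r \<in> CT"
  using lev3.min_degree[OF n_min] by blast

text \<open>\<open>lead_coeff_invariant\<close> rests on the composition law of
  \<open>\<delta>\<close>, so it is applied in \<open>B\<close>, to the terms of an independent
  representation.\<close>

lemma lead_CT:
  assumes "degree (exp3 r) \<le> n"
  shows "coeff (exp3 r) n \<in> CT"
proof -
  obtain I e b where I: "finite I" and b: "\<And>i. i \<in> I \<Longrightarrow> b i \<in> B"
    and re: "r = (\<Sum>i\<in>I. const3 (e i) * coord (b i))" and ind: "lev3.lin_indep I e"
    using lev3.indep_representation[of r] by blast
  have "coeff (\<delta> (b i)) n \<in> C" if "i \<in> I" for i
  proof -
    have "degree (\<delta> (b i)) \<le> n" using lev3.degree_indep[of I e b n i] ind b that re assms by simp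
    then show ?thesis
      using lead_coeff_invariant[OF b[OF that]] subring_0[OF is_subring_invariants]
      by (cases "degree (\<delta> (b i)) = n") (auto simp: coeff_eq_0)
  qed
  then have "(\<Sum>i\<in>I. const3 (e i) * coord (coeff (\<delta> (b i)) n)) \<in> CT"
    by (intro subring_sum[OF sCT] subring_mult[OF sCT] const3_CT coord_CT)
  then show ?thesis using lev3.D'_sum[of I b e n] b unfolding re by (simp only:)
qed

text \<open>Otherwise (V0 - H(U, F))/(U - u) would have degree \<open>n\<close> and leading
  coefficient a0/(U - u), against \<open>V0_min\<close>.\<close>

lemma specialize_V0: "specialize u (coord V0) = specialize u (evalF H) \<Longrightarrow> poly a0 u \<noteq> 0"
proof
  assume e: "specialize u (coord V0) = specialize u (evalF H)" and "poly a0 u = 0"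
  have "specialize u (coord V0 - evalF H) = 0" using e by (simp only: homU_simps[OF specialize_hom]) simp
  from specialize_eq_0[OF this] obtain g where g: "coord V0 - evalF H = lin u * g" by blast
  have "exp3 (coord V0 - evalF H) = exp3 (coord V0) - [:evalF H:]"
    using lev3.ext.invariantD(2)[OF evalF_CT] by (simp only: homU_simps[OF lev3.exp'_hom])
  then have x: "exp3 (coord V0) - [:evalF H:] = smult (lin u) (exp3 g)"
    unfolding g lev3.ext.invariant_mult_exp[OF inU_CT UNIV_I] by simp
  have "coeff (exp3 (coord V0) - [:evalF H:]) i = coeff (exp3 (coord V0)) i" if "i > 0" for i
    using that by (simp add: coeff_pCons split: nat.split)
  then have c: "lin u * coeff (exp3 g) i = coeff (exp3 (coord V0)) i" if "i > 0" for i
    using that x by (metis coeff_smult)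
  have "degree (exp3 g) \<le> n"
  proof (rule degree_le, intro allI impI)
    fix i assume "n < i"
    then have "lin u * coeff (exp3 g) i = 0" using c[of i] exp3_V0(1) by (simp add: coeff_eq_0)
    then show "coeff (exp3 g) i = 0" by (metis mult_eq_0_iff pCons_eq_0_iff one_neq_zero)
  qed
  obtain a' where a': "a0 = [:-u, 1:] * a'" using \<open>poly a0 u = 0\<close> by (auto simp: poly_eq_0_iff_dvd)
  have "lin u * coeff (exp3 g) n = lin u * inU a'"
    using c[OF n_pos] exp3_V0(2) a' homU_simps(4)[OF inU_hom, of "[:-u, 1:]" a'] by simp
  then have g': "coeff (exp3 g) n = inU a'" by (metis mult_cancel_left pCons_eq_0_iff one_neq_zero)
  have "a' \<noteq> 0" using a' lead_V0(3) by auto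
  then have "coeff (exp3 g) n \<noteq> 0" using g' by simp
  then have "degree (exp3 g) = n" using \<open>degree (exp3 g) \<le> n\<close> le_degree by (metis le_antisym)
  from V0_min[OF this g'] have "degree a0 \<le> degree a'" .
  moreover have "degree a0 = Suc (degree a')" using \<open>a' \<noteq> 0\<close> by (subst a', subst degree_mult_eq) auto
  ultimately show False by simp
qed

text \<open>With c the top coefficient of \<open>b\<close>, the element c V0 - a0 b has degree below
  \<open>n\<close> and is invariant. The factors U - u of a0 are split off from c one at a time:
  modulo such a factor the identity reads c1 V0 = d with c1 and d polynomials in F. Were c1 nonzero
  there, \<open>evalc_divide\<close> would make V0 a polynomial in F, against
  \<open>specialize_V0\<close>.\<close>

theorem lead_principal:
  assumes b: "degree (exp3 b) \<le> n"
  shows "inU a0 dvd coeff (exp3 b) n"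
proof -
  let ?c = "coeff (exp3 b) n"
  have c: "?c \<in> CT" by (rule lead_CT[OF b])
  have c0: "?c * coord V0 - inU a0 * b \<in> CT"
  proof -
    have e: "exp3 (?c * coord V0 - inU a0 * b) = smult ?c (exp3 (coord V0)) - smult (inU a0) (exp3 b)"
      using lev3.ext.invariant_mult_exp[OF c UNIV_I] lev3.ext.invariant_mult_exp[OF inU_CT UNIV_I]
      by (simp only: homU_simps[OF lev3.exp'_hom])
    have "degree (exp3 (?c * coord V0 - inU a0 * b)) < n"
    proof (rule degree_lessI)
      show "\<forall>k\<ge>n. coeff (exp3 (?c * coord V0 - inU a0 * b)) k = 0"
        unfolding e using exp3_V0 b by (auto simp: le_less coeff_eq_0 mult.commute)
    qed (use n_pos in simp)
    then show ?thesis by (rule CT_min_degree)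
  qed
  have "inU r dvd ?c" if "r dvd a0" for r
    using that
  proof (induction "degree r" arbitrary: r rule: less_induct)
    case less
    have "r \<noteq> 0" using less.prems lead_V0(3) by auto
    show ?case
    proof (cases "degree r = 0")
      case True
      then have "is_unit r" using \<open>r \<noteq> 0\<close> by (simp add: is_unit_iff_degree)
      then have "is_unit (inU r)" by (simp add: is_unit_const_poly_iff)
      then show ?thesis by blast
    next
      case False
      then obtain u where u: "poly r u = 0" using alg_closed_imp_poly_has_root by blast
      then obtain r' where r': "r = [:-u, 1:] * r'" by (auto simp: poly_eq_0_iff_dvd)
      have "r' \<noteq> 0" using r' \<open>r \<noteq> 0\<close> by auto
      then have "degree r' < degree r" unfolding r' by (subst degree_mult_eq) auto
      moreover have "r' dvd a0" using less.prems r' by (metis dvd_mult_right)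
      ultimately have "inU r' dvd ?c" using less.hyps by blast
      then obtain c1 where c1: "?c = inU r' * c1" by blast
      obtain a2 where a2: "a0 = r * a2" using less.prems by blast
      have u0: "poly a0 u = 0" using u a2 by simp
      show ?thesis
      proof (cases "?c = 0")
        case False
        have c1C: "c1 \<in> CT" using c c1 False CT_factorially_closed(2)[of "inU r'" c1] by simp
        \<comment> \<open>The invariant c V0 - a0 b divided by r', using a0 = r' (U - u) a2.\<close>
        define d where "d = c1 * coord V0 - lin u * (inU a2 * b)"
        have "inU a0 = inU r' * (lin u * inU a2)"
          unfolding a2 r' homU_simps(4)[OF inU_hom] by (simp only: mult_ac)
        then have "inU r' * d = ?c * coord V0 - inU a0 * b"
          unfolding d_def c1 by (simp only: right_diff_distrib mult.assoc)
        then have d': "inU r' * d \<in> CT" using c0 by simp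
        have dC: "d \<in> CT"
        proof (cases "d = 0")
          case True
          then show ?thesis using subring_0[OF sCT] by simp
        next
          case False
          then have "inU r' * d \<noteq> 0" using \<open>r' \<noteq> 0\<close> by (metis mult_eq_0_iff pCons_eq_0_iff)
          then show ?thesis using d' CT_factorially_closed(2) by blast
        qed
        obtain S T where S: "c1 = evalF S" and T: "d = evalF T" using CT_generated c1C dC by blast
        let ?f = "specialize u (coord F)" and ?s = "map_poly (\<lambda>p. poly p u)"
        have "specialize u (lin u) = 0" by (simp add: specialize_simps)
        then have "specialize u d = specialize u c1 * specialize u (coord V0)"
          unfolding d_def by (simp only: homU_simps[OF specialize_hom]) simp
        then have "evalc ?f (?s S) * specialize u (coord V0) = evalc ?f (?s T)"
          by (simp only: S T specialize_evalF)
        moreover have "?s S = 0"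
        proof (rule ccontr)
          assume "?s S \<noteq> 0"
          with evalc_divide[OF F_specialize this] calculation
          obtain g where "specialize u (coord V0) = evalc ?f g" by blast
          also have "g = ?s (map_poly (\<lambda>e. [:e:]) g)" by (intro poly_eqI) (simp add: coeff_map_poly)
          finally have "specialize u (coord V0) = specialize u (evalF (map_poly (\<lambda>e. [:e:]) g))"
            by (simp only: specialize_evalF)
          from specialize_V0[OF this] u0 show False by simp
        qed
        then have "specialize u c1 = 0" by (simp add: S specialize_evalF)
        from specialize_eq_0[OF this] obtain g where "c1 = lin u * g" by blast
        then have "?c = inU r * g"
          unfolding c1 r' homU_simps(4)[OF inU_hom] by (simp only: mult_ac)
        then show ?thesis by (metis dvd_triv_left)
      qed simp
    qed
  qed
  then show ?thesis by simp
qed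

end

section \<open>Two invariant coordinates\<close>

context base_change
begin

lemma spannedI:
  assumes J: "finite J" and b: "\<And>j. j \<in> J \<Longrightarrow> b j \<in> S" and r: "r = (\<Sum>j\<in>J. const (e j) * bc (b j))"
  shows "spanned S r"
proof -
  obtain I :: "nat set" and f where I: "finite I" and f: "bij_betw f I J" using reindex_nat[OF J] by metis
  have "r = (\<Sum>i\<in>I. const (e (f i)) * bc (b (f i)))"
    unfolding r by (rule sum.reindex_bij_betw[OF f, symmetric])
  moreover have "b (f i) \<in> S" if "i \<in> I" for i using b f that by (auto simp: bij_betw_def)
  ultimately show ?thesis
    unfolding spanned_def using I by (intro exI[of _ I] exI[of _ "\<lambda>i. e (f i)"] exI[of _ "\<lambda>i. b (f i)"]) simp
qed

lemma spanned_add: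
  assumes "spanned S r" "spanned S r'"
  shows "spanned S (r + r')"
proof -
  obtain I e b where 1: "finite (I::nat set)" "\<forall>i\<in>I. b i \<in> S" "r = (\<Sum>i\<in>I. const (e i) * bc (b i))"
    using assms(1) unfolding spanned_def by blast
  obtain J f c where 2: "finite (J::nat set)" "\<forall>i\<in>J. c i \<in> S" "r' = (\<Sum>i\<in>J. const (f i) * bc (c i))"
    using assms(2) unfolding spanned_def by blast
  show ?thesis
    by (rule spannedI[of "Sum_Type.Plus I J" "case_sum b c" S _ "case_sum e f"])
      (use 1 2 in \<open>auto simp: sum.Plus\<close>)
qed

lemma spanned_mult:
  assumes "spanned S r" "spanned S r'" and S: "S \<subseteq> B" and mult: "\<And>x y. x \<in> S \<Longrightarrow> y \<in> S \<Longrightarrow> x * y \<in> S"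
  shows "spanned S (r * r')"
proof -
  obtain I e b where 1: "finite (I::nat set)" "\<forall>i\<in>I. b i \<in> S" "r = (\<Sum>i\<in>I. const (e i) * bc (b i))"
    using assms(1) unfolding spanned_def by blast
  obtain J f c where 2: "finite (J::nat set)" "\<forall>i\<in>J. c i \<in> S" "r' = (\<Sum>i\<in>J. const (f i) * bc (c i))"
    using assms(2) unfolding spanned_def by blast
  have "r * r' = (\<Sum>(i, j)\<in>I \<times> J. (const (e i) * bc (b i)) * (const (f j) * bc (c j)))"
    unfolding 1 2 by (simp add: sum_product sum.cartesian_product)
  also have "\<dots> = (\<Sum>(i, j)\<in>I \<times> J. const (e i * f j) * bc (b i * c j))"
    using 1 2 S by (intro sum.cong refl)
      (auto simp: homU_simps[OF const_hom] hom_mult[OF bc_hom] subset_iff ac_simps)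
  finally show ?thesis
    using 1 2 mult by (intro spannedI[of "I \<times> J" "\<lambda>(i, j). b i * c j" S _ "\<lambda>(i, j). e i * f j"])
      (auto simp: split_def)
qed

lemma spanned_const_bc: "x \<in> S \<Longrightarrow> spanned S (const e * bc x)"
  by (rule spannedI[of "{0::nat}" "\<lambda>_. x" S _ "\<lambda>_. e"]) auto

lemma spanned_bc: "x \<in> S \<Longrightarrow> spanned S (bc x)"
  using spanned_const_bc[of x S 1] by (simp add: homU_simps(1)[OF const_hom])

lemma spanned_poly:
  assumes S: "S \<subseteq> B" "is_subring S" and p: "\<And>i. spanned S (coeff p i)" and x: "spanned S x"
  shows "spanned S (poly p x)"
  using p
proof (induction p)
  case 0
  show ?case using spanned_bc[OF subring_0[OF S(2)]] hom_0[OF bc_hom sB] by simp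
next
  case (pCons a p)
  have "spanned S a" using pCons.prems[of 0] by simp
  moreover have "spanned S (poly p x)" using pCons.IH pCons.prems[of "Suc _"] by simp
  ultimately show ?case
    using spanned_add spanned_mult[OF x _ S(1) subring_mult[OF S(2)]] by simp
qed

end

lemma dvd_diff_trans: "q dvd a - b \<Longrightarrow> q dvd b - c \<Longrightarrow> q dvd a - (c::'a::comm_ring_1)"
  using dvd_add[of q "a - b" "b - c"] by simp

lemma adjoin_poly:
  assumes A: "is_subring A" and x: "x \<in> adjoin A {a}"
  shows "\<exists>q\<in>polys_over A. x = poly q a"
proof -
  let ?R = "(\<lambda>q. poly q a) ` polys_over A"
  note sr = is_subring_polys_over[OF A]
  have "is_subring ?R"
    unfolding is_subring_def
  proof (intro conjI ballI)
    show "1 \<in> ?R" using subring_1[OF sr] by force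
    fix x y assume "x \<in> ?R" "y \<in> ?R"
    then obtain p q where pq: "p \<in> polys_over A" "q \<in> polys_over A" and xy: "x = poly p a" "y = poly q a" by blast
    have "x - y = poly (p - q) a" "x * y = poly (p * q) a" unfolding xy by simp_all
    then show "x - y \<in> ?R" "x * y \<in> ?R" using subringD[OF sr] pq by blast+
  qed
  moreover have "x \<in> ?R" if "x \<in> A" for x
    using that const_polys_over[OF A that] by (intro image_eqI[of _ _ "[:x:]"]) auto
  moreover have "a \<in> ?R" using var_polys_over[OF A] by (intro image_eqI[of _ _ "[:0, 1:]"]) auto
  ultimately have "adjoin A {a} \<subseteq> ?R" by (intro adjoin_least) auto
  then show ?thesis using x by blast
qed

text \<open>The expansion of \<open>x\<close> has coefficients in \<open>A\<close> and
  \<open>emb\<close> is injective, so the shape visible over k already holds over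
  \<open>A\<close>.\<close>

lemma (in coordinates) coord_first:
  assumes x: "x \<in> B" and e: "coord x = [:[:p:]:]"
  shows "x \<in> adjoin A {a}"
proof -
  obtain q where q: "q \<in> polys3 A" "x = val q" "coord x = map_poly3 emb q"
    using coord_ex[OF x] by blast
  have "emb (coeff3 q i j l) = coeff3 [:[:p:]:] i j l" for i j l
    using e q(3) by (metis (no_types, lifting) coeff_map_poly map_poly_0 emb_0)
  then have z: "coeff3 q i j l = 0" if "i > 0 \<or> j > 0" for i j l
    using that by (intro emb_eq_0) (auto simp: coeff_pCons split: nat.split)
  let ?q = "coeff (coeff q 0) 0"
  have "q = [:[:?q:]:]"
    by (intro poly_eqI) (use z in \<open>auto simp: coeff_pCons split: nat.split\<close>)
  then have "x = val [:[:?q:]:]" using q(2) by simp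
  also have "\<dots> = poly ?q a" by (simp add: eval3_def map_poly_pCons)
  finally show ?thesis using poly_in_adjoin[of ?q A a] q(1) by (simp add: polys_over_def)
qed

text \<open>The sorts of \<open>'k\<close> make \<open>'k poly poly\<close> factorial, as needed for
  the induction over prime divisors in \<open>divide_all\<close>.\<close>

locale two_coordinates = U: invariant_slice A B \<delta> emb U V W + X: exp_coordinates2 A B \<delta> emb X Y Z
  for A B :: "'b::idom set" and \<delta> :: "'b \<Rightarrow> 'b poly"
    and emb :: "'b \<Rightarrow> 'k::{alg_closed_field, factorial_ring_gcd, semiring_gcd_mult_normalize}"
    and U V W X Y Z :: 'b +
  assumes U_notin: "U \<notin> adjoin A {X}"
begin

abbreviation "C2 \<equiv> X.lev2.ext.C"
abbreviation "inU p \<equiv> [:[:p :: 'k poly:]:]"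
abbreviation "lin u \<equiv> [:[:[:-u, 1:]:]:] :: 'k poly poly poly"

definition trans :: "'k poly poly poly \<Rightarrow> 'k poly poly poly" where
  "trans = eval3 const3 (X.coord U) (X.coord V) (X.coord W)"

lemma trans_hom: "ring_hom_on UNIV trans"
  unfolding trans_def by (rule eval3_hom[OF const3_hom])

lemma trans_simps: "trans (const3 e) = const3 e" "trans var1 = X.coord U"
    "trans var2 = X.coord V" "trans var3 = X.coord W"
  unfolding trans_def by (rule eval3_simps[OF const3_hom])+

lemma trans_coord: assumes "x \<in> B" shows "trans (U.coord x) = X.coord x"
proof (rule hom_eq_on_adjoin[of A "{U, V, W}"])
  show "ring_hom_on (adjoin A {U, V, W}) (\<lambda>x. trans (U.coord x))"
    using hom_comp[OF U.coord_hom trans_hom] unfolding U.gen .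
  show "ring_hom_on (adjoin A {U, V, W}) X.coord" using X.coord_hom unfolding U.gen .
  show "x \<in> adjoin A {U, V, W}" using assms U.gen by simp
  show "trans (U.coord y) = X.coord y" if "y \<in> A" for y
    by (simp only: U.coord_simps(1)[OF that] X.coord_simps(1)[OF that] trans_simps)
  show "trans (U.coord y) = X.coord y" if "y \<in> {U, V, W}" for y
    using that by (auto simp only: U.coord_simps trans_simps insert_iff empty_iff)
qed

text \<open>Passage from k[U, V, W] to k[Y, Z]: the change of coordinates, after which X becomes a
  scalar.\<close>

definition spec :: "'k poly poly poly \<Rightarrow> 'k poly poly" where
  "spec p = specialize (emb X) (trans p)"

lemma spec_hom: "ring_hom_on UNIV spec"
  unfolding spec_def[abs_def] by (rule hom_comp[OF trans_hom specialize_hom])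

lemma spec_const: "spec (const3 e) = const2 e"
  by (simp only: spec_def trans_simps specialize_simps(1))

lemma spec_coord: "x \<in> B \<Longrightarrow> spec (U.coord x) = X.coord2 x"
  by (simp only: spec_def trans_coord X.coord2_def)

lemma coord_U_not_X: "X.coord U \<noteq> inU p"
  using X.coord_first[OF U.gen_mem(1)] U_notin by blast

lemma const3_unit:
  fixes p :: "'k poly poly poly"
  assumes "p dvd 1" shows "\<exists>x. p = const3 x"
  using assms by (auto simp: is_unit_poly_iff)

text \<open>If \<open>X - \<xi>\<close> were divisible by \<open>U - u\<close>, then the two would agree up to a constant factor,
  because \<open>X - \<xi>\<close> is irreducible in the coordinates \<open>X, Y, Z\<close>.\<close>

lemma lin_not_dvd: "\<not> lin u dvd U.coord X - const3 \<xi>"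
proof
  assume "lin u dvd U.coord X - const3 \<xi>"
  then obtain g where g: "U.coord X - const3 \<xi> = lin u * g" by blast
  have l: "lin u = var1 - const3 u" "lin \<xi> = var1 - const3 \<xi>" by simp_all
  have e: "lin \<xi> = (X.coord U - const3 u) * trans g"
    using arg_cong[OF g, of trans]
    by (simp only: homU_simps[OF trans_hom] l trans_simps trans_coord[OF X.gen_mem(1)] X.coord_simps)
  have lnz: "lin \<xi> \<noteq> 0" by simp
  have cancel: "y * z = 1" if "x = y * (x * z)" "x \<noteq> 0" for x y z :: "'k poly poly poly"
    using that by (metis mult.left_commute mult.right_neutral mult_cancel_left)
  have s: "specialize \<xi> (lin \<xi>) = 0" by (simp add: specialize_simps)
  \<comment> \<open>At X = \<xi> the left side vanishes, so one factor is divisible by X - \<xi>.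
    What remains is a product equal to 1, hence consists of constants. Either way U lies in
    k[X].\<close>
  have "specialize \<xi> (X.coord U - const3 u) * specialize \<xi> (trans g) = 0"
    using arg_cong[OF e, of "specialize \<xi>"] s by (simp only: homU_simps(4)[OF specialize_hom])
  then consider "specialize \<xi> (trans g) = 0" | "specialize \<xi> (X.coord U - const3 u) = 0" by auto
  then show False
  proof cases
    case 1
    from specialize_eq_0[OF this] obtain g' where "trans g = lin \<xi> * g'" by blast
    then have "lin \<xi> = (X.coord U - const3 u) * (lin \<xi> * g')" using e by metis
    then have "(X.coord U - const3 u) * g' = 1" using cancel[OF _ lnz] by blast
    then have "X.coord U - const3 u dvd 1" by (metis dvd_triv_left)
    then obtain x where "X.coord U - const3 u = const3 x" using const3_unit by blast
    then have "X.coord U = inU ([:x:] + [:u:])" by (simp add: algebra_simps)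
    then show False using coord_U_not_X by blast
  next
    case 2
    from specialize_eq_0[OF this] obtain h where h: "X.coord U - const3 u = lin \<xi> * h" by blast
    have "lin \<xi> = (lin \<xi> * h) * trans g" using e unfolding h .
    also have "\<dots> = h * (lin \<xi> * trans g)" by (simp only: mult_ac)
    finally have "lin \<xi> = h * (lin \<xi> * trans g)" .
    then have "h * trans g = 1" using cancel[OF _ lnz] by blast
    then have "h dvd 1" by (metis dvd_triv_left)
    then obtain x where "h = const3 x" using const3_unit by blast
    then have "X.coord U = inU ([:-\<xi>, 1:] * [:x:] + [:u:])" using h by (simp add: algebra_simps)
    then show False using coord_U_not_X by blast
  qed
qed

text \<open>Since \<open>emb\<close> is injective and X is transcendental over \<open>A\<close>, a
  coefficient of U at a monomial in Y, Z that vanishes after specialization was zero before; so U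
  would lie in A[X].\<close>

lemma coord2_U: "X.coord2 U \<noteq> const2 y"
proof
  assume e: "X.coord2 U = const2 y"
  obtain q where q: "q \<in> polys3 A" "U = X.val q" using X.coord_ex[OF U.gen_mem(1)] by blast
  have qc: "coeff (coeff q i) j \<in> polys_over A" for i j using q(1) by (auto simp: polys_over_def)
  have tr: "r = 0" if r: "r \<in> polys_over A" "poly r X = 0" for r
  proof -
    have "[:[:r:]:] \<in> polys3 A" using r by (intro const_polys_over is_subring_polys_over U.sA)
    moreover have "X.val [:[:r:]:] = 0" using r by (simp add: eval3_def map_poly_pCons)
    ultimately show ?thesis using X.indep by fastforce
  qed
  have z: "coeff (coeff q i) j = 0" if "i > 0 \<or> j > 0" for i j
  proof (rule tr[OF qc])
    have "emb (poly (coeff (coeff q i) j) X) = coeff (coeff (const2 y) i) j"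
      using X.coeff_coord2[OF q, of i j] e by simp
    also have "\<dots> = 0" using that by (auto simp: coeff_pCons split: nat.split)
    finally show "poly (coeff (coeff q i) j) X = 0" by (rule U.emb_eq_0)
  qed
  let ?q = "coeff (coeff q 0) 0"
  have "q = [:[:?q:]:]"
    by (intro poly_eqI) (use z in \<open>auto simp: coeff_pCons split: nat.split\<close>)
  then have "U = X.val [:[:?q:]:]" using q(2) by simp
  also have "\<dots> = poly ?q X" by (simp add: eval3_def map_poly_pCons)
  finally show False using U_notin poly_in_adjoin[OF qc] by metis
qed

section \<open>Invariants on \<open>k[Y, Z]\<close> modulo the prime factors of
  \<open>U - u\<close>\<close>

lemmas sC2 = X.lev2.ext.is_subring_invariants

lemma const2_C2: "const2 e \<in> C2"
  using X.lev2.exp'_const by (simp add: invariants_def)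

lemma coord2_C2: "x \<in> U.C \<Longrightarrow> X.coord2 x \<in> C2"
  using X.lev2.bc_invariant_iff U.invariantD(1) by blast

lemma C2_factorially_closed: "x * y \<in> C2 \<Longrightarrow> x * y \<noteq> 0 \<Longrightarrow> x \<in> C2" "x * y \<in> C2 \<Longrightarrow> x * y \<noteq> 0 \<Longrightarrow> y \<in> C2"
  using X.lev2.ext.factorially_closed by blast+

abbreviation "U2 \<equiv> X.coord2 U"
abbreviation "V2 \<equiv> X.coord2 U.V0"
abbreviation "F2 \<equiv> X.coord2 U.F"

lemma spec_inU: "spec (inU p) = evalc U2 p"
proof (rule hom_poly_unique[where f = "\<lambda>p. spec (inU p)"])
  show "ring_hom_on UNIV (\<lambda>p. spec (inU p))" by (rule hom_comp[OF U.inU_hom spec_hom])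
  show "ring_hom_on UNIV (evalc U2)" by (rule evalc_hom)
  show "spec (const3 e) = evalc U2 [:e:]" for e by (simp only: spec_const evalc_simps)
  show "spec var1 = evalc U2 [:0, 1:]"
    using spec_coord[OF U.gen_mem(1)] by (simp add: U.coord_simps map_poly_pCons one_pCons[symmetric])
qed

text \<open>An element of degree at most \<open>n\<close> is a combination of images of elements of
  \<open>B\<close> of degree at most \<open>n\<close>, and for these the divisibility holds in
  k[U, V, W] by \<open>lead_principal\<close>.\<close>

lemma lead_dvd:
  assumes b: "degree (X.exp2 b) \<le> U.n"
  shows "spec (inU U.a0) dvd coeff (X.exp2 b) U.n"
proof -
  obtain I e t where t: "\<And>i. i \<in> I \<Longrightarrow> t i \<in> B"
    and r: "b = (\<Sum>i\<in>I. const2 (e i) * X.coord2 (t i))" and ind: "X.lev2.lin_indep I e"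
    using X.lev2.indep_representation[of b] by blast
  have "spec (inU U.a0) dvd X.coord2 (coeff (\<delta> (t i)) U.n)" if i: "i \<in> I" for i
  proof -
    have "degree (\<delta> (t i)) \<le> U.n" using X.lev2.degree_indep[of I e t U.n i] ind t i r b by simp
    then have "inU U.a0 dvd U.coord (coeff (\<delta> (t i)) U.n)"
      using U.lead_principal[of "U.coord (t i)"] U.lev3.degree_bc[OF t[OF i]] U.lev3.D'_bc[OF t[OF i]] by simp
    then obtain g where "U.coord (coeff (\<delta> (t i)) U.n) = inU U.a0 * g" by blast
    then have "spec (U.coord (coeff (\<delta> (t i)) U.n)) = spec (inU U.a0) * spec g"
      by (simp only: homU_simps(4)[OF spec_hom])
    then show ?thesis using spec_coord[OF U.D_mem[OF t[OF i]]] by simp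
  qed
  then have "spec (inU U.a0) dvd (\<Sum>i\<in>I. const2 (e i) * X.coord2 (coeff (\<delta> (t i)) U.n))"
    by (intro dvd_sum dvd_mult)
  then show ?thesis using X.lev2.D'_sum[of I t e U.n] t unfolding r by (simp only:)
qed

text \<open>The components of the fibres of U in the plane with coordinates Y, Z.\<close>

definition "over_U q \<longleftrightarrow> prime_elem q \<and> (\<exists>u. q dvd U2 - const2 u)"

lemma over_U_C2: assumes "over_U q" shows "q \<in> C2"
proof -
  obtain u g where g: "U2 - const2 u = q * g" using assms unfolding over_U_def by blast
  have "U2 - const2 u \<in> C2" by (intro subring_diff[OF sC2] const2_C2 coord2_C2 U.U_inv)
  moreover have "U2 - const2 u \<noteq> 0" using coord2_U by auto
  ultimately show ?thesis using g C2_factorially_closed(1)[of q g] by simp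
qed

lemma prime_not_dvd_const2:
  assumes q: "prime_elem (q :: 'k poly poly)" and e: "e \<noteq> 0" shows "\<not> q dvd const2 e"
proof
  assume "q dvd const2 e"
  moreover have "is_unit (const2 e)" using e by (simp add: is_unit_const_poly_iff dvd_field_iff)
  ultimately have "is_unit q" by (meson dvd_trans)
  then show False using q by (simp add: prime_elem_not_unit)
qed

lemma prime_root:
  assumes "prime_elem (q :: 'k poly poly)" "G \<noteq> 0" "q dvd evalc x G"
  shows "\<exists>\<mu>. q dvd x - const2 \<mu>"
  by (rule alg_closed_root_ideal[OF const2_hom, where I = "\<lambda>x. q dvd x"])
    (use assms prime_not_dvd_const2 in \<open>auto simp: prime_elem_dvd_mult_iff\<close>)

lemma evalF_mod:
  assumes q: "q dvd U2 - const2 u"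
  shows "q dvd spec (U.evalF H) - evalc F2 (map_poly (\<lambda>p. poly p u) H)"
proof (induction H)
  case 0
  then show ?case using homU_simps(2)[OF spec_hom] homU_simps(2)[OF U.evalF_hom] by simp
next
  case (pCons p H)
  have "U.evalF (pCons p H) = U.evalF [:p:] + U.evalF [:0, 1:] * U.evalF H"
    by (simp only: homU_simps[OF U.evalF_hom, symmetric]) simp
  then have s: "spec (U.evalF (pCons p H)) = spec (inU p) + F2 * spec (U.evalF H)"
    using spec_coord[of U.F] U.F_props(1) U.invariantD(1)
    by (simp only: homU_simps[OF spec_hom] U.evalF_simps)
  have m: "evalc F2 (map_poly (\<lambda>p. poly p u) (pCons p H)) =
      const2 (poly p u) + F2 * evalc F2 (map_poly (\<lambda>p. poly p u) H)"
    by (simp add: map_poly_pCons)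
  have "[:-u, 1:] dvd p - [:poly p u:]" by (simp add: poly_eq_0_iff_dvd[symmetric])
  then obtain p' where "p - [:poly p u:] = [:-u, 1:] * p'" by blast
  then have "evalc U2 (p - [:poly p u:]) = (U2 - const2 u) * evalc U2 p'"
    by (simp only: homU_simps[OF evalc_hom] evalc_simps)
  then have "spec (inU p) - const2 (poly p u) = (U2 - const2 u) * evalc U2 p'"
    by (simp only: homU_simps[OF evalc_hom] evalc_simps spec_inU)
  then have "q dvd spec (inU p) - const2 (poly p u)" using q by (metis dvd_mult2)
  then have "q dvd (spec (inU p) - const2 (poly p u))
      + F2 * (spec (U.evalF H) - evalc F2 (map_poly (\<lambda>p. poly p u) H))"
    using pCons.IH by (intro dvd_add dvd_mult)
  then show ?case unfolding s m by (simp add: algebra_simps)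
qed

text \<open>The invariant X is a polynomial H(U, F), and on k[Y, Z] it is the scalar
  \<open>emb X\<close>. Modulo \<open>q\<close> this becomes the equation H(u, F) =
  \<open>emb X\<close> for F over k. Were it trivial, U - u would divide X - \<open>emb X\<close> in
  k[U, V, W], against \<open>lin_not_dvd\<close>.\<close>

lemma F2_mod:
  assumes q: "over_U q" shows "\<exists>\<phi>. q dvd F2 - const2 \<phi>"
proof -
  obtain u where u: "q dvd U2 - const2 u" using q over_U_def by blast
  obtain H where H: "U.coord X = U.evalF H"
    using U.CT_generated U.coord_CT[OF X.a_inv] by blast
  let ?G = "map_poly (\<lambda>p. poly p u) H - [:emb X:]"
  have "spec (U.evalF H) = const2 (emb X)"
    using spec_coord[OF X.gen_mem(1)] X.coord2_simps(2) by (simp add: H)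
  then have "q dvd const2 (emb X) - evalc F2 (map_poly (\<lambda>p. poly p u) H)" using evalF_mod[OF u, of H] by simp
  then have "q dvd evalc F2 (map_poly (\<lambda>p. poly p u) H) - const2 (emb X)" by (metis dvd_minus_iff minus_diff_eq)
  then have d: "q dvd evalc F2 ?G" by (simp only: homU_simps[OF evalc_hom] evalc_simps)
  have "?G \<noteq> 0"
  proof
    assume "?G = 0"
    then have "map_poly (\<lambda>p. poly p u) H = [:emb X:]" by simp
    then have "specialize u (U.coord X) = const2 (emb X)"
      unfolding H U.specialize_evalF by (simp only: evalc_simps)
    then have "specialize u (U.coord X - const3 (emb X)) = 0"
      by (simp only: homU_simps[OF specialize_hom] specialize_simps(1) diff_self)
    from specialize_eq_0[OF this] lin_not_dvd show False by blast
  qed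
  then show ?thesis using prime_root d q over_U_def by blast
qed

text \<open>The invariants are spanned by images of elements of \<open>U.C\<close>; these are
  polynomials in U and F, and both are constant modulo \<open>q\<close>.\<close>

lemma C2_mod:
  assumes q: "over_U q" and c: "c \<in> C2" shows "\<exists>l. q dvd c - const2 l"
proof -
  obtain u where u: "q dvd U2 - const2 u" using q over_U_def by blast
  obtain \<phi> where \<phi>: "q dvd F2 - const2 \<phi>" using F2_mod[OF q] by blast
  obtain I :: "nat set" and e t where t: "\<And>i. i \<in> I \<Longrightarrow> t i \<in> U.C"
    and r: "c = (\<Sum>i\<in>I. const2 (e i) * X.coord2 (t i))"
    using X.lev2.invariant_indep[OF c] by blast
  have "\<exists>l. q dvd X.coord2 (t i) - const2 l" if i: "i \<in> I" for i
  proof -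
    obtain H where H: "U.coord (t i) = U.evalF H" using U.CT_generated U.coord_CT[OF t[OF i]] by blast
    let ?G = "map_poly (\<lambda>p. poly p u) H"
    have 1: "q dvd X.coord2 (t i) - evalc F2 ?G"
      using evalF_mod[OF u, of H] spec_coord[OF U.invariantD(1)[OF t[OF i]]] H by simp
    have "[:-\<phi>, 1:] dvd ?G - [:poly ?G \<phi>:]" by (simp add: poly_eq_0_iff_dvd[symmetric])
    then obtain g where "?G - [:poly ?G \<phi>:] = [:-\<phi>, 1:] * g" by blast
    then have "evalc F2 (?G - [:poly ?G \<phi>:]) = (F2 - const2 \<phi>) * evalc F2 g"
      by (simp only: homU_simps[OF evalc_hom] evalc_simps)
    then have "evalc F2 ?G - const2 (poly ?G \<phi>) = (F2 - const2 \<phi>) * evalc F2 g"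
      by (simp only: homU_simps[OF evalc_hom] evalc_simps)
    then have 2: "q dvd evalc F2 ?G - const2 (poly ?G \<phi>)" using \<phi> by (metis dvd_mult2)
    show ?thesis using dvd_diff_trans[OF 1 2] by blast
  qed
  then obtain l where l: "\<And>i. i \<in> I \<Longrightarrow> q dvd X.coord2 (t i) - const2 (l i)" by metis
  have "c - const2 (\<Sum>i\<in>I. e i * l i) = (\<Sum>i\<in>I. const2 (e i) * (X.coord2 (t i) - const2 (l i)))"
    unfolding r by (simp only: homU_simps[OF const2_hom] right_diff_distrib sum_subtractf)
  moreover have "q dvd \<dots>" using l by (intro dvd_sum dvd_mult)
  ultimately show ?thesis by metis
qed

lemma V2_not_mod:
  assumes q: "over_U q" shows "\<not> q dvd V2 - const2 \<mu>"
proof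
  assume "q dvd V2 - const2 \<mu>"
  then obtain b where b: "V2 - const2 \<mu> = q * b" by blast
  have "X.exp2 (V2 - const2 \<mu>) = X.exp2 V2 - [:const2 \<mu>:]"
    by (simp only: homU_simps[OF X.lev2.exp'_hom] X.lev2.exp'_const)
  then have x: "X.exp2 V2 - [:const2 \<mu>:] = smult q (X.exp2 b)"
    unfolding b X.lev2.ext.invariant_mult_exp[OF over_U_C2[OF q] UNIV_I] by simp
  have "coeff (X.exp2 V2 - [:const2 \<mu>:]) i = coeff (X.exp2 V2) i" if "i > 0" for i
    using that by (simp add: coeff_pCons split: nat.split)
  then have c: "q * coeff (X.exp2 b) i = coeff (X.exp2 V2) i" if "i > 0" for i
    using that x by (metis coeff_smult)
  have q0: "q \<noteq> 0" and qu: "\<not> q dvd 1" using q by (auto simp: over_U_def prime_elem_def)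
  have dV: "degree (X.exp2 V2) = U.n" using X.lev2.degree_bc[OF U.V0_props(1)] U.V0_props(2) by simp
  have "degree (X.exp2 b) \<le> U.n"
  proof (rule degree_le, intro allI impI)
    fix i assume "U.n < i"
    then have "q * coeff (X.exp2 b) i = 0" using c[of i] dV by (simp add: coeff_eq_0)
    then show "coeff (X.exp2 b) i = 0" using q0 by simp
  qed
  \<comment> \<open>The top coefficient of \<open>V2\<close> is \<open>q\<close> times that of
    \<open>b\<close>, and \<open>lead_dvd\<close> makes the latter a multiple of the former; so
    \<open>q\<close> would be a unit.\<close>
  from lead_dvd[OF this] obtain z where z: "coeff (X.exp2 b) U.n = spec (inU U.a0) * z" by blast
  have l: "coeff (X.exp2 V2) U.n = spec (inU U.a0)"
    using X.lev2.D'_bc[OF U.V0_props(1), of U.n] spec_coord[OF U.D_mem[OF U.V0_props(1), of U.n]]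
    by (simp only: U.a0(1))
  have "spec (inU U.a0) \<noteq> 0"
    using dV l U.n_pos by (metis degree_0 less_irrefl leading_coeff_0_iff)
  moreover have "spec (inU U.a0) * (q * z) = spec (inU U.a0)"
    using c[OF U.n_pos] unfolding z l by (simp only: mult.left_commute)
  ultimately have "q * z = 1" by simp
  then show False using qu by (metis dvd_triv_left)
qed

lemma divide_prime:
  assumes q: "over_U q" and \<gamma>: "\<gamma> \<in> polys_over C2" and d: "q dvd poly \<gamma> V2"
  shows "\<exists>\<gamma>'\<in>polys_over C2. \<gamma> = smult q \<gamma>'"
proof -
  \<comment> \<open>The value at 0 is fixed so that \<open>map_poly l\<close> acts on every
    coefficient.\<close>
  define l where "l c = (if c = 0 then 0 else SOME l. q dvd c - const2 l)" for c
  have l: "q dvd c - const2 (l c)" if "c \<in> C2" for c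
    using someI_ex[OF C2_mod[OF q that]] by (simp add: l_def)
  let ?L = "map_poly l \<gamma>"
  have l0: "l 0 = 0" by (simp add: l_def)
  have "[:q:] dvd \<gamma> - map_poly const2 ?L"
    using l \<gamma> by (auto simp: const_poly_dvd_iff coeff_map_poly l0 polys_over_def)
  then obtain g where g: "\<gamma> - map_poly const2 ?L = [:q:] * g" by blast
  have "poly \<gamma> V2 - evalc V2 ?L = q * poly g V2"
    using arg_cong[OF g, of "\<lambda>p. poly p V2"] by simp
  then have "q dvd poly \<gamma> V2 - evalc V2 ?L" by simp
  then have dL: "q dvd evalc V2 ?L" using d by (metis dvd_diff_right_iff dvd_diff_commute)
  \<comment> \<open>A nonzero \<open>?L\<close> has constant coefficients, so \<open>V2\<close>
    would be algebraic over k modulo \<open>q\<close> and hence constant there.\<close>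
  have "?L = 0"
    using prime_root[OF _ _ dL] V2_not_mod[OF q] q over_U_def by blast
  then have "\<gamma> = smult q g" using g by simp
  moreover have "coeff g i \<in> C2" for i
  proof (cases "coeff g i = 0")
    case True
    then show ?thesis using subring_0[OF sC2] by simp
  next
    case False
    have "q * coeff g i \<in> C2" using \<gamma> \<open>\<gamma> = smult q g\<close> by (auto simp: polys_over_def)
    moreover have "q \<noteq> 0" using q by (auto simp: over_U_def)
    ultimately show ?thesis using False C2_factorially_closed(2)[of q "coeff g i"] by simp
  qed
  ultimately show ?thesis by (auto simp: polys_over_def)
qed

lemma divide_all:
  fixes w :: "'k poly poly"
  assumes "w \<noteq> 0" "\<And>q. prime_elem q \<Longrightarrow> q dvd w \<Longrightarrow> over_U q" "\<gamma> \<in> polys_over C2" "w dvd poly \<gamma> V2"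
  shows "\<exists>\<gamma>'\<in>polys_over C2. \<gamma> = smult w \<gamma>'"
  using assms
proof (induction w arbitrary: \<gamma> rule: prime_divisors_induct)
  case zero
  then show ?case by simp
next
  case (unit w)
  then obtain w' where w': "1 = w * w'" by blast
  then have "w' dvd const2 1" by (simp add: one_pCons[symmetric]) (metis dvd_triv_right)
  then obtain y where "w' = const2 y" using const2_unit[of w' 1] by auto
  then have "w' \<in> C2" using const2_C2 by simp
  then have "smult w' \<gamma> \<in> polys_over C2" using unit(4) by (auto simp: polys_over_def subring_mult[OF sC2])
  moreover have "\<gamma> = smult w (smult w' \<gamma>)" using w' by simp
  ultimately show ?case by blast
next
  case (factor q w)
  have q: "over_U q" using factor(4)[of q] factor(1) by (simp add: prime_imp_prime_elem)
  have "q dvd poly \<gamma> V2" using factor(6) by (metis dvd_mult_left)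
  from divide_prime[OF q factor(5) this] obtain \<gamma>' where \<gamma>': "\<gamma>' \<in> polys_over C2" "\<gamma> = smult q \<gamma>'" by blast
  have "q \<noteq> 0" using factor(3) by auto
  then have "w dvd poly \<gamma>' V2" using factor(6) \<gamma>'(2) by simp
  moreover have "over_U p" if "prime_elem p" "p dvd w" for p using factor(4)[OF that(1)] that(2) by (simp add: dvd_mult)
  ultimately obtain \<gamma>'' where "\<gamma>'' \<in> polys_over C2" "\<gamma>' = smult w \<gamma>''"
    using factor(2)[of \<gamma>'] factor(3) \<gamma>'(1) by auto
  then show ?case using \<gamma>'(2) by (intro bexI[of _ \<gamma>'']) auto
qed

text \<open>If U - u divided a nonzero polynomial in X over \<open>A\<close>, then X would be
  algebraic over k modulo U - u, hence constant there, against \<open>lin_not_dvd\<close>.\<close>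

lemma specialize_adjoin_X:
  assumes s: "s \<in> adjoin A {X}" "s \<noteq> 0" shows "specialize u (U.coord s) \<noteq> 0"
proof
  assume z: "specialize u (U.coord s) = 0"
  obtain q where q: "q \<in> polys_over A" "s = poly q X" using adjoin_poly[OF U.sA s(1)] by blast
  have qB: "q \<in> polys_over B" using q(1) U.AB by (auto simp: polys_over_def)
  have "U.coord s = poly (map_poly U.coord q) (U.coord X)"
    unfolding q(2) by (rule hom_poly[OF U.coord_hom U.sB qB X.gen_mem(1)])
  also have "map_poly U.coord q = map_poly (\<lambda>x. const3 (emb x)) q"
    using q(1) hom_0[OF U.coord_hom U.sB]
    by (intro poly_eqI) (auto simp: coeff_map_poly U.coord_simps polys_over_def U.emb_0)
  finally have "specialize u (U.coord s) = poly (map_poly (specialize u) (map_poly (\<lambda>x. const3 (emb x)) q)) (specialize u (U.coord X))"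
    using hom_poly[OF specialize_hom is_subring_UNIV] by simp
  also have "map_poly (specialize u) (map_poly (\<lambda>x. const3 (emb x)) q) = map_poly const2 (map_poly emb q)"
    by (intro poly_eqI) (simp add: coeff_map_poly U.emb_0 homU_simps(2)[OF specialize_hom] specialize_simps)
  finally have e: "evalc (specialize u (U.coord X)) (map_poly emb q) = 0" using z by simp
  have "q \<noteq> 0" using q s(2) by auto
  then have "emb (lead_coeff q) \<noteq> 0" using U.emb_eq_0 by (metis leading_coeff_0_iff)
  then have "map_poly emb q \<noteq> 0" using U.emb_0 by (metis coeff_0 coeff_map_poly)
  then obtain \<xi> where "specialize u (U.coord X) = const2 \<xi>" using evalc_inj e by blast
  then have "specialize u (U.coord X - const3 \<xi>) = 0"
    by (simp only: homU_simps[OF specialize_hom] specialize_simps(1) diff_self)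
  from specialize_eq_0[OF this] lin_not_dvd show False by blast
qed

text \<open>Descent from k[Y, Z] introduces denominators in A[X]. By
  \<open>specialize_adjoin_X\<close> they are divisible by no U - u, so the linear factors of
  \<open>g\<close> pass to \<open>c\<close> one by one.\<close>

lemma cancel_adjoin_X:
  assumes s: "s \<in> adjoin A {X}" "s \<noteq> 0" and g: "g \<noteq> 0" and d: "inU g dvd U.coord s * c"
  shows "inU g dvd c"
  using g d
proof (induction "degree g" arbitrary: g c rule: less_induct)
  case less
  show ?case
  proof (cases "degree g = 0")
    case True
    then have "is_unit g" using less.prems(1) by (simp add: is_unit_iff_degree)
    then have "is_unit (inU g)" by (simp add: is_unit_const_poly_iff)
    then show ?thesis by blast
  next
    case False
    then obtain u where "poly g u = 0" using alg_closed_imp_poly_has_root by blast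
    then obtain g' where g': "g = [:-u, 1:] * g'" by (auto simp: poly_eq_0_iff_dvd)
    have ig: "inU g = lin u * inU g'" unfolding g' by (rule homU_simps(4)[OF U.inU_hom])
    obtain z where z: "U.coord s * c = lin u * inU g' * z" using less.prems(2) unfolding ig by blast
    have "specialize u (lin u) = 0" by (simp add: specialize_simps)
    then have "specialize u (U.coord s) * specialize u c = 0"
      using arg_cong[OF z, of "specialize u"] by (simp only: homU_simps[OF specialize_hom] mult_zero_left)
    then have "specialize u c = 0" using specialize_adjoin_X[OF s] by auto
    from specialize_eq_0[OF this] obtain c' where c': "c = lin u * c'" by blast
    have "lin u * (U.coord s * c') = lin u * (inU g' * z)" using z unfolding c' by (simp only: mult_ac)
    then have "U.coord s * c' = inU g' * z" by (metis mult_cancel_left pCons_eq_0_iff one_neq_zero)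
    then have "inU g' dvd U.coord s * c'" by (metis dvd_triv_left)
    moreover have "g' \<noteq> 0" using g' less.prems by auto
    moreover from this have "degree g' < degree g" unfolding g' by (subst degree_mult_eq) auto
    ultimately have "inU g' dvd c'" using less.hyps by blast
    then show ?thesis unfolding ig c' by (rule mult_dvd_mono[OF dvd_refl])
  qed
qed

lemma submodule_multiples:
  assumes "a \<in> B" shows "X.lev2.submodule ((\<lambda>z. a * z) ` B)"
  unfolding X.lev2.submodule_def
proof (intro conjI ballI)
  show "0 \<in> (*) a ` B" using subring_0[OF U.sB] by force
  show "(*) a ` B \<subseteq> B" using assms subring_mult[OF U.sB] by auto
  fix x y assume "x \<in> (*) a ` B" "y \<in> (*) a ` B"
  then show "x + y \<in> (*) a ` B" using subring_add[OF U.sB] by (auto simp: distrib_left[symmetric])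
next
  fix s x assume "s \<in> adjoin A {X}" "x \<in> (*) a ` B"
  then obtain z where "z \<in> B" "s \<in> B" "x = a * z" using X.adjoin_a(1) by blast
  then show "s * x \<in> (*) a ` B"
    using subring_mult[OF U.sB, of s z] by (intro image_eqI[of _ _ "s * z"]) (simp_all add: mult.left_commute)
qed

text \<open>The expansion a^N b = p(V0) is to be divided by a^N. On k[Y, Z] this works
  coefficientwise by \<open>divide_all\<close>: a0 splits over k, so all prime factors of the image
  of a^N lie over U. Descent then puts s times each coefficient into a^N B for some nonzero s in
  A[X], and \<open>cancel_adjoin_X\<close> removes s in k[U, V, W].\<close>

theorem slice_divides:
  assumes b: "b \<in> B"
  shows "\<exists>p\<in>polys_over U.CT. U.coord b = poly p (U.coord U.V0)"
proof -
  let ?a = "coeff (\<delta> U.V0) U.n"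
  obtain N p where p: "p \<in> polys_over U.C" and e: "?a ^ N * b = poly p U.V0"
    using U.slice_expansion[OF U.V0_slice b] U.V0_props(2) by auto
  have aB: "?a ^ N \<in> B" using U.lead_V0(1) U.invariantD(1) subring_power[OF U.sB] by blast
  have pB: "p \<in> polys_over B" using p U.invariantD(1) by (auto simp: polys_over_def)
  have cB: "coeff p i \<in> B" for i using pB by (auto simp: polys_over_def)
  have Ua: "U.coord (?a ^ N) = inU (U.a0 ^ N)"
    using U.lead_V0(1) U.invariantD(1)
    by (simp only: hom_power[OF U.coord_hom U.sB] U.a0 homU_simps(7)[OF U.inU_hom])
  let ?w = "X.coord2 (?a ^ N)"
  have w: "?w = evalc U2 (U.a0 ^ N)" using spec_coord[OF aB] Ua spec_inU by metis
  have aN: "U.a0 ^ N \<noteq> 0" using U.lead_V0(3) by simp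
  have w0: "?w \<noteq> 0" using X.lev2.bc_eq_0[OF aB] U.lead_V0(2) by auto
  have e2: "?w * X.coord2 b = poly (map_poly X.coord2 p) V2"
    using arg_cong[OF e, of X.coord2] hom_poly[OF X.coord2_hom U.sB pB U.V0_props(1)]
      hom_mult[OF X.coord2_hom aB b] by simp
  have p2: "map_poly X.coord2 p \<in> polys_over C2"
    using p coord2_C2 hom_0[OF X.coord2_hom U.sB] by (auto simp: polys_over_def coeff_map_poly)
  have "\<exists>\<gamma>\<in>polys_over C2. map_poly X.coord2 p = smult ?w \<gamma>"
  proof (rule divide_all[OF w0 _ p2])
    show "over_U q" if "prime_elem q" "q dvd ?w" for q
      using prime_root[OF that(1) aN] that w unfolding over_U_def by metis
    show "?w dvd poly (map_poly X.coord2 p) V2" unfolding e2[symmetric] by simp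
  qed
  then obtain \<gamma> where \<gamma>: "map_poly X.coord2 p = smult ?w \<gamma>" by blast
  have "inU (U.a0 ^ N) dvd U.coord (coeff p i)" for i
  proof -
    let ?S = "(\<lambda>z. ?a ^ N * z) ` B"
    have c: "X.coord2 (coeff p i) = ?w * coeff \<gamma> i"
      using arg_cong[OF \<gamma>, of "\<lambda>p. coeff p i"] hom_0[OF X.coord2_hom U.sB] by (simp add: coeff_map_poly)
    obtain I :: "nat set" and e t where t: "finite I" "\<And>i. i \<in> I \<Longrightarrow> t i \<in> B" and r: "coeff \<gamma> i = (\<Sum>i\<in>I. const2 (e i) * X.coord2 (t i))"
      using X.lev2.indep_representation[of "coeff \<gamma> i"] by blast
    have "X.coord2 (coeff p i) = (\<Sum>i\<in>I. const2 (e i) * X.coord2 (?a ^ N * t i))"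
      unfolding c r sum_distrib_left
      by (intro sum.cong refl) (simp only: hom_mult[OF X.coord2_hom aB t(2)] mult.left_commute)
    then have "X.lev2.spanned ?S (X.coord2 (coeff p i))"
      using t by (intro X.lev2.spannedI[of I "\<lambda>i. ?a ^ N * t i"]) auto
    then obtain s where s: "s \<in> adjoin A {X}" "s \<noteq> 0" "s * coeff p i \<in> ?S"
      using X.lev2.descent[OF submodule_multiples[OF aB] cB] by metis
    then obtain z where z: "z \<in> B" "s * coeff p i = ?a ^ N * z" by blast
    have sB': "s \<in> B" using s(1) X.adjoin_a(1) by blast
    have "U.coord s * U.coord (coeff p i) = inU (U.a0 ^ N) * U.coord z"
      using arg_cong[OF z(2), of U.coord]
      by (simp only: hom_mult[OF U.coord_hom sB' cB] hom_mult[OF U.coord_hom aB z(1)] Ua)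
    then have "inU (U.a0 ^ N) dvd U.coord s * U.coord (coeff p i)" by (metis dvd_triv_left)
    then show ?thesis by (rule cancel_adjoin_X[OF s(1,2) aN])
  qed
  then have "[:inU (U.a0 ^ N):] dvd map_poly U.coord p"
    using hom_0[OF U.coord_hom U.sB] by (simp add: const_poly_dvd_iff coeff_map_poly)
  then obtain p' where p': "map_poly U.coord p = [:inU (U.a0 ^ N):] * p'" by blast
  have iN: "inU (U.a0 ^ N) \<noteq> 0" using aN by simp
  have "inU (U.a0 ^ N) * U.coord b = poly (map_poly U.coord p) (U.coord U.V0)"
    using arg_cong[OF e, of U.coord] hom_poly[OF U.coord_hom U.sB pB U.V0_props(1)]
      hom_mult[OF U.coord_hom aB b] Ua by simp
  also have "\<dots> = inU (U.a0 ^ N) * poly p' (U.coord U.V0)" unfolding p' by simp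
  finally have "U.coord b = poly p' (U.coord U.V0)" using iN by (metis mult_cancel_left)
  moreover have "coeff p' i \<in> U.CT" for i
  proof (cases "coeff p' i = 0")
    case True
    then show ?thesis using subring_0[OF U.sCT] by simp
  next
    case False
    have "inU (U.a0 ^ N) * coeff p' i = U.coord (coeff p i)"
      using arg_cong[OF p', of "\<lambda>p. coeff p i"] hom_0[OF U.coord_hom U.sB] by (simp add: coeff_map_poly)
    moreover have "U.coord (coeff p i) \<in> U.CT" using p by (intro U.coord_CT) (auto simp: polys_over_def)
    ultimately show ?thesis using U.CT_factorially_closed(2) iN False by (metis mult_eq_0_iff)
  qed
  ultimately show ?thesis by (auto simp: polys_over_def)
qed

text \<open>Over k, \<open>b\<close> is a polynomial in U, F and V0 by \<open>slice_divides\<close>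
  and \<open>CT_generated\<close>. As these three lie in \<open>B\<close>, \<open>descent\<close>
  brings the relation back to \<open>A\<close> at the price of a denominator.\<close>

theorem rank_one_generators:
  assumes b: "b \<in> B" shows "\<exists>s\<in>A. s \<noteq> 0 \<and> s * b \<in> adjoin A {U, U.F, U.V0}"
proof -
  let ?S = "adjoin A {U, U.F, U.V0}"
  have gB: "U \<in> B" "U.F \<in> B" "U.V0 \<in> B" using U.gen_mem U.F_props U.V0_props U.invariantD(1) by auto
  then have SB: "?S \<subseteq> B" using U.AB by (intro adjoin_least[OF U.sB]) auto
  note sS = is_subring_adjoin[of A "{U, U.F, U.V0}"]
  have gen: "U.lev3.spanned ?S (U.coord U)" "U.lev3.spanned ?S (U.coord U.F)" "U.lev3.spanned ?S (U.coord U.V0)"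
    by (auto intro!: U.lev3.spanned_bc adjoin_gen)
  have c: "U.lev3.spanned ?S (const3 e)" for e
    using U.lev3.spanned_const_bc[OF subring_1[OF sS], of e] hom_1[OF U.coord_hom] by simp
  have inU: "U.lev3.spanned ?S (inU p)" for p
  proof -
    have "inU p = poly (map_poly const3 p) (U.coord U)"
    proof (rule hom_poly_unique[where f = inU])
      show "ring_hom_on UNIV (\<lambda>p. poly (map_poly const3 p) (U.coord U))"
        by (rule hom_comp[OF hom_map_poly_UNIV[OF const3_hom] hom_eval])
    qed (simp_all add: U.inU_hom map_poly_pCons U.coord_simps)
    then show ?thesis using c gen SB sS by (simp add: U.lev3.spanned_poly coeff_map_poly)
  qed
  have CT: "U.lev3.spanned ?S c" if cC: "c \<in> U.CT" for c
  proof -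
    obtain H where "c = U.evalF H" using U.CT_generated[OF cC] by blast
    then show ?thesis unfolding U.evalF_def
      using inU gen SB sS by (simp add: U.lev3.spanned_poly coeff_map_poly)
  qed
  obtain p where "p \<in> polys_over U.CT" "U.coord b = poly p (U.coord U.V0)" using slice_divides[OF b] by blast
  then have sp: "U.lev3.spanned ?S (U.coord b)"
    using CT gen SB sS by (simp add: U.lev3.spanned_poly polys_over_def)
  have "U.lev3.submodule ?S"
    unfolding U.lev3.submodule_def using SB subringD[OF sS] adjoin_base[of _ A] by auto
  from U.lev3.descent[OF this b sp] show ?thesis by metis
qed

end

section \<open>Rank and triangularity\<close>

lemma localization_base: "x \<in> B \<Longrightarrow> 1 \<in> A \<Longrightarrow> to_fract (x :: 'b::idom) \<in> localization A B"
proof -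
  assume "x \<in> B" "1 \<in> A"
  moreover have "to_fract x = to_fract x / to_fract 1" by simp
  ultimately show "to_fract x \<in> localization A B"
    unfolding localization_def using one_neq_zero by blast
qed

lemma is_subring_localization:
  assumes A: "is_subring A" and B: "is_subring B" and AB: "A \<subseteq> B"
  shows "is_subring (localization A (B :: 'b::idom set))"
  unfolding is_subring_def
proof (intro conjI ballI)
  show "1 \<in> localization A B" using localization_base[OF subring_1[OF B] subring_1[OF A]] by simp
  fix x y assume "x \<in> localization A B" "y \<in> localization A B"
  then obtain b s c t where b: "b \<in> B" "s \<in> A - {0}" and c: "c \<in> B" "t \<in> A - {0}"
    and xy: "x = to_fract b / to_fract s" "y = to_fract c / to_fract t"
    unfolding localization_def by blast
  have st: "s * t \<in> A - {0}" using b c subring_mult[OF A] by auto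
  have "s \<in> B" "t \<in> B" using b c AB by auto
  then have m: "b * t - c * s \<in> B" "b * c \<in> B" using b c by (auto intro: subringD[OF B])
  have "x - y = to_fract (b * t - c * s) / to_fract (s * t)" "x * y = to_fract (b * c) / to_fract (s * t)"
    using b c by (simp_all add: xy field_simps)
  then show "x - y \<in> localization A B" "x * y \<in> localization A B"
    unfolding localization_def using m st by blast+
qed

context exp_map
begin

abbreviation "K \<equiv> localization A A"
abbreviation "L \<equiv> localization A B"
abbreviation "\<delta>K \<equiv> extend_exp A B \<delta>"

lemma exp_map_localization: "exp_map K L \<delta>K"
proof
  show "is_subring K" by (rule is_subring_localization[OF sA sA order_refl])
  show "is_subring L" by (rule is_subring_localization[OF sA sB AB])
  show "K \<subseteq> L" using AB by (auto simp: localization_def)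
  show "\<delta>K \<in> EXP K L" by (rule extend_exp_in_EXP[OF sA sB AB \<delta>])
qed

lemma to_fract_adjoin: "x \<in> adjoin A S \<Longrightarrow> to_fract x \<in> adjoin K (to_fract ` S)"
proof -
  let ?R = "{x. to_fract x \<in> adjoin K (to_fract ` S)}"
  have "is_subring ?R"
    using subringD[OF is_subring_adjoin[of K "to_fract ` S"]] by (auto simp: is_subring_def)
  moreover have "A \<subseteq> ?R" using localization_base[OF _ subring_1[OF sA]] adjoin_base by fast
  moreover have "S \<subseteq> ?R" by (auto intro: adjoin_gen)
  ultimately show "x \<in> adjoin A S \<Longrightarrow> to_fract x \<in> adjoin K (to_fract ` S)"
    using adjoin_least by blast
qed

text \<open>The denominators become invertible in \<open>K\<close>, so the triple generates
  \<open>L\<close>; listing the two invariants first makes them the 3 - 1 invariant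
  coordinates.\<close>

lemma exp_rank_localization_le_1:
  assumes P: "P \<in> C" "Q \<in> C" "S \<in> B"
    and gen: "\<And>b. b \<in> B \<Longrightarrow> \<exists>s\<in>A. s \<noteq> 0 \<and> s * b \<in> adjoin A {P, Q, S}"
  shows "exp_rank K L 3 \<delta>K \<le> 1"
proof -
  interpret loc: exp_map K L \<delta>K by (rule exp_map_localization)
  let ?f = "to_fract :: 'b \<Rightarrow> 'b fract"
  let ?X = "[?f P, ?f Q, ?f S]"
  have PB: "P \<in> B" "Q \<in> B" using P invariantD(1) by auto
  have "adjoin K (set ?X) \<subseteq> L"
    using PB P localization_base[OF _ subring_1[OF sA]] by (intro adjoin_least loc.sB loc.AB) auto
  moreover have "x \<in> adjoin K (set ?X)" if xL: "x \<in> L" for x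
  proof -
    obtain b s where b: "b \<in> B" "s \<in> A - {0}" and x: "x = ?f b / ?f s"
      using xL unfolding localization_def by blast
    obtain t where t: "t \<in> A" "t \<noteq> 0" "t * b \<in> adjoin A {P, Q, S}" using gen[OF b(1)] by blast
    have "?f (t * b) \<in> adjoin K (set ?X)" using to_fract_adjoin[OF t(3)] by simp
    moreover have "?f 1 / ?f (t * s) \<in> K"
      unfolding localization_def using t b subring_mult[OF sA] subring_1[OF sA] by fastforce
    then have "?f 1 / ?f (t * s) \<in> adjoin K (set ?X)" by (rule adjoin_base)
    ultimately have "?f (t * b) * (?f 1 / ?f (t * s)) \<in> adjoin K (set ?X)"
      by (rule subring_mult[OF is_subring_adjoin])
    moreover have "x = ?f (t * b) * (?f 1 / ?f (t * s))" using t b by (simp add: x)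
    ultimately show ?thesis by simp
  qed
  ultimately have co: "?X \<in> coord_systems K L 3"
    unfolding coord_systems_def by auto
  have inv: "?f x \<in> loc.C" if x: "x \<in> C" for x
  proof -
    have "\<delta>K (?f x / ?f 1) = [:?f x:]"
      using extend_exp_frac[OF AB \<delta> invariantD(1)[OF x], of 1] invariantD(2)[OF x] subring_1[OF sA]
      by (simp add: map_poly_pCons)
    then show ?thesis
      using localization_base[OF invariantD(1)[OF x] subring_1[OF sA]] by (simp add: invariants_def)
  qed
  have "adjoin K (set (take (3 - 1) ?X)) \<subseteq> loc.C"
    using inv P by (intro adjoin_least loc.is_subring_invariants loc.base_invariants) (auto simp: numeral_2_eq_2)
  then show ?thesis unfolding exp_rank_def by (intro Least_le conjI bexI[OF _ co]) simp_all
qed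

text \<open>A local slice with leading coefficient in \<open>A\<close> can be completed by invariants: modulo the
  slice, the other two generators agree with invariants up to a factor in \<open>A\<close>.\<close>

lemma slice_over_base:
  assumes gen: "B = adjoin A {U, V, W}" and U: "local_slice B \<delta> U"
    and a: "coeff (\<delta> U) (degree (\<delta> U)) \<in> A"
  shows "\<exists>P\<in>C. \<exists>Q\<in>C. \<forall>b\<in>B. \<exists>s\<in>A. s \<noteq> 0 \<and> s * b \<in> adjoin A {P, Q, U}"
proof -
  let ?a = "coeff (\<delta> U) (degree (\<delta> U))"
  note sC = is_subring_invariants
  have UB: "U \<in> B" and n: "degree (\<delta> U) > 0" using U by (auto simp: local_slice_def)
  have VB: "V \<in> B" "W \<in> B" unfolding gen by (auto intro: adjoin_gen)
  have a0: "?a \<noteq> 0" using n by auto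
  have aA: "?a ^ m \<in> A" for m by (rule subring_power[OF sA a])
  have aB: "?a ^ m \<in> B" for m using aA AB by blast
  have UC: "U \<notin> C" using n invariant_iff_degree[OF UB] by simp
  have red: "\<exists>N. \<exists>P\<in>C. \<exists>z\<in>B. ?a ^ N * x = P + U * z" if x: "x \<in> B" for x
  proof -
    obtain N p where p: "p \<in> polys_over C" "?a ^ N * x = poly p U" using slice_expansion[OF U x] by blast
    obtain P q where pq: "p = pCons P q" by (cases p) auto
    have "P \<in> C" using p(1) by (auto simp: pq polys_over_def dest: spec[of _ 0])
    moreover have "coeff q i \<in> B" for i
      using p(1) invariantD(1) by (auto simp: pq polys_over_def dest: spec[of _ "Suc i"])
    then have "poly q U \<in> B" by (intro poly_polys_over[OF sB _ UB]) (simp add: polys_over_def)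
    ultimately show ?thesis using p(2) pq by auto
  qed
  obtain M P z where P: "P \<in> C" "z \<in> B" "?a ^ M * V = P + U * z" using red[OF VB(1)] by blast
  obtain N Q y where Q: "Q \<in> C" "y \<in> B" "?a ^ N * W = Q + U * y" using red[OF VB(2)] by blast
  let ?D = "adjoin A {P, Q}" and ?E = "adjoin A {P, Q, U}"
  note sD = is_subring_adjoin[of A "{P, Q}"] and sE = is_subring_adjoin[of A "{P, Q, U}"]
  have DC: "?D \<subseteq> C" using P Q by (intro adjoin_least sC base_invariants) auto
  have DE: "?D \<subseteq> ?E" by (intro adjoin_least sE) (auto intro: adjoin_base adjoin_gen)
  \<comment> \<open>The elements that lie in A[P, Q] modulo U, up to a power of the leading
    coefficient. They form a subring containing all generators, hence all of
    \<open>B\<close>.\<close>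
  let ?R = "{x \<in> B. \<exists>m. \<exists>h\<in>?D. \<exists>z\<in>B. ?a ^ m * x = h + U * z}"
  have "is_subring ?R"
    unfolding is_subring_def
  proof (intro conjI ballI)
    have "?a ^ 0 * 1 = 1 + U * 0" by simp
    then show "1 \<in> ?R" using subringD[OF sB] subring_1[OF sD] by blast
    fix x y assume "x \<in> ?R" "y \<in> ?R"
    then obtain m h z m' h' z' where x: "x \<in> B" "h \<in> ?D" "z \<in> B" "?a ^ m * x = h + U * z"
      and y: "y \<in> B" "h' \<in> ?D" "z' \<in> B" "?a ^ m' * y = h' + U * z'" by blast
    have hB: "h \<in> B" "h' \<in> B" using x y DC invariantD(1) by auto
    have aD: "?a ^ k \<in> ?D" for k using aA adjoin_base by blast
    have "?a ^ (m + m') * (x - y) = ?a ^ m' * (?a ^ m * x) - ?a ^ m * (?a ^ m' * y)"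
      by (simp add: power_add algebra_simps)
    also have "\<dots> = (?a ^ m' * h - ?a ^ m * h') + U * (?a ^ m' * z - ?a ^ m * z')"
      unfolding x y by (simp add: algebra_simps)
    finally have e1: "?a ^ (m + m') * (x - y) = \<dots>" .
    have "?a ^ (m + m') * (x * y) = (?a ^ m * x) * (?a ^ m' * y)" by (simp add: power_add algebra_simps)
    also have "\<dots> = h * h' + U * (h * z' + z * h' + U * (z * z'))"
      unfolding x y by (simp add: algebra_simps)
    finally have e2: "?a ^ (m + m') * (x * y) = \<dots>" .
    have 1: "?a ^ m' * h - ?a ^ m * h' \<in> ?D" "h * h' \<in> ?D" using x y aD subringD[OF sD] by auto
    have 2: "?a ^ m' * z - ?a ^ m * z' \<in> B" "h * z' + z * h' + U * (z * z') \<in> B"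
      using x y hB UB aB subringD[OF sB] by auto
    show "x - y \<in> ?R" using e1 1(1) 2(1) subring_diff[OF sB x(1) y(1)] by blast
    show "x * y \<in> ?R" using e2 1(2) 2(2) subring_mult[OF sB x(1) y(1)] by blast
  qed
  moreover have "A \<subseteq> ?R"
  proof
    fix x assume "x \<in> A"
    then have "x \<in> B" "x \<in> ?D" "?a ^ 0 * x = x + U * 0" using AB adjoin_base by auto
    then show "x \<in> ?R" using subring_0[OF sB] by blast
  qed
  moreover have "U \<in> ?R"
  proof -
    have "?a ^ 0 * U = 0 + U * 1" by simp
    then show ?thesis using UB subringD[OF sB] subring_0[OF sD] by blast
  qed
  moreover have "V \<in> ?R" "W \<in> ?R"
    using P Q VB adjoin_gen[of P "{P, Q}" A] adjoin_gen[of Q "{P, Q}" A] by blast+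
  ultimately have BR: "B \<subseteq> ?R" by (subst gen, intro adjoin_least) auto
  \<comment> \<open>For an invariant \<open>c\<close> the remainder U z is invariant too, so it
    vanishes, because U is not invariant.\<close>
  have CD: "\<exists>m. ?a ^ m * c \<in> ?D" if c: "c \<in> C" for c
  proof -
    obtain m h z where h: "h \<in> ?D" "z \<in> B" "?a ^ m * c = h + U * z"
      using BR invariantD(1)[OF c] by blast
    have "?a ^ m * c - h \<in> C" using c h(1) DC aA base_invariants by (intro subringD[OF sC]) auto
    then have "U * z \<in> C" using h(3) by simp
    then have "U * z = 0" using factorially_closed(1)[OF UB h(2)] UC by blast
    then show ?thesis using h by auto
  qed
  \<comment> \<open>This subring contains \<open>C\<close> and U, hence the value of every slice
    expansion.\<close>
  let ?T = "{x \<in> B. \<exists>m. ?a ^ m * x \<in> ?E}"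
  have sT: "is_subring ?T"
    unfolding is_subring_def
  proof (intro conjI ballI)
    have "?a ^ 0 * 1 \<in> ?E" using subring_1[OF sE] by simp
    then show "1 \<in> ?T" using subring_1[OF sB] by blast
    fix x y assume "x \<in> ?T" "y \<in> ?T"
    then obtain m m' where x: "x \<in> B" "?a ^ m * x \<in> ?E" and y: "y \<in> B" "?a ^ m' * y \<in> ?E" by blast
    have aE: "?a ^ k \<in> ?E" for k using aA adjoin_base by blast
    have e1: "?a ^ (m + m') * (x - y) = ?a ^ m' * (?a ^ m * x) - ?a ^ m * (?a ^ m' * y)"
      and e2: "?a ^ (m + m') * (x * y) = (?a ^ m * x) * (?a ^ m' * y)"
      by (simp_all add: power_add algebra_simps)
    have "?a ^ (m + m') * (x - y) \<in> ?E" "?a ^ (m + m') * (x * y) \<in> ?E"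
      unfolding e1 e2 by (intro subringD[OF sE] aE x(2) y(2))+
    then show "x - y \<in> ?T" "x * y \<in> ?T" using subringD[OF sB] x y by blast+
  qed
  have CT: "C \<subseteq> ?T" using CD DE invariantD(1) by blast
  have "?a ^ 0 * U \<in> ?E" using adjoin_gen[of U "{P, Q, U}" A] by simp
  then have UT: "U \<in> ?T" using UB by blast
  have "\<exists>s\<in>A. s \<noteq> 0 \<and> s * b \<in> ?E" if b: "b \<in> B" for b
  proof -
    obtain k p where p: "p \<in> polys_over C" "?a ^ k * b = poly p U" using slice_expansion[OF U b] by blast
    have "p \<in> polys_over ?T" using p(1) CT by (auto simp: polys_over_def)
    then have "poly p U \<in> ?T" by (rule poly_polys_over[OF sT _ UT])
    then obtain m where "?a ^ m * (?a ^ k * b) \<in> ?E" using p(2) by auto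
    then have "?a ^ (m + k) * b \<in> ?E" by (simp add: power_add mult.assoc)
    then show ?thesis using aA a0 by (intro bexI[of _ "?a ^ (m + k)"]) auto
  qed
  then show ?thesis using P(1) Q(1) by blast
qed

end

text \<open>The degree of a composition is the product of the degrees. Each application removes one
  outer variable from the coordinates of an element.\<close>

lemma poly_const_degree:
  fixes y :: "'r::idom poly" and h :: "'k::zero \<Rightarrow> 'r"
  assumes h: "h 0 = 0" "\<And>c. h c = 0 \<Longrightarrow> c = 0" and G: "degree G > 0"
    and e: "poly (map_poly (\<lambda>c. [:h c:]) G) y = [:z:]"
  shows "\<exists>y'. y = [:y':] \<and> poly (map_poly h G) y' = z"
proof -
  have "map_poly (\<lambda>c. [:h c:]) G = map_poly (\<lambda>c. [:c:]) (map_poly h G)"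
    by (intro poly_eqI) (simp add: coeff_map_poly h)
  then have "pcompose (map_poly h G) y = [:z:]" using e by (simp add: pcompose_altdef)
  moreover have "degree (map_poly h G) = degree G" using h(2) by (intro degree_map_poly) auto
  ultimately have "degree G * degree y = 0" by (metis degree_pcompose degree_pCons_0)
  then obtain y' where y: "y = [:y':]" using G by (auto elim: degree_eq_zeroE)
  have "poly (map_poly (\<lambda>c. [:c:]) p) [:x:] = [:poly p x:]" for p and x :: 'r
    by (induction p) (auto simp: map_poly_pCons)
  then show ?thesis using e y \<open>map_poly (\<lambda>c. [:h c:]) G = _\<close> by simp
qed

text \<open>If \<open>a\<close> is a polynomial in \<open>x\<close>, comparing degrees in the other
  two variables shows that \<open>x\<close> involves neither of them. For the coordinates U and X
  this means that U in A[X] already gives A[U] = A[X].\<close>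

lemma (in coordinates) first_variable_in_adjoin:
  assumes x: "x \<in> B" and a: "a \<in> adjoin A {x}"
  shows "x \<in> adjoin A {a}"
proof -
  obtain q where q: "q \<in> polys_over A" "a = poly q x" using adjoin_poly[OF sA a] by blast
  let ?G = "map_poly emb q"
  have qB: "q \<in> polys_over B" using q base_mem by (auto simp: polys_over_def)
  have "var1 = poly (map_poly coord q) (coord x)"
    using hom_poly[OF coord_hom sB' qB x] q(2) coord_simps(2) by simp
  also have "map_poly coord q = map_poly const3 ?G"
    using q(1) hom_0[OF coord_hom sB']
    by (intro poly_eqI) (auto simp: coeff_map_poly coord_simps(1) polys_over_def emb_0)
  finally have e: "poly (map_poly const3 ?G) (coord x) = var1" ..
  have "degree ?G > 0"
  proof (rule ccontr)
    assume "\<not> ?thesis"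
    then obtain c where "?G = [:c:]" by (auto elim: degree_eq_zeroE)
    then show False using e by (simp add: map_poly_pCons)
  qed
  from poly_const_degree[OF _ _ this e] obtain y where y: "coord x = [:y:]"
    "poly (map_poly const2 ?G) y = [:[:0, 1:]:]" by auto
  from poly_const_degree[OF _ _ \<open>degree ?G > 0\<close> y(2)] obtain y' where "y = [:y':]" by auto
  then show ?thesis using coord_first[OF x] y(1) by simp
qed

definition emb_ac :: "'b::idom \<Rightarrow> 'b fract alg_closure" where
  "emb_ac x = to_ac (to_fract x)"

lemma field_embedding_ac: "field_embedding emb_ac"
  by unfold_locales (simp_all add: ring_hom_on_def emb_ac_def)

lemma coord_systems_3: "xs \<in> coord_systems A B 3 \<Longrightarrow> \<exists>U V W. xs = [U, V, W] \<and> B = adjoin A {U, V, W}"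
  by (auto simp: coord_systems_def numeral_eq_Suc length_Suc_conv)

lemma coord_systems_2: "xs \<in> coord_systems A B 2 \<Longrightarrow> \<exists>P Q. xs = [P, Q] \<and> B = adjoin A {P, Q}"
  by (auto simp: coord_systems_def numeral_eq_Suc length_Suc_conv)

lemma lead_coeff_pCons_0:
  fixes p :: "'a::comm_ring_1 poly"
  assumes "p - [:x:] = pCons 0 q" "degree p > 0" "q \<in> polys_over R"
  shows "coeff p (degree p) \<in> R"
proof -
  obtain m where m: "degree p = Suc m" using assms(2) gr0_implies_Suc by blast
  have "p = pCons 0 q + [:x:]" using assms(1) unfolding diff_eq_eq .
  then have "coeff p (Suc m) = coeff q m" by (simp add: coeff_pCons)
  then show ?thesis using assms(3) m by (simp add: polys_over_def)
qed

lemma EXP_adjoin_invariant: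
  assumes "exp_map A B \<delta>" "X \<in> invariants B \<delta>"
  shows "\<delta> \<in> EXP (adjoin A {X}) B"
proof -
  interpret exp_map A B \<delta> by (rule assms(1))
  have "adjoin A {X} \<subseteq> C"
    using assms(2) by (intro adjoin_least is_subring_invariants base_invariants) auto
  then have "\<delta> a = [:a:]" if "a \<in> adjoin A {X}" for a using that invariantD(2) by blast
  then show ?thesis using \<delta> unfolding EXP_def by blast
qed

theorem proposition5p4:
  fixes A B :: "'b::idom set" and \<delta> :: "'b \<Rightarrow> 'b poly" and X Y Z :: 'b
  assumes "is_subring A"
    and "is_polynomial_ring A B 3"
    and "\<delta> \<in> EXP A B"
    and "[X, Y, Z] \<in> coord_systems A B 3"
    and "X \<in> invariants B \<delta>"
    and "exp_rank A B 3 \<delta> = 2"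
    and "exp_rank (localization A A) (localization A B) 3 (extend_exp A B \<delta>) = 2"
  shows "triangular A B 3 \<delta> \<longleftrightarrow> triangular (adjoin A {X}) B 2 \<delta>"
proof -
  have BX: "B = adjoin A {X, Y, Z}" using assms(4) coord_systems_3 by blast
  interpret exp_map A B \<delta>
  proof
    show "is_subring B" unfolding BX by (rule is_subring_adjoin)
    show "A \<subseteq> B" unfolding BX by (auto intro: adjoin_base)
  qed (use assms in auto)
  \<comment> \<open>All contradictions below are drawn in this form: such a triple would give
    \<open>\<delta>K\<close> rank at most 1.\<close>
  have no_rank_one: "\<not> (\<forall>b\<in>B. \<exists>s\<in>A. s \<noteq> 0 \<and> s * b \<in> adjoin A {P, Q, S})"
    if "P \<in> C" "Q \<in> C" "S \<in> B" for P Q S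
    using exp_rank_localization_le_1[OF that] assms(7) by auto
  have coordinates: "coordinates emb_ac A B P Q S" if "B = adjoin A {P, Q, S}" for P Q S
    unfolding coordinates_def coordinates_axioms_def
    using field_embedding_ac sA that generators_independent[OF sA assms(2) that] by blast
  show ?thesis
  proof
    assume "triangular A B 3 \<delta>"
    then obtain xs where xs: "xs \<in> coord_systems A B 3"
      and t0: "\<exists>p\<in>polys_over A. \<delta> (xs ! 0) - [:xs ! 0:] = pCons 0 p"
      and ti: "\<And>i. 0 < i \<Longrightarrow> i < 3 \<Longrightarrow> \<exists>p\<in>polys_over (adjoin A (set (take i xs))). \<delta> (xs ! i) - [:xs ! i:] = pCons 0 p"
      and sl: "\<And>i. i < 3 \<Longrightarrow> \<delta> (xs ! i) \<noteq> [:xs ! i:] \<Longrightarrow> (\<forall>j<i. \<delta> (xs ! j) = [:xs ! j:]) \<Longrightarrow> local_slice B \<delta> (xs ! i)"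
      unfolding triangular_def by auto
    obtain U V W where uvw: "xs = [U, V, W]" and BU: "B = adjoin A {U, V, W}"
      using coord_systems_3[OF xs] by blast
    have mem: "U \<in> B" "V \<in> B" "W \<in> B" unfolding BU by (auto intro: adjoin_gen)
    obtain p where p: "p \<in> polys_over A" "\<delta> U - [:U:] = pCons 0 p" using t0 uvw by auto
    obtain q where q: "q \<in> polys_over (adjoin A {U})" "\<delta> V - [:V:] = pCons 0 q" using ti[of 1] uvw by auto
    obtain r where r: "r \<in> polys_over (adjoin A {U, V})" "\<delta> W - [:W:] = pCons 0 r"
      using ti[of 2] uvw by (auto simp: numeral_2_eq_2)
    have U: "\<delta> U = [:U:]"
    proof (rule ccontr)
      assume "\<delta> U \<noteq> [:U:]"
      then have slU: "local_slice B \<delta> U" using sl[of 0] uvw by simp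
      then have "coeff (\<delta> U) (degree (\<delta> U)) \<in> A"
        using lead_coeff_pCons_0[OF p(2) _ p(1)] by (simp add: local_slice_def)
      from slice_over_base[OF BU slU this] show False using no_rank_one mem by blast
    qed
    then have UC: "U \<in> C" using mem by (simp add: invariants_def)
    \<comment> \<open>Were V invariant as well, the triple U, V, W itself would violate
      \<open>no_rank_one\<close>, with s = 1.\<close>
    have V: "\<delta> V \<noteq> [:V:]"
    proof
      assume "\<delta> V = [:V:]"
      then have "V \<in> C" using mem by (simp add: invariants_def)
      moreover have "\<forall>b\<in>B. \<exists>s\<in>A. s \<noteq> 0 \<and> s * b \<in> adjoin A {U, V, W}"
        using subring_1[OF sA] BU by (intro ballI bexI[of _ 1]) auto
      ultimately show False using no_rank_one UC mem by blast
    qed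
    then have slV: "local_slice B \<delta> V" using sl[of 1] U uvw by simp
    then have leadV: "coeff (\<delta> V) (degree (\<delta> V)) \<in> adjoin A {U}"
      using lead_coeff_pCons_0[OF q(2) _ q(1)] by (simp add: local_slice_def)
    interpret cU: coordinates emb_ac A B U V W by (rule coordinates[OF BU])
    interpret cX: coordinates emb_ac A B X Y Z by (rule coordinates[OF BX])
    have UX: "U \<in> adjoin A {X}"
    proof (rule ccontr)
      assume "U \<notin> adjoin A {X}"
      then interpret two_coordinates A B \<delta> emb_ac U V W X Y Z
        by unfold_locales (use UC slV leadV assms(5) in auto)
      show False
        using no_rank_one[OF UC U.F_props(1) U.V0_props(1)] rank_one_generators by blast
    qed
    have XU: "X \<in> adjoin A {U}"
      by (rule cU.first_variable_in_adjoin[OF cX.gen_mem(1) UX])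
    have eq: "adjoin A {X} = adjoin A {U}"
      using UX XU by (intro equalityI adjoin_least is_subring_adjoin) (auto intro: adjoin_base)
    show "triangular (adjoin A {X}) B 2 \<delta>"
      unfolding triangular_def
    proof (intro conjI bexI[of _ "[V, W]"] impI allI)
      show "\<delta> \<in> EXP (adjoin A {X}) B" by (rule EXP_adjoin_invariant[OF exp_map_axioms assms(5)])
      show "[V, W] \<in> coord_systems (adjoin A {X}) B 2"
        unfolding coord_systems_def eq by (simp add: adjoin_adjoin BU)
      show "\<exists>p\<in>polys_over (adjoin A {X}). \<delta> ([V, W] ! 0) - [:[V, W] ! 0:] = pCons 0 p"
        using q eq by auto
      show "\<exists>p\<in>polys_over (adjoin (adjoin A {X}) (set (take i [V, W]))). \<delta> ([V, W] ! i) - [:[V, W] ! i:] = pCons 0 p"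
        if "0 < i \<and> i < 2" for i
      proof -
        have "i = 1" using that by auto
        then show ?thesis using r by (auto simp: eq adjoin_adjoin insert_commute)
      qed
      show "local_slice B \<delta> ([V, W] ! i)"
        if "i < 2" "\<delta> ([V, W] ! i) \<noteq> [:[V, W] ! i:] \<and> (\<forall>j<i. \<delta> ([V, W] ! j) = [:[V, W] ! j:])" for i
        using that slV V by (cases i) auto
    qed
  next
    assume "triangular (adjoin A {X}) B 2 \<delta>"
    then obtain xs where xs: "xs \<in> coord_systems (adjoin A {X}) B 2"
      and t0: "\<exists>p\<in>polys_over (adjoin A {X}). \<delta> (xs ! 0) - [:xs ! 0:] = pCons 0 p"
      and ti: "\<And>i. 0 < i \<Longrightarrow> i < 2 \<Longrightarrow> \<exists>p\<in>polys_over (adjoin (adjoin A {X}) (set (take i xs))). \<delta> (xs ! i) - [:xs ! i:] = pCons 0 p"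
      and sl: "\<And>i. i < 2 \<Longrightarrow> \<delta> (xs ! i) \<noteq> [:xs ! i:] \<Longrightarrow> (\<forall>j<i. \<delta> (xs ! j) = [:xs ! j:]) \<Longrightarrow> local_slice B \<delta> (xs ! i)"
      unfolding triangular_def by auto
    obtain P Q where pq: "xs = [P, Q]" and BP: "B = adjoin (adjoin A {X}) {P, Q}"
      using coord_systems_2[OF xs] by blast
    have dX: "\<delta> X = [:X:]" using assms(5) by (simp add: invariants_def)
    show "triangular A B 3 \<delta>"
      unfolding triangular_def
    proof (intro conjI bexI[of _ "[X, P, Q]"] impI allI)
      show "\<delta> \<in> EXP A B" by (rule \<delta>)
      show "[X, P, Q] \<in> coord_systems A B 3"
        unfolding coord_systems_def by (simp add: BP adjoin_adjoin insert_commute)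
      show "\<exists>p\<in>polys_over A. \<delta> ([X, P, Q] ! 0) - [:[X, P, Q] ! 0:] = pCons 0 p"
        using subring_0[OF sA] by (intro bexI[of _ 0]) (simp_all add: dX polys_over_def)
      show "\<exists>p\<in>polys_over (adjoin A (set (take i [X, P, Q]))). \<delta> ([X, P, Q] ! i) - [:[X, P, Q] ! i:] = pCons 0 p"
        if "0 < i \<and> i < 3" for i
      proof -
        have "i = 1 \<or> i = 2" using that by linarith
        then show ?thesis
          using t0 ti[of 1] pq by (elim disjE) (auto simp: adjoin_adjoin numeral_2_eq_2 insert_commute)
      qed
      \<comment> \<open>Prepending the invariant X shifts the indices by one and leaves the first
        moved coordinate the same.\<close>
      show "local_slice B \<delta> ([X, P, Q] ! i)"
        if "i < 3" "\<delta> ([X, P, Q] ! i) \<noteq> [:[X, P, Q] ! i:] \<and> (\<forall>j<i. \<delta> ([X, P, Q] ! j) = [:[X, P, Q] ! j:])" for i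
      proof (cases i)
        case 0
        then show ?thesis using that(2) dX by simp
      next
        case (Suc k)
        have "\<delta> (xs ! k) \<noteq> [:xs ! k:]" using that(2) Suc pq by simp
        moreover have "\<forall>j<k. \<delta> (xs ! j) = [:xs ! j:]"
          using that(2) Suc pq by (metis Suc_less_eq nth_Cons_Suc)
        ultimately show ?thesis using sl[of k] that(1) Suc pq by simp
      qed
    qed
  qed
qed

end
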